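(* Let $A_i\in\mathbb{C}_{\rm H}^{m_i}$ and $B_i\in\mathbb{C}^{m_i\times n}$ be given for $i=1,2$, and let $$M=\begin{bmatrix} A_1 & 0 & B_1\\ 0 & -A_2 & B_2\\ B_1^{*} & B_2^{*} & 0\end{bmatrix},\quad N=\begin{bmatrix} A_1 & B_1 & 0\\ B_1^{*} & 0 & B_2^{*}\end{bmatrix},\quad M_1=\begin{bmatrix} A_1 & B_1\\ B_1^{*} & 0\end{bmatrix}.$$ Assume that there exists $X\in\mathbb{C}_{\rm H}^{n}$ such that $B_2XB_2^{*}\preccurlyeq A_2$, i.e., $i_{+}\begin{bmatrix} A_2 & B_2\\ B_2^{*} & 0\end{bmatrix}=r[\,A_2,\,B_2\,]$, and let ${\cal T}_2=\{X\in\mathbb{C}_{\rm H}^{n} \mid B_2XB_2^{*}\preccurlyeq A_2\}$. Then $$\max_{X\in{\cal T}_2} r(A_1-B_1XB_1^{*}) = r[\,A_1,\,B_1\,],$$ $$\min_{X\in{\cal T}_2} r(A_1-B_1XB_1^{*}) = 2r[\,A_1,\,B_1\,]+i_{+}(M)-i_{+}(M_1)-r(N),$$ $$\max_{X\in{\cal T}_2} i_{+}(A_1-B_1XB_1^{*}) = i_{+}(M_1),$$ $$\min_{X\in{\cal T}_2} i_{+}(A_1-B_1XB_1^{*}) = r[\,A_1,\,B_1\,]-r(N)+i_{+}(M),$$ $$\max_{X\in{\cal T}_2} i_{-}(A_1-B_1XB_1^{*}) = i_{-}(M)-r[\,A_2,\,B_2\,],$$ $$\min_{X\in{\cal T}_2}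 i_{-}(A_1-B_1XB_1^{*}) = r[\,A_1,\,B_1\,]-i_{+}(M_1).$$ In consequence, the following hold. (a) There exists $X\in{\cal T}_2$ such that $A_1-B_1XB_1^{*}$ is nonsingular if and only if $r[\,A_1,\,B_1\,]=m_1$. (b) $A_1-B_1XB_1^{*}$ is nonsingular for every $X\in{\cal T}_2$ if and only if $i_{+}(M)=i_{+}(M_1)+r(N)-m_1$. (c) There exists $X\in{\cal T}_2$ such that $B_1XB_1^{*}=A_1$ if and only if ${\mathscr R}(A_1)\subseteq{\mathscr R}(B_1)$ and $i_{+}(M)=r\begin{bmatrix} B_1\\ B_2\end{bmatrix}$. (d) There exists $X\in{\cal T}_2$ such that $B_1XB_1^{*}\prec A_1$ if and only if $i_{+}(M_1)=m_1$. (e) There exists $X\in{\cal T}_2$ such that $B_1XB_1^{*}\succ A_1$ if and only if $i_{-}(M)=r[\,A_2,\,B_2\,]+m_1$. (f) There exists $X\in{\cal T}_2$ such that $B_1XB_1^{*}\preccurlyeq A_1$ if and only if $i_{+}(M_1)=r[\,A_1,\,B_1\,]$. (g) There exists $X\in{\cal T}_2$ such that $B_1XB_1^{*}\succcurlyeq A_1$ if and only if $i_{+}(M)=r(N)-r[\,A_1,\,B_1\,]$. (h) $B_1XB_1^{*}\preccurlyeq A_1$ holds for all $X\in{\cal T}_2$, i.e., ${\cal T}_2\subseteq\{X\in\mathbb{C}_{\rm H}^{n}\mid B_1XB_1^{*}\preccurlyeq A_1\}$, if and only if $i_{-}(M)=r[\,A_2,\,B_2\,]$. (i) $r(A_1-B_1XB_1^{*})$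 takes the same value for all $X\in{\cal T}_2$ if and only if $i_{+}(M)=i_{+}(M_1)+r(N)-r[\,A_1,\,B_1\,]$. (j) $i_{+}(A_1-B_1XB_1^{*})$ takes the same value for all $X\in{\cal T}_2$ if and only if $i_{+}(M_1)+r(N)=r[\,A_1,\,B_1\,]+i_{+}(M)$. (k) $i_{-}(A_1-B_1XB_1^{*})$ takes the same value for all $X\in{\cal T}_2$ if and only if $i_{-}(M)+i_{+}(M_1)=r[\,A_1,\,B_1\,]+r[\,A_2,\,B_2\,]$.
   Context: $\mathbb{C}^{m\times n}$ is the set of $m\times n$ complex matrices and $\mathbb{C}_{\rm H}^{m}$ is the set of $m\times m$ complex Hermitian matrices. $r(\cdot)$ is rank, ${\mathscr R}(\cdot)$ is range (column space), $A^{*}$ is the conjugate transpose. $i_{+}(A)$ and $i_{-}(A)$ are the numbers of positive and negative eigenvalues of a Hermitian matrix $A$, counted with multiplicity. $[\,A,\,B\,]$ is the row block matrix. For Hermitian $P,Q$, $P\succcurlyeq Q$ ($P\succ Q$) means $P-Q$ is positive semi-definite (positive definite); $P\preccurlyeq Q$ ($P\prec Q$) means $Q\succcurlyeq P$ ($Q\succ P$).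
   Formalization: In (b) the right-hand condition additionally requires r[A1,B1]=m1, because (b) as printed fails, e.g. for A1=diag(1,0), B1=(1,0)^T, A2=0, B2=0 with m2=n=1. *)

theory Defs
  imports
    "Jordan_Normal_Form.Char_Poly"
    "Jordan_Normal_Form.Schur_Decomposition"
    "Jordan_Normal_Form.DL_Rank"
begin

definition herm_mats :: "nat \<Rightarrow> complex mat set" where
  "herm_mats m = {A \<in> carrier_mat m m. mat_adjoint A = A}"

definition append_cols :: "'a :: zero mat \<Rightarrow> 'a mat \<Rightarrow> 'a mat" (infixr \<open>@\<^sub>c\<close> 70) where
  "A @\<^sub>c B = four_block_mat A B (0\<^sub>m 0 (dim_col A)) (0\<^sub>m 0 (dim_col B))"

abbreviation mat_rank :: "complex mat \<Rightarrow> nat" where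
  "mat_rank A \<equiv> vec_space.rank (dim_row A) A"

abbreviation mat_range :: "complex mat \<Rightarrow> complex vec set" where
  "mat_range A \<equiv> vec_space.col_space (dim_row A) A"

(* The multiplicity of an eigenvalue is its order as a root of the characteristic
   polynomial; for Hermitian matrices this agrees with the geometric multiplicity. *)

definition pos_inertia :: "complex mat \<Rightarrow> nat" where
  "pos_inertia A =
     (\<Sum>x | 0 < x \<and> eigenvalue A (complex_of_real x). order (complex_of_real x) (char_poly A))"

definition neg_inertia :: "complex mat \<Rightarrow> nat" where
  "neg_inertia A =
     (\<Sum>x | x < 0 \<and> eigenvalue A (complex_of_real x). order (complex_of_real x) (char_poly A))"

definition pos_semidef :: "complex mat \<Rightarrow> bool" where
  "pos_semidef A \<longleftrightarrow> A \<in> herm_mats (dim_row A) \<and>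
     (\<forall>v \<in> carrier_vec (dim_row A). 0 \<le> Re ((A *\<^sub>v v) \<bullet>c v))"

definition pos_def :: "complex mat \<Rightarrow> bool" where
  "pos_def A \<longleftrightarrow> A \<in> herm_mats (dim_row A) \<and>
     (\<forall>v \<in> carrier_vec (dim_row A). v \<noteq> 0\<^sub>v (dim_row A) \<longrightarrow> 0 < Re ((A *\<^sub>v v) \<bullet>c v))"

definition loewner_le :: "complex mat \<Rightarrow> complex mat \<Rightarrow> bool" (infix \<open>\<preceq>\<^sub>L\<close> 50) where
  "Q \<preceq>\<^sub>L P \<longleftrightarrow> pos_semidef (P - Q)"

definition loewner_less :: "complex mat \<Rightarrow> complex mat \<Rightarrow> bool" (infix \<open>\<prec>\<^sub>L\<close> 50) where
  "Q \<prec>\<^sub>L P \<longleftrightarrow> pos_def (P - Q)"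

end

theory Submission
  imports Defs "Jordan_Normal_Form.Spectral_Radius"
begin

text \<open>
Write \<open>S X = A1 - B1 X B1*\<close> and \<open>T X = A2 - B2 X B2*\<close>; a parameter \<open>X\<close> is feasible when \<open>T X\<close> is
positive semidefinite. Everything rests on one observation: on the subspace
\<open>W = {(v, w). B1* v + B2* w = 0}\<close> the form \<open>v* A1 v - w* A2 w\<close> equals \<open>v* (S X) v - w* (T X) w\<close> for
every \<open>X\<close>, because the two terms in \<open>X\<close> cancel. Bordering a Hermitian \<open>A\<close> by \<open>B\<close> and \<open>B*\<close> adds the
rank of \<open>B\<close> to both inertias of the restriction of \<open>A\<close> to the kernel of \<open>B*\<close>
(\<open>bordered_upper\<close>, \<open>bordered_lower\<close>, \<open>bordered_nonpos\<close>). Hence \<open>M\<close> records the inertia of the form on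
\<open>W\<close>, and \<open>M1\<close> that of \<open>A1\<close> on the kernel of \<open>B1*\<close>, where all \<open>S X\<close> agree.

The bounds valid for every feasible \<open>X\<close> are dimension counts. The tool is \<open>nonneg_dim_le\<close>: a subspace
on which a Hermitian form is nonnegative has dimension at most the positive inertia plus the dimension
of its intersection with the kernel. This gives \<open>pencil_pos_le\<close> and \<open>pencil_neg_ge\<close> from \<open>M1\<close>, and
\<open>neg_upper\<close> and \<open>pos_lower\<close> from \<open>M\<close>; the rank is the sum of the two inertias.

The bounds are attained at three parameters. Subtracting a large multiple of the identity from a
feasible \<open>X\<close> keeps it feasible and, by Finsler's lemma, makes the positive inertia of \<open>S X\<close> maximal;
the negative inertia is then minimal and the rank maximal (\<open>feasible_pos_attained\<close>). If instead \<open>T X\<close>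
has the least possible rank, its range meets that of \<open>B2\<close> only in zero, so that a form on \<open>W\<close> can
be tested on vectors with \<open>T X w = 0\<close>; pushing \<open>X\<close> up along the kernel of \<open>B2\<close>, which does not change \<open>T X\<close>, then makes
the negative inertia of \<open>S X\<close> maximal (\<open>neg_max_attained\<close>). Finally let \<open>X\<close> minimise
\<open>2 rank (S X) + rank (T X)\<close>. No feasible change of \<open>X\<close> by a matrix of rank one, or by
\<open>z y* + y z*\<close> with \<open>B2 z = 0\<close>, can lower this number, and these local conditions are strong enough to
force both inertias of \<open>S X\<close> down to their lower bounds simultaneously (\<open>min_attained\<close>). The least rank is therefore
the sum of the least inertias.

Items (a) to (k) compare these extremal values with \<open>0\<close>, with \<open>m1\<close> or with each other; in (c) the
inclusion of ranges makes \<open>M1\<close> and \<open>N\<close> explicit (\<open>range_subset_facts\<close>).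
\<close>

section \<open>Subspaces of complex coordinate space and their dimensions\<close>

definition lin_sub :: "nat \<Rightarrow> complex vec set \<Rightarrow> bool" where
  "lin_sub n W \<longleftrightarrow> W \<subseteq> carrier_vec n \<and> 0\<^sub>v n \<in> W \<and>
     (\<forall>x\<in>W. \<forall>y\<in>W. x + y \<in> W) \<and> (\<forall>c. \<forall>x\<in>W. c \<cdot>\<^sub>v x \<in> W)"

text \<open>The ambient dimension is a parameter because the zero vector of a matrix-vector space depends on it.\<close>
definition vdim :: "nat \<Rightarrow> complex vec set \<Rightarrow> nat" where
  "vdim n W = vectorspace.dim (class_ring :: complex ring) ((module_vec TYPE(complex) n)\<lparr>carrier := W\<rparr>)"

lemma lin_subI:
  assumes "W \<subseteq> carrier_vec n" "0\<^sub>v n \<in> W" "\<And>x y. x \<in> W \<Longrightarrow> y \<in> W \<Longrightarrow> x + y \<in> W"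
    "\<And>c x. x \<in> W \<Longrightarrow> c \<cdot>\<^sub>v x \<in> W"
  shows "lin_sub n W"
  using assms by (auto simp: lin_sub_def)

lemma lin_subD:
  assumes "lin_sub n W"
  shows "W \<subseteq> carrier_vec n" "0\<^sub>v n \<in> W" "\<And>x y. x \<in> W \<Longrightarrow> y \<in> W \<Longrightarrow> x + y \<in> W"
    "\<And>c x. x \<in> W \<Longrightarrow> c \<cdot>\<^sub>v x \<in> W" "\<And>x. x \<in> W \<Longrightarrow> x \<in> carrier_vec n"
  using assms by (auto simp: lin_sub_def)

lemma lin_sub_subspace:
  assumes "lin_sub n W"
  shows "VectorSpace.subspace class_ring W (module_vec TYPE(complex) n)"
  unfolding VectorSpace.subspace_def submodule_def
  using assms vec_vs vec_module by (auto simp: lin_sub_def module_vec_simps)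

lemma lin_sub_vectorspace:
  assumes "lin_sub n W"
  shows "vectorspace class_ring ((module_vec TYPE(complex) n)\<lparr>carrier := W\<rparr>)"
  using vectorspace.subspace_is_vs[OF vec_vs lin_sub_subspace[OF assms]] .

text \<open>A maximal independent subset of \<open>W\<close> exists because independent sets in the ambient space have at most
\<open>n\<close> elements; it is then a basis of \<open>W\<close>.\<close>
lemma lin_sub_basis:
  assumes W: "lin_sub n W"
  obtains b where "finite b" "b \<subseteq> W"
    "vectorspace.basis class_ring ((module_vec TYPE(complex) n)\<lparr>carrier := W\<rparr>) b"
    "card b = vdim n W" "LinearCombinations.module.span class_ring (module_vec TYPE(complex) n) b = W"
    "LinearCombinations.module.lin_indpt class_ring (module_vec TYPE(complex) n) b"
proof -
  interpret V: vec_space "TYPE(complex)" n .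
  interpret Wv: vectorspace "class_ring :: complex ring" "(module_vec TYPE(complex) n)\<lparr>carrier := W\<rparr>"
    by (rule lin_sub_vectorspace[OF W])
  have sm: "submodule class_ring W (module_vec TYPE(complex) n)"
    using lin_sub_subspace[OF W] by (simp add: VectorSpace.subspace_def)
  have "\<exists>A. finite A \<and> maximal A (\<lambda>S. S \<subseteq> W \<and> Wv.lin_indpt S)"
  proof (rule maximal_exists[where N = n and B = "{}"])
    fix A assume A: "A \<subseteq> W \<and> Wv.lin_indpt A"
    hence "V.lin_indpt A" using V.span_li_not_depend(2)[OF _ sm, of A] by auto
    moreover have "A \<subseteq> carrier_vec n" using A lin_subD(1)[OF W] by auto
    ultimately show "finite A \<and> card A \<le> n"
      using V.li_le_dim[of A] V.fin_dim V.dim_is_n by auto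
  next
    show "{} \<subseteq> W \<and> Wv.lin_indpt {}" by (auto simp: Wv.lin_dep_def)
  qed
  then obtain b where b: "finite b" "maximal b (\<lambda>S. S \<subseteq> W \<and> Wv.lin_indpt S)" by auto
  have bas: "Wv.basis b" using Wv.max_li_is_basis[of b] b(2) by simp
  have bW: "b \<subseteq> W" using b(2) by (auto simp: maximal_def)
  show ?thesis
  proof (rule that[OF b(1) bW bas])
    show "card b = vdim n W" unfolding vdim_def using Wv.dim_basis[OF b(1) bas] by simp
    show "V.span b = W" using bas V.span_li_not_depend(1)[OF bW sm]
      by (auto simp: Wv.basis_def)
    show "V.lin_indpt b" using bas V.span_li_not_depend(2)[OF bW sm]
      by (auto simp: Wv.basis_def)
  qed
qed

lemma lin_sub_fin_dim:
  assumes "lin_sub n W"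
  shows "vectorspace.fin_dim class_ring ((module_vec TYPE(complex) n)\<lparr>carrier := W\<rparr>)"
proof -
  interpret Wv: vectorspace "class_ring :: complex ring" "(module_vec TYPE(complex) n)\<lparr>carrier := W\<rparr>"
    by (rule lin_sub_vectorspace[OF assms])
  obtain b where "finite b" "b \<subseteq> W" "Wv.basis b" by (rule lin_sub_basis[OF assms])
  thus ?thesis by (auto simp: Wv.fin_dim_def Wv.basis_def)
qed

lemma vdim_mono:
  assumes X: "lin_sub n X" and W: "lin_sub n W" and sub: "X \<subseteq> W"
  shows "vdim n X \<le> vdim n W"
proof -
  interpret V: vec_space "TYPE(complex)" n .
  interpret Wv: vectorspace "class_ring :: complex ring" "(module_vec TYPE(complex) n)\<lparr>carrier := W\<rparr>"
    by (rule lin_sub_vectorspace[OF W])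
  have "VectorSpace.subspace class_ring X ((module_vec TYPE(complex) n)\<lparr>carrier := W\<rparr>)"
    by (rule V.nested_subspaces[OF lin_sub_subspace[OF W] lin_sub_subspace[OF X] sub])
  from Wv.subspace_dim[OF this lin_sub_fin_dim[OF W]] lin_sub_fin_dim[OF X]
  show ?thesis by (simp add: vdim_def)
qed

lemma vdim_eq_imp_eq:
  assumes X: "lin_sub n X" and W: "lin_sub n W" and sub: "X \<subseteq> W" and d: "vdim n W \<le> vdim n X"
  shows "X = W"
proof -
  interpret V: vec_space "TYPE(complex)" n .
  interpret Wv: vectorspace "class_ring :: complex ring" "(module_vec TYPE(complex) n)\<lparr>carrier := W\<rparr>"
    by (rule lin_sub_vectorspace[OF W])
  have sm: "submodule class_ring W (module_vec TYPE(complex) n)"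
    using lin_sub_subspace[OF W] by (simp add: VectorSpace.subspace_def)
  obtain b where b: "finite b" "b \<subseteq> X" "card b = vdim n X" "V.span b = X" "V.lin_indpt b"
    by (rule lin_sub_basis[OF X])
  have bW: "b \<subseteq> W" using b sub by auto
  have "Wv.lin_indpt b" using V.span_li_not_depend(2)[OF bW sm] b(5) by simp
  hence "Wv.basis b"
    using Wv.dim_li_is_basis[OF lin_sub_fin_dim[OF W] b(1)] bW b(3) d by (simp add: vdim_def)
  hence "Wv.span b = W" by (auto simp: Wv.basis_def)
  thus ?thesis using V.span_li_not_depend(1)[OF bW sm] b(4) by simp
qed

lemma lin_sub_carrier: "lin_sub n (carrier_vec n)" by (auto simp: lin_sub_def)

lemma lin_sub_zero: "lin_sub n {0\<^sub>v n}" by (auto simp: lin_sub_def)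

lemma vdim_carrier: "vdim n (carrier_vec n) = n"
proof -
  interpret V: vec_space "TYPE(complex)" n .
  have "(module_vec TYPE(complex) n)\<lparr>carrier := carrier_vec n\<rparr> = module_vec TYPE(complex) n"
    by (simp add: module_vec_def)
  thus ?thesis unfolding vdim_def by (simp only: V.dim_is_n)
qed

lemma vdim_le: "lin_sub n W \<Longrightarrow> vdim n W \<le> n"
  using vdim_mono[OF _ lin_sub_carrier] lin_subD(1) vdim_carrier by metis

lemma vdim_zero: "vdim n {0\<^sub>v n} = 0"
proof -
  interpret Wv: vectorspace "class_ring :: complex ring" "(module_vec TYPE(complex) n)\<lparr>carrier := {0\<^sub>v n}\<rparr>"
    by (rule lin_sub_vectorspace[OF lin_sub_zero])
  have sub: "Wv.span {0\<^sub>v n} = {0\<^sub>v n}"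
    using Wv.span_is_subset2[of "{0\<^sub>v n}"] Wv.in_own_span[of "{0\<^sub>v n}"] by auto
  show ?thesis unfolding vdim_def
    by (rule Wv.dim0I) (use sub in \<open>simp add: module_vec_simps\<close>)
qed

lemma vdim_0_iff:
  assumes "lin_sub n W"
  shows "vdim n W = 0 \<longleftrightarrow> W = {0\<^sub>v n}"
  using vdim_eq_imp_eq[OF lin_sub_zero assms] vdim_zero lin_subD(2)[OF assms] by auto

definition lin_on :: "complex vec set \<Rightarrow> nat \<Rightarrow> (complex vec \<Rightarrow> complex vec) \<Rightarrow> bool" where
  "lin_on W k f \<longleftrightarrow> (\<forall>x\<in>W. f x \<in> carrier_vec k) \<and> (\<forall>x\<in>W. \<forall>y\<in>W. f (x + y) = f x + f y) \<and>
     (\<forall>c. \<forall>x\<in>W. f (c \<cdot>\<^sub>v x) = c \<cdot>\<^sub>v f x)"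

lemma lin_on_zero:
  assumes "lin_on W k f" "lin_sub n W"
  shows "f (0\<^sub>v n) = 0\<^sub>v k"
proof -
  have z: "0\<^sub>v n \<in> W" using assms(2) by (auto simp: lin_sub_def)
  have "f (0 \<cdot>\<^sub>v 0\<^sub>v n) = 0 \<cdot>\<^sub>v f (0\<^sub>v n)" using assms(1) z by (auto simp: lin_on_def)
  moreover have "f (0\<^sub>v n) \<in> carrier_vec k" using assms(1) z by (auto simp: lin_on_def)
  moreover have "0 \<cdot>\<^sub>v v = 0\<^sub>v k" if "v \<in> carrier_vec k" for v :: "complex vec"
    using that by (intro eq_vecI) auto
  moreover have "0 \<cdot>\<^sub>v 0\<^sub>v n = (0\<^sub>v n :: complex vec)" by (intro eq_vecI) auto
  ultimately show ?thesis by simp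
qed

lemma lin_sub_ker:
  assumes f: "lin_on W k f" and W: "lin_sub n W"
  shows "lin_sub n {x \<in> W. f x = 0\<^sub>v k}"
  using lin_subD[OF W] lin_on_zero[OF f W] f by (intro lin_subI) (auto simp: lin_on_def)

lemma lin_sub_image:
  assumes f: "lin_on W k f" and W: "lin_sub n W"
  shows "lin_sub k (f ` W)"
proof (rule lin_subI)
  show "f ` W \<subseteq> carrier_vec k" using f by (auto simp: lin_on_def)
  show "0\<^sub>v k \<in> f ` W" using lin_on_zero[OF f W] lin_subD(2)[OF W] by force
  fix x y assume "x \<in> f ` W" "y \<in> f ` W"
  then obtain a b where ab: "a \<in> W" "b \<in> W" "x = f a" "y = f b" by auto
  hence "x + y = f (a + b)" using f by (auto simp: lin_on_def)
  thus "x + y \<in> f ` W" using lin_subD(3)[OF W ab(1,2)] by auto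
next
  fix c x assume "x \<in> f ` W"
  then obtain a where a: "a \<in> W" "x = f a" by auto
  hence "c \<cdot>\<^sub>v x = f (c \<cdot>\<^sub>v a)" using f by (auto simp: lin_on_def)
  thus "c \<cdot>\<^sub>v x \<in> f ` W" using lin_subD(4)[OF W a(1)] by auto
qed

text \<open>All later dimension counts come from this formula, applied to matrices and to the projections of
stacked vectors. The map has to be linear on the subspace only.\<close>
lemma rank_nullity:
  assumes f: "lin_on W k f" and W: "lin_sub n W"
  shows "vdim k (f ` W) + vdim n {x \<in> W. f x = 0\<^sub>v k} = vdim n W"
proof -
  interpret Wv: vectorspace "class_ring :: complex ring" "(module_vec TYPE(complex) n)\<lparr>carrier := W\<rparr>"
    by (rule lin_sub_vectorspace[OF W])
  interpret T: linear_map "class_ring :: complex ring" "(module_vec TYPE(complex) n)\<lparr>carrier := W\<rparr>"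
    "module_vec TYPE(complex) k" f
    using lin_sub_vectorspace[OF W] vec_vs[of k] f
    by (auto simp: linear_map_def mod_hom_def mod_hom_axioms_def LinearCombinations.module_hom_def
        vectorspace_def lin_on_def module_vec_simps)
  have k: "T.kerT = {x \<in> W. f x = 0\<^sub>v k}" unfolding T.ker_def by (auto simp: module_vec_simps)
  have i: "T.imT = f ` W" unfolding T.im_def by simp
  show ?thesis using T.rank_nullity[OF lin_sub_fin_dim[OF W]] unfolding k i vdim_def by simp
qed

lemma lin_sub_Int:
  assumes X: "lin_sub n X" and Y: "lin_sub n Y"
  shows "lin_sub n (X \<inter> Y)"
  using lin_subD[OF X] lin_subD[OF Y] by (intro lin_subI) auto

lemma vdim_inj_image:
  assumes f: "lin_on W k f" and W: "lin_sub n W" and inj: "\<And>x. x \<in> W \<Longrightarrow> f x = 0\<^sub>v k \<Longrightarrow> x = 0\<^sub>v n"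
  shows "vdim k (f ` W) = vdim n W"
proof -
  have "{x \<in> W. f x = 0\<^sub>v k} = {0\<^sub>v n}" using inj lin_on_zero[OF f W] lin_subD(2)[OF W] by blast
  thus ?thesis using rank_nullity[OF f W] vdim_zero by simp
qed

definition vprod :: "complex vec set \<Rightarrow> complex vec set \<Rightarrow> complex vec set" where
  "vprod X Y = {x @\<^sub>v y | x y. x \<in> X \<and> y \<in> Y}"

lemma vec_first_append: "x \<in> carrier_vec m \<Longrightarrow> vec_first (x @\<^sub>v y) m = x"
  by (intro eq_vecI) (auto simp: vec_first_def)

lemma vec_last_append: "y \<in> carrier_vec n \<Longrightarrow> vec_last (x @\<^sub>v y) n = y"
  by (intro eq_vecI) (auto simp: vec_last_def)

lemma smult_append_vec: "c \<cdot>\<^sub>v (x @\<^sub>v y) = c \<cdot>\<^sub>v x @\<^sub>v c \<cdot>\<^sub>v (y :: complex vec)"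
  by (intro eq_vecI) auto

lemma zero_append_vec: "0\<^sub>v (m + n) = 0\<^sub>v m @\<^sub>v (0\<^sub>v n :: complex vec)"
  by (intro eq_vecI) auto

lemma vec_first_linear:
  fixes x y :: "complex vec"
  assumes "x \<in> carrier_vec (m + n)" "y \<in> carrier_vec (m + n)"
  shows "vec_first (x + y) m = vec_first x m + vec_first y m" "vec_first (c \<cdot>\<^sub>v x) m = c \<cdot>\<^sub>v vec_first x m"
  using carrier_vecD[OF assms(1)] carrier_vecD[OF assms(2)] by (auto intro!: eq_vecI simp: vec_first_def)

lemma vec_last_linear:
  fixes x y :: "complex vec"
  assumes x: "x \<in> carrier_vec (m + n)" and y: "y \<in> carrier_vec (m + n)"
  shows "vec_last (x + y) n = vec_last x n + vec_last y n" "vec_last (c \<cdot>\<^sub>v x) n = c \<cdot>\<^sub>v vec_last x n"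
proof -
  have l: "vec_last z n = vec n (\<lambda>i. z $ (m + i))" if "z \<in> carrier_vec (m + n)" for z :: "complex vec"
    using that unfolding vec_last_def by (simp add: carrier_vecD[OF that])
  have "x + y \<in> carrier_vec (m + n)" "c \<cdot>\<^sub>v x \<in> carrier_vec (m + n)" using x y by auto
  thus "vec_last (x + y) n = vec_last x n + vec_last y n" "vec_last (c \<cdot>\<^sub>v x) n = c \<cdot>\<^sub>v vec_last x n"
    using x y by (simp_all only: l) (intro eq_vecI; simp)+
qed

lemma lin_on_vec_first: "W \<subseteq> carrier_vec (m + n) \<Longrightarrow> lin_on W m (\<lambda>x. vec_first x m)"
  unfolding lin_on_def using vec_first_linear[of _ m n] by (meson subsetD vec_first_carrier)

lemma lin_on_vec_last: "W \<subseteq> carrier_vec (m + n) \<Longrightarrow> lin_on W n (\<lambda>x. vec_last x n)"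
  unfolding lin_on_def using vec_last_linear[of _ m n] by (meson subsetD vec_last_carrier)

lemma lin_on_add:
  assumes f: "lin_on W k f" and g: "lin_on W k g"
  shows "lin_on W k (\<lambda>x. f x + g x)"
  unfolding lin_on_def
proof (intro conjI ballI allI)
  fix x y assume x: "x \<in> W" and y: "y \<in> W"
  have c: "f x \<in> carrier_vec k" "g x \<in> carrier_vec k" "f y \<in> carrier_vec k" "g y \<in> carrier_vec k"
    using f g x y by (auto simp: lin_on_def)
  have "f (x + y) = f x + f y" "g (x + y) = g x + g y" using f g x y by (auto simp: lin_on_def)
  thus "f (x + y) + g (x + y) = f x + g x + (f y + g y)" using c by (intro eq_vecI) auto
next
  fix c x assume x: "x \<in> W"
  have "f x \<in> carrier_vec k" "g x \<in> carrier_vec k" using f g x by (auto simp: lin_on_def)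
  thus "f (c \<cdot>\<^sub>v x) + g (c \<cdot>\<^sub>v x) = c \<cdot>\<^sub>v (f x + g x)"
    using f g x by (auto simp: lin_on_def smult_add_distrib_vec)
qed (use f g in \<open>auto simp: lin_on_def\<close>)

lemma vprodI: "x \<in> X \<Longrightarrow> y \<in> Y \<Longrightarrow> x @\<^sub>v y \<in> vprod X Y"
  by (auto simp: vprod_def)

lemma vprodE:
  assumes "z \<in> vprod X Y"
  obtains x y where "z = x @\<^sub>v y" "x \<in> X" "y \<in> Y"
  using assms by (auto simp: vprod_def)

lemma lin_sub_vprod:
  assumes X: "lin_sub m X" and Y: "lin_sub n Y"
  shows "lin_sub (m + n) (vprod X Y)"
proof (rule lin_subI)
  note c = lin_subD(5)[OF X] lin_subD(5)[OF Y]
  show "vprod X Y \<subseteq> carrier_vec (m + n)" using c by (auto elim!: vprodE)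
  show "0\<^sub>v (m + n) \<in> vprod X Y" unfolding zero_append_vec
    by (intro vprodI lin_subD(2)[OF X] lin_subD(2)[OF Y])
  fix z w assume "z \<in> vprod X Y" "w \<in> vprod X Y"
  then obtain x y x' y' where h: "z = x @\<^sub>v y" "w = x' @\<^sub>v y'" "x \<in> X" "x' \<in> X" "y \<in> Y" "y' \<in> Y"
    by (elim vprodE)
  have "z + w = (x + x') @\<^sub>v (y + y')" unfolding h
    by (rule append_vec_add) (use h c in auto)
  thus "z + w \<in> vprod X Y" by (simp add: vprodI lin_subD(3)[OF X] lin_subD(3)[OF Y] h)
next
  fix a z assume "z \<in> vprod X Y"
  thus "a \<cdot>\<^sub>v z \<in> vprod X Y"
    by (auto elim!: vprodE simp: smult_append_vec intro!: vprodI lin_subD(4)[OF X] lin_subD(4)[OF Y])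
qed

lemma vdim_vprod:
  assumes X: "lin_sub m X" and Y: "lin_sub n Y"
  shows "vdim (m + n) (vprod X Y) = vdim m X + vdim n Y"
proof -
  note c = lin_subD(5)[OF X] lin_subD(5)[OF Y]
  note P = lin_sub_vprod[OF X Y]
  have l1: "lin_on (vprod X Y) m (\<lambda>x. vec_first x m)"
    by (rule lin_on_vec_first[OF lin_subD(1)[OF P]])
  have im: "(\<lambda>x. vec_first x m) ` vprod X Y = X"
  proof (intro equalityI subsetI)
    fix x assume "x \<in> X"
    hence "x @\<^sub>v 0\<^sub>v n \<in> vprod X Y" "vec_first (x @\<^sub>v 0\<^sub>v n) m = x"
      using c lin_subD(2)[OF Y] by (auto simp: vprodI vec_first_append)
    thus "x \<in> (\<lambda>x. vec_first x m) ` vprod X Y" by (intro image_eqI[where x = "x @\<^sub>v 0\<^sub>v n"]) simp_all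
  qed (use c in \<open>auto elim!: vprodE simp: vec_first_append\<close>)
  let ?Z = "{x \<in> vprod X Y. vec_first x m = 0\<^sub>v m}"
  have Z: "lin_sub (m + n) ?Z" by (rule lin_sub_ker[OF l1 P])
  have l2: "lin_on ?Z n (\<lambda>x. vec_last x n)" by (rule lin_on_vec_last[OF lin_subD(1)[OF Z]])
  have im2: "(\<lambda>x. vec_last x n) ` ?Z = Y"
  proof (intro equalityI subsetI)
    fix y assume "y \<in> Y"
    hence "0\<^sub>v m @\<^sub>v y \<in> ?Z" "vec_last (0\<^sub>v m @\<^sub>v y) n = y"
      using c lin_subD(2)[OF X] by (auto simp: vprodI vec_first_append vec_last_append)
    thus "y \<in> (\<lambda>x. vec_last x n) ` ?Z" by (intro image_eqI[where x = "0\<^sub>v m @\<^sub>v y"]) simp_all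
  qed (use c in \<open>auto elim!: vprodE simp: vec_last_append\<close>)
  have "vdim n ((\<lambda>x. vec_last x n) ` ?Z) = vdim (m + n) ?Z"
    by (rule vdim_inj_image[OF l2 Z])
       (use c in \<open>auto elim!: vprodE simp: vec_first_append vec_last_append zero_append_vec\<close>)
  thus ?thesis using rank_nullity[OF l1 P] im im2 by simp
qed

definition vsum :: "complex vec set \<Rightarrow> complex vec set \<Rightarrow> complex vec set" where
  "vsum X Y = {x + y | x y. x \<in> X \<and> y \<in> Y}"

lemma vsumI: "x \<in> X \<Longrightarrow> y \<in> Y \<Longrightarrow> x + y \<in> vsum X Y"
  by (auto simp: vsum_def)

lemma vsumE:
  assumes "z \<in> vsum X Y"
  obtains x y where "z = x + y" "x \<in> X" "y \<in> Y"
  using assms by (auto simp: vsum_def)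

lemma vsum_eq_image:
  assumes X: "lin_sub n X" and Y: "lin_sub n Y"
  shows "vsum X Y = (\<lambda>z. vec_first z n + vec_last z n) ` vprod X Y" (is "_ = ?f ` _")
proof -
  note c = lin_subD(5)[OF X] lin_subD(5)[OF Y]
  have f: "?f (x @\<^sub>v y) = x + y" if "x \<in> X" "y \<in> Y" for x y
    using that c by (simp add: vec_first_append vec_last_append)
  show ?thesis
  proof (intro equalityI subsetI)
    fix z assume "z \<in> vsum X Y"
    then obtain x y where h: "z = x + y" "x \<in> X" "y \<in> Y" by (rule vsumE)
    thus "z \<in> ?f ` vprod X Y" using f vprodI by (intro image_eqI[where x = "x @\<^sub>v y"]) simp_all
  next
    fix z assume "z \<in> ?f ` vprod X Y"
    then obtain u where u: "u \<in> vprod X Y" "z = ?f u" by blast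
    then obtain x y where h: "u = x @\<^sub>v y" "x \<in> X" "y \<in> Y" by (blast elim: vprodE)
    thus "z \<in> vsum X Y" using u f vsumI by metis
  qed
qed

lemma lin_on_vsum:
  "lin_sub n X \<Longrightarrow> lin_sub n Y \<Longrightarrow> lin_on (vprod X Y) n (\<lambda>z. vec_first z n + vec_last z n)"
  by (intro lin_on_add lin_on_vec_first lin_on_vec_last lin_subD(1)[OF lin_sub_vprod])

lemma lin_sub_vsum:
  assumes X: "lin_sub n X" and Y: "lin_sub n Y"
  shows "lin_sub n (vsum X Y)"
  unfolding vsum_eq_image[OF X Y]
  by (rule lin_sub_image[OF lin_on_vsum[OF X Y] lin_sub_vprod[OF X Y]])

lemma add_eq_0_vec:
  fixes x y :: "complex vec"
  assumes "x + y = 0\<^sub>v n" "x \<in> carrier_vec n" "y \<in> carrier_vec n"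
  shows "y = (-1) \<cdot>\<^sub>v x"
proof (rule eq_vecI)
  fix i assume i: "i < dim_vec ((-1) \<cdot>\<^sub>v x)"
  hence i': "i < n" using assms by simp
  have "(x + y) $ i = 0" unfolding assms(1) using i' by simp
  thus "y $ i = ((-1) \<cdot>\<^sub>v x) $ i" using i' assms(2,3) by (simp add: add_eq_0_iff)
qed (use assms(2,3) in auto)

text \<open>Rank-nullity for addition on the product of the two subspaces: its kernel consists of the pairs
\<open>(x, -x)\<close> and is a copy of the intersection.\<close>
lemma vdim_vsum:
  assumes X: "lin_sub n X" and Y: "lin_sub n Y"
  shows "vdim n (vsum X Y) + vdim n (X \<inter> Y) = vdim n X + vdim n Y"
proof -
  note c = lin_subD(5)[OF X] lin_subD(5)[OF Y]
  note P = lin_sub_vprod[OF X Y]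
  let ?f = "\<lambda>z. vec_first z n + vec_last z n"
  note l = lin_on_vsum[OF X Y]
  let ?K = "{z \<in> vprod X Y. ?f z = 0\<^sub>v n}"
  have K: "lin_sub (n + n) ?K" by (rule lin_sub_ker[OF l P])
  have l2: "lin_on ?K n (\<lambda>x. vec_first x n)" by (rule lin_on_vec_first[OF lin_subD(1)[OF K]])
  have KE: "\<exists>x y. z = x @\<^sub>v y \<and> x \<in> X \<and> y \<in> Y \<and> y = (-1) \<cdot>\<^sub>v x \<and> x = (-1) \<cdot>\<^sub>v y \<and> vec_first z n = x"
    if "z \<in> ?K" for z
  proof -
    from that obtain x y where h: "x \<in> X" "y \<in> Y" "?f (x @\<^sub>v y) = 0\<^sub>v n" "z = x @\<^sub>v y"
      by (blast elim: vprodE)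
    have cc: "x \<in> carrier_vec n" "y \<in> carrier_vec n" using h c by auto
    have s: "x + y = 0\<^sub>v n" using h cc by (simp add: vec_first_append vec_last_append)
    hence s': "y + x = 0\<^sub>v n" using cc by (simp add: comm_add_vec)
    show ?thesis using h add_eq_0_vec[OF s cc] add_eq_0_vec[OF s' cc(2,1)] vec_first_append[OF cc(1)]
      by blast
  qed
  have "(\<lambda>x. vec_first x n) ` ?K = X \<inter> Y"
  proof (intro equalityI subsetI)
    fix x assume x: "x \<in> X \<inter> Y"
    hence xc: "x \<in> carrier_vec n" using c by auto
    have y: "(-1) \<cdot>\<^sub>v x \<in> Y" using lin_subD(4)[OF Y] x by auto
    have "?f (x @\<^sub>v (-1) \<cdot>\<^sub>v x) = 0\<^sub>v n" using xc by (auto simp: vec_first_append vec_last_append)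
    hence "x @\<^sub>v (-1) \<cdot>\<^sub>v x \<in> ?K" using x y by (simp add: vprodI)
    moreover have "vec_first (x @\<^sub>v (-1) \<cdot>\<^sub>v x) n = x" by (rule vec_first_append[OF xc])
    ultimately show "x \<in> (\<lambda>x. vec_first x n) ` ?K"
      by (intro image_eqI[where x = "x @\<^sub>v (-1) \<cdot>\<^sub>v x"]) simp_all
  next
    fix x assume "x \<in> (\<lambda>x. vec_first x n) ` ?K"
    then obtain z where z: "z \<in> ?K" "x = vec_first z n" by blast
    from KE[OF z(1)] obtain y where y: "x \<in> X" "y \<in> Y" "x = (-1) \<cdot>\<^sub>v y" using z(2) by metis
    thus "x \<in> X \<inter> Y" using lin_subD(4)[OF Y y(2)] by simp
  qed
  moreover have "vdim n ((\<lambda>x. vec_first x n) ` ?K) = vdim (n + n) ?K"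
  proof (rule vdim_inj_image[OF l2 K])
    fix z assume z: "z \<in> ?K" "vec_first z n = 0\<^sub>v n"
    from KE[OF z(1)] z(2) obtain y where "z = 0\<^sub>v n @\<^sub>v y" "y = (-1) \<cdot>\<^sub>v 0\<^sub>v n" by metis
    moreover have "(-1) \<cdot>\<^sub>v 0\<^sub>v n = (0\<^sub>v n :: complex vec)" by (intro eq_vecI) auto
    ultimately show "z = 0\<^sub>v (n + n)" by (simp add: zero_append_vec)
  qed
  ultimately show ?thesis
    using rank_nullity[OF l P] vdim_vprod[OF X Y] vsum_eq_image[OF X Y] by simp
qed

lemma vdim_Int_ge:
  assumes X: "lin_sub n X" and Y: "lin_sub n Y"
  shows "vdim n X + vdim n Y \<le> n + vdim n (X \<inter> Y)"
  using vdim_vsum[OF X Y] vdim_le[OF lin_sub_vsum[OF X Y]] by simp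

section \<open>Adjoints, kernels and ranges\<close>

lemma mat_vec_carrier [simp]: "A \<in> carrier_mat nr nc \<Longrightarrow> A *\<^sub>v x \<in> carrier_vec nr"
  by (rule carrier_vecI) (simp add: carrier_matD)

lemma adjoint_dim [simp]: "dim_row (mat_adjoint A) = dim_col A" "dim_col (mat_adjoint A) = dim_row A"
  unfolding mat_adjoint_def by auto

lemma adjoint_carrier_iff [simp]: "mat_adjoint A \<in> carrier_mat nc nr \<longleftrightarrow> A \<in> carrier_mat nr nc"
  by (metis adjoint_dim carrier_matD carrier_matI)

lemma adjoint_vec_carrier [simp]: "A \<in> carrier_mat nr nc \<Longrightarrow> mat_adjoint A *\<^sub>v x \<in> carrier_vec nc"
  by (intro carrier_vecI) simp

lemma adjoint_index [simp]:
  "i < dim_col A \<Longrightarrow> j < dim_row A \<Longrightarrow> mat_adjoint A $$ (i, j) = cnj (A $$ (j, i))"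
  unfolding mat_adjoint_def by (simp add: mat_of_rows_index)

lemma adjoint_adjoint [simp]: "mat_adjoint (mat_adjoint (A :: complex mat)) = A"
  by (rule eq_matI) auto

lemma cip_adjoint:
  fixes A :: "complex mat"
  assumes A: "A \<in> carrier_mat nr nc" and x: "x \<in> carrier_vec nc" and y: "y \<in> carrier_vec nr"
  shows "(A *\<^sub>v x) \<bullet>c y = x \<bullet>c (mat_adjoint A *\<^sub>v y)"
proof -
  have "(A *\<^sub>v x) \<bullet>c y = (\<Sum>i<nr. (\<Sum>j<nc. A $$ (i,j) * x $ j) * cnj (y $ i))"
    using assms by (simp add: scalar_prod_def atLeast0LessThan)
  also have "\<dots> = (\<Sum>j<nc. \<Sum>i<nr. A $$ (i,j) * x $ j * cnj (y $ i))"
    unfolding sum_distrib_right by (rule sum.swap)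
  also have "\<dots> = (\<Sum>j<nc. x $ j * cnj (\<Sum>i<nr. cnj (A $$ (i,j)) * y $ i))"
    by (simp add: sum_distrib_left mult_ac)
  also have "\<dots> = x \<bullet>c (mat_adjoint A *\<^sub>v y)"
    using assms by (simp add: scalar_prod_def atLeast0LessThan)
  finally show ?thesis .
qed

lemma cip_sym: "x \<in> carrier_vec n \<Longrightarrow> y \<in> carrier_vec n \<Longrightarrow> y \<bullet>c x = cnj (x \<bullet>c (y :: complex vec))"
  by (simp add: scalar_prod_def mult.commute)

lemma cip_add_left: "x \<in> carrier_vec n \<Longrightarrow> y \<in> carrier_vec n \<Longrightarrow> z \<in> carrier_vec n \<Longrightarrow>
    (x + y) \<bullet>c z = x \<bullet>c z + y \<bullet>c (z :: complex vec)"
  by (simp add: add_scalar_prod_distrib[of _ n])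

lemma cip_add_right: "x \<in> carrier_vec n \<Longrightarrow> y \<in> carrier_vec n \<Longrightarrow> z \<in> carrier_vec n \<Longrightarrow>
    x \<bullet>c (y + z) = x \<bullet>c y + x \<bullet>c (z :: complex vec)"
  by (simp add: conjugate_add_vec[of _ n] scalar_prod_add_distrib[of _ n])

lemma cip_smult_left: "x \<in> carrier_vec n \<Longrightarrow> y \<in> carrier_vec n \<Longrightarrow>
    (c \<cdot>\<^sub>v x) \<bullet>c y = c * (x \<bullet>c (y :: complex vec))"
  by simp

lemma cip_smult_right: "x \<in> carrier_vec n \<Longrightarrow> y \<in> carrier_vec n \<Longrightarrow>
    x \<bullet>c (c \<cdot>\<^sub>v y) = cnj c * (x \<bullet>c (y :: complex vec))"
  by (simp add: conjugate_smult_vec scalar_prod_def sum_distrib_left mult_ac)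

lemma cip_zero [simp]: "x \<in> carrier_vec n \<Longrightarrow> x \<bullet>c (0\<^sub>v n :: complex vec) = 0"
  "x \<in> carrier_vec n \<Longrightarrow> (0\<^sub>v n :: complex vec) \<bullet>c x = 0"
  by (simp_all add: scalar_prod_def)

lemma cip_self_real: "(x :: complex vec) \<bullet>c x = complex_of_real (\<Sum>i<dim_vec x. (cmod (x $ i))\<^sup>2)"
  by (simp add: scalar_prod_def atLeast0LessThan complex_norm_square[symmetric] del: of_real_power)

lemma cip_self_ge_0: "0 \<le> Re ((x :: complex vec) \<bullet>c x)"
  unfolding cip_self_real by (simp add: sum_nonneg)

lemma cip_self_eq_0: "x \<in> carrier_vec n \<Longrightarrow> (x :: complex vec) \<bullet>c x = 0 \<longleftrightarrow> x = 0\<^sub>v n"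
  by (rule conjugate_square_eq_0_vec)

lemma eq_zero_vecI:
  assumes z: "(z :: complex vec) \<in> carrier_vec n" and "\<And>x. x \<in> carrier_vec n \<Longrightarrow> x \<bullet>c z = 0"
  shows "z = 0\<^sub>v n"
  using assms(2)[OF z] cip_self_eq_0[OF z] by simp

lemma cip_eqI:
  assumes "(x :: complex vec) \<in> carrier_vec n" "y \<in> carrier_vec n"
    and "\<And>z. z \<in> carrier_vec n \<Longrightarrow> z \<bullet>c x = z \<bullet>c y"
  shows "x = y"
proof -
  have "x + (-1) \<cdot>\<^sub>v y = 0\<^sub>v n"
    by (rule eq_zero_vecI) (use assms in \<open>auto simp: cip_add_right cip_smult_right\<close>)
  show ?thesis
  proof (rule eq_vecI)
    fix i assume i: "i < dim_vec y"
    hence "(x + (-1) \<cdot>\<^sub>v y) $ i = 0" using assms(2) by (subst \<open>_ = 0\<^sub>v n\<close>) simp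
    thus "x $ i = y $ i" using i assms(1,2) by simp
  qed (use assms in auto)
qed

lemma lin_on_mat: "A \<in> carrier_mat k n \<Longrightarrow> W \<subseteq> carrier_vec n \<Longrightarrow> lin_on W k (\<lambda>x. A *\<^sub>v (x :: complex vec))"
  unfolding lin_on_def by (auto simp: subset_iff mult_add_distrib_mat_vec mult_mat_vec)

definition mker :: "complex mat \<Rightarrow> complex vec set" where
  "mker A = {x \<in> carrier_vec (dim_col A). A *\<^sub>v x = 0\<^sub>v (dim_row A)}"

definition mran :: "complex mat \<Rightarrow> complex vec set" where
  "mran A = (\<lambda>x. A *\<^sub>v x) ` carrier_vec (dim_col A)"

lemma mker_iff: "A \<in> carrier_mat nr nc \<Longrightarrow> x \<in> mker A \<longleftrightarrow> x \<in> carrier_vec nc \<and> A *\<^sub>v x = 0\<^sub>v nr"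
  by (auto simp: mker_def)

lemma mran_iff: "A \<in> carrier_mat nr nc \<Longrightarrow> z \<in> mran A \<longleftrightarrow> (\<exists>x\<in>carrier_vec nc. z = A *\<^sub>v x)"
  by (auto simp: mran_def)

lemma lin_sub_mker: "A \<in> carrier_mat nr nc \<Longrightarrow> lin_sub nc (mker A)"
  unfolding mker_def using lin_sub_ker[OF lin_on_mat lin_sub_carrier, of A nr nc] by auto

lemma lin_sub_mran: "A \<in> carrier_mat nr nc \<Longrightarrow> lin_sub nr (mran A)"
  unfolding mran_def using lin_sub_image[OF lin_on_mat lin_sub_carrier, of A nr nc] by auto

lemma mat_range_eq: "mat_range A = mran A"
  unfolding mran_def by (subst vec_space.col_space_eq[of A _ "dim_col A"]) (auto intro!: carrier_vecI)

lemma mat_rank_eq: "mat_rank A = vdim (dim_row A) (mran A)"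
  unfolding mat_range_eq[symmetric] vec_space.rank_def vdim_def vec_space.col_space_def
  by (simp add: module_vec_def)

lemma rank_mker: "A \<in> carrier_mat nr nc \<Longrightarrow> mat_rank A + vdim nc (mker A) = nc"
  using rank_nullity[OF lin_on_mat[OF _ subset_refl] lin_sub_carrier, of A nr nc] vdim_carrier[of nc]
  unfolding mat_rank_eq mran_def mker_def by simp

lemma adjoint_mult_self_zero:
  fixes A :: "complex mat"
  assumes A: "A \<in> carrier_mat nr nc" and x: "x \<in> carrier_vec nc"
    and z: "mat_adjoint A *\<^sub>v (A *\<^sub>v x) = 0\<^sub>v nc"
  shows "A *\<^sub>v x = 0\<^sub>v nr"
proof -
  have "(A *\<^sub>v x) \<bullet>c (A *\<^sub>v x) = x \<bullet>c (mat_adjoint A *\<^sub>v (A *\<^sub>v x))"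
    using cip_adjoint[OF A x, of "A *\<^sub>v x"] A x by simp
  thus ?thesis unfolding z using cip_self_eq_0[of "A *\<^sub>v x" nr] A x by simp
qed

text \<open>The adjoint is injective on the range of \<open>A\<close>, because \<open>A* A x = 0\<close> implies \<open>A x = 0\<close>.\<close>
lemma rank_adjoint_le:
  assumes A: "A \<in> carrier_mat nr nc"
  shows "mat_rank A \<le> mat_rank (mat_adjoint A)"
proof -
  let ?A = "mat_adjoint A"
  have A': "?A \<in> carrier_mat nc nr" using A by simp
  have l: "lin_on (mran A) nc (\<lambda>x. ?A *\<^sub>v x)"
    by (rule lin_on_mat[OF A' lin_subD(1)[OF lin_sub_mran[OF A]]])
  have "vdim nr (mran A) = vdim nc ((\<lambda>x. ?A *\<^sub>v x) ` mran A)"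
    by (rule vdim_inj_image[OF l lin_sub_mran[OF A], symmetric])
       (auto simp: mran_iff[OF A] intro: adjoint_mult_self_zero[OF A])
  also have "\<dots> \<le> vdim nc (mran ?A)"
    by (rule vdim_mono[OF lin_sub_image[OF l lin_sub_mran[OF A]] lin_sub_mran[OF A']])
       (use A in \<open>auto simp: mran_iff[OF A] mran_iff[OF A'] intro!: bexI\<close>)
  finally show ?thesis unfolding mat_rank_eq using A by simp
qed

lemma rank_adjoint: "A \<in> carrier_mat nr nc \<Longrightarrow> mat_rank (mat_adjoint A) = mat_rank A"
  using rank_adjoint_le[of A nr nc] rank_adjoint_le[of "mat_adjoint A" nc nr] by simp

lemma rank_mker_adjoint: "A \<in> carrier_mat nr nc \<Longrightarrow> mat_rank A + vdim nr (mker (mat_adjoint A)) = nr"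
  using rank_mker[of "mat_adjoint A" nc nr] rank_adjoint by simp

text \<open>Membership in the kernel of an adjoint is orthogonality to the range; in this form adjoints of block
matrices never have to be computed.\<close>
lemma mker_adjoint_iff:
  assumes A: "A \<in> carrier_mat nr nc"
  shows "x \<in> mker (mat_adjoint A) \<longleftrightarrow> x \<in> carrier_vec nr \<and> (\<forall>y\<in>carrier_vec nc. (A *\<^sub>v y) \<bullet>c x = 0)"
proof (cases "x \<in> carrier_vec nr")
  case True
  have m: "mat_adjoint A *\<^sub>v x \<in> carrier_vec nc" using A True by simp
  have "(\<forall>y\<in>carrier_vec nc. (A *\<^sub>v y) \<bullet>c x = 0) \<longleftrightarrow> (\<forall>y\<in>carrier_vec nc. y \<bullet>c (mat_adjoint A *\<^sub>v x) = 0)"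
    using cip_adjoint[OF A _ True] by auto
  also have "\<dots> \<longleftrightarrow> mat_adjoint A *\<^sub>v x = 0\<^sub>v nc" using eq_zero_vecI[OF m] by auto
  finally show ?thesis using A True by (simp add: mker_iff[of _ nc nr])
qed (use A in \<open>simp add: mker_iff[of _ nc nr]\<close>)

lemma basis_matrix:
  assumes W: "lin_sub n W"
  obtains J where "J \<in> carrier_mat n (vdim n W)" "mran J = W" "mker J = {0\<^sub>v (vdim n W)}"
proof -
  obtain b where b: "finite b" "b \<subseteq> W" "card b = vdim n W"
     "LinearCombinations.module.span class_ring (module_vec TYPE(complex) n) b = W"
    by (rule lin_sub_basis[OF W])
  obtain bs where bs: "set bs = b" "distinct bs" using finite_distinct_list[OF b(1)] by blast
  have len: "length bs = vdim n W" using bs b(3) distinct_card by fastforce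
  have sub: "set bs \<subseteq> carrier_vec n" using bs b(2) lin_subD(1)[OF W] by auto
  let ?J = "mat_of_cols n bs"
  have J: "?J \<in> carrier_mat n (vdim n W)" using len by auto
  have cols: "cols ?J = bs" using sub by (simp add: cols_mat_of_cols)
  have r: "mran ?J = W" unfolding mat_range_eq[symmetric] vec_space.col_space_def
    using b(4) bs cols by simp
  have "mat_rank ?J = vdim n W" unfolding mat_rank_eq r by simp
  hence "vdim (vdim n W) (mker ?J) = 0" using rank_mker[OF J] by simp
  hence "mker ?J = {0\<^sub>v (vdim n W)}" using vdim_0_iff[OF lin_sub_mker[OF J]] by simp
  thus ?thesis using that J r by blast
qed

text \<open>The range of \<open>A\<close> lies in the orthogonal complement of the kernel of \<open>A*\<close>, and both have dimension
\<open>rank A\<close>.\<close>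
lemma mran_eq_perp_mker_adjoint:
  assumes A: "A \<in> carrier_mat nr nc" and z: "z \<in> carrier_vec nr"
    and perp: "\<And>x. x \<in> mker (mat_adjoint A) \<Longrightarrow> z \<bullet>c x = 0"
  shows "z \<in> mran A"
proof -
  let ?K = "mker (mat_adjoint A)"
  have A': "mat_adjoint A \<in> carrier_mat nc nr" using A by simp
  have K: "lin_sub nr ?K" by (rule lin_sub_mker[OF A'])
  obtain J where J: "J \<in> carrier_mat nr (vdim nr ?K)" "mran J = ?K" "mker J = {0\<^sub>v (vdim nr ?K)}"
    by (rule basis_matrix[OF K])
  let ?C = "mker (mat_adjoint J)"
  have J': "mat_adjoint J \<in> carrier_mat (vdim nr ?K) nr" using J by simp
  have C: "lin_sub nr ?C" by (rule lin_sub_mker[OF J'])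
  have mem: "x \<in> ?C \<longleftrightarrow> x \<in> carrier_vec nr \<and> (\<forall>k\<in>?K. k \<bullet>c x = 0)" for x
  proof -
    have "k \<in> ?K \<longleftrightarrow> (\<exists>y\<in>carrier_vec (vdim nr ?K). k = J *\<^sub>v y)" for k
      using mran_iff[OF J(1)] J(2) by simp
    thus ?thesis unfolding mker_adjoint_iff[OF J(1)] by auto
  qed
  have "mran A = ?C"
  proof (rule vdim_eq_imp_eq[OF lin_sub_mran[OF A] C])
    show "mran A \<subseteq> ?C"
    proof
      fix x assume "x \<in> mran A"
      then obtain y where y: "y \<in> carrier_vec nc" "x = A *\<^sub>v y" by (auto simp: mran_iff[OF A])
      have xc: "x \<in> carrier_vec nr" using A y by simp
      have "k \<bullet>c x = 0" if "k \<in> ?K" for k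
      proof -
        have kc: "k \<in> carrier_vec nr" using that lin_subD(5)[OF K] by simp
        have "x \<bullet>c k = 0" using that y by (auto simp: mker_adjoint_iff[OF A])
        thus ?thesis using cip_sym[OF xc kc] by simp
      qed
      thus "x \<in> ?C" using mem xc by simp
    qed
    show "vdim nr ?C \<le> vdim nr (mran A)"
      using rank_mker_adjoint[OF J(1)] rank_mker_adjoint[OF A] A J(1)
      unfolding mat_rank_eq J(2) by simp
  qed
  moreover have "z \<in> ?C" unfolding mem
  proof (intro conjI ballI z)
    fix k assume k: "k \<in> ?K"
    have kc: "k \<in> carrier_vec nr" using k lin_subD(5)[OF K] by simp
    show "k \<bullet>c z = 0" using cip_sym[OF z kc] perp[OF k] by simp
  qed
  ultimately show ?thesis by simp
qed

lemma hermD: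
  assumes "S \<in> herm_mats m"
  shows "S \<in> carrier_mat m m" "mat_adjoint S = S"
  using assms by (auto simp: herm_mats_def)

lemma herm_cip:
  assumes S: "S \<in> herm_mats m" and "x \<in> carrier_vec m" "y \<in> carrier_vec m"
  shows "(S *\<^sub>v x) \<bullet>c y = x \<bullet>c (S *\<^sub>v y)"
  using cip_adjoint[OF hermD(1)[OF S] assms(2,3)] hermD(2)[OF S] by simp

lemma hermI:
  assumes S: "S \<in> carrier_mat m m"
    and c: "\<And>x y. x \<in> carrier_vec m \<Longrightarrow> y \<in> carrier_vec m \<Longrightarrow> (S *\<^sub>v x) \<bullet>c y = x \<bullet>c (S *\<^sub>v y)"
  shows "S \<in> herm_mats m"
proof -
  have u: "(mat_adjoint S *\<^sub>v y) = S *\<^sub>v y" if "y \<in> carrier_vec m" for y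
    by (rule cip_eqI[of _ m]) (use S that c cip_adjoint[OF S _ that] in auto)
  have "mat_adjoint S = S"
  proof (rule eq_matI)
    fix i j assume ij: "i < dim_row S" "j < dim_col S"
    hence "(mat_adjoint S *\<^sub>v unit_vec m j) $ i = (S *\<^sub>v unit_vec m j) $ i" using u[of "unit_vec m j"] by simp
    thus "mat_adjoint S $$ (i, j) = S $$ (i, j)" using ij S by auto
  qed (use S in auto)
  thus ?thesis using S by (simp add: herm_mats_def)
qed

definition qf :: "complex mat \<Rightarrow> complex vec \<Rightarrow> real" where
  "qf S x = Re ((S *\<^sub>v x) \<bullet>c x)"

lemma herm_qf_complex:
  assumes S: "S \<in> herm_mats m" and x: "x \<in> carrier_vec m"
  shows "(S *\<^sub>v x) \<bullet>c x = complex_of_real (qf S x)"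
proof -
  have Sx: "S *\<^sub>v x \<in> carrier_vec m" using hermD(1)[OF S] x by simp
  have "cnj ((S *\<^sub>v x) \<bullet>c x) = (S *\<^sub>v x) \<bullet>c x"
    using cip_sym[OF Sx x] herm_cip[OF S x x] by simp
  thus ?thesis unfolding qf_def by (metis Reals_cnj_iff of_real_Re)
qed

lemma qf_add:
  assumes S: "S \<in> herm_mats m" and x: "x \<in> carrier_vec m" and y: "y \<in> carrier_vec m"
  shows "qf S (x + y) = qf S x + qf S y + 2 * Re ((S *\<^sub>v x) \<bullet>c y)"
proof -
  note c = hermD(1)[OF S]
  have Sx: "S *\<^sub>v x \<in> carrier_vec m" "S *\<^sub>v y \<in> carrier_vec m" using c x y by auto
  have "(S *\<^sub>v y) \<bullet>c x = cnj ((S *\<^sub>v x) \<bullet>c y)" using herm_cip[OF S y x] cip_sym[OF Sx(1) y] by simp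
  thus ?thesis unfolding qf_def mult_add_distrib_mat_vec[OF c x y]
    using Sx x y by (simp add: cip_add_left[of _ m] cip_add_right[of _ m])
qed

lemma qf_smult:
  assumes S: "S \<in> carrier_mat m m" and x: "x \<in> carrier_vec m"
  shows "qf S (c \<cdot>\<^sub>v x) = (cmod c)\<^sup>2 * qf S x"
proof -
  have Sx: "S *\<^sub>v x \<in> carrier_vec m" using S x by auto
  have "(S *\<^sub>v (c \<cdot>\<^sub>v x)) \<bullet>c (c \<cdot>\<^sub>v x) = c * (cnj c * ((S *\<^sub>v x) \<bullet>c x))"
    unfolding mult_mat_vec[OF S x] using Sx x
    by (simp add: cip_smult_left[of _ m] cip_smult_right[of _ m])
  also have "\<dots> = complex_of_real ((cmod c)\<^sup>2) * ((S *\<^sub>v x) \<bullet>c x)"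
    by (simp only: complex_norm_square mult.assoc)
  finally show ?thesis unfolding qf_def by (simp only: Re_complex_of_real Im_complex_of_real times_complex.sel)
qed

lemma qf_zero: "S \<in> carrier_mat m m \<Longrightarrow> qf S (0\<^sub>v m) = 0"
  unfolding qf_def by (subst cip_zero(1)[of _ m]) auto

lemma mker_qf: "S \<in> carrier_mat m m \<Longrightarrow> x \<in> mker S \<Longrightarrow> qf S x = 0"
  unfolding qf_def by (auto simp: mker_iff cip_zero(2))

lemma qf_uminus: "S \<in> carrier_mat m m \<Longrightarrow> x \<in> carrier_vec m \<Longrightarrow> qf (- S) x = - qf S x"
proof -
  assume S: "S \<in> carrier_mat m m" and x: "x \<in> carrier_vec m"
  have "(- S) *\<^sub>v x = (-1) \<cdot>\<^sub>v (S *\<^sub>v x)" using S x by (intro eq_vecI) auto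
  thus ?thesis unfolding qf_def using S x by (simp add: cip_smult_left[of _ m])
qed

lemma herm_uminus: "S \<in> herm_mats m \<Longrightarrow> - S \<in> herm_mats m"
  unfolding herm_mats_def by (auto intro!: eq_matI) (metis (no_types, lifting) adjoint_index carrier_matD)

section \<open>Diagonalising Hermitian matrices\<close>

lemma rank_eq_vdim: "A \<in> carrier_mat nr nc \<Longrightarrow> vec_space.rank nr A = vdim nr (mran A)"
  using mat_rank_eq[of A] by (simp only: carrier_matD)

lemma eigenvector_exists:
  assumes G: "(G :: complex mat) \<in> carrier_mat r r" and r: "0 < r"
  obtains g c where "g \<in> carrier_vec r" "g \<noteq> 0\<^sub>v r" "G *\<^sub>v g = c \<cdot>\<^sub>v g"
proof -
  from spectrum_non_empty[OF G r] obtain c where "eigenvalue G c" by (auto simp: spectrum_def)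
  then obtain g where "eigenvector G g c" by (auto simp: eigenvalue_def)
  thus ?thesis using that G by (auto simp: eigenvector_def)
qed

text \<open>In coordinates with respect to a basis of \<open>W\<close> the restriction of \<open>S\<close> is a square matrix \<open>G\<close> with
\<open>S J = J G\<close>; an eigenvector of \<open>G\<close> is carried to one of \<open>S\<close>.\<close>
lemma invariant_subspace_eigenvector:
  assumes S: "S \<in> carrier_mat m m" and W: "lin_sub m W" and inv: "\<And>x. x \<in> W \<Longrightarrow> S *\<^sub>v x \<in> W"
    and pos: "0 < vdim m W"
  obtains w c where "w \<in> W" "w \<noteq> 0\<^sub>v m" "S *\<^sub>v w = c \<cdot>\<^sub>v w"
proof -
  define r where "r = vdim m W"
  obtain J where J: "J \<in> carrier_mat m r" "mran J = W" "mker J = {0\<^sub>v r}"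
    using basis_matrix[OF W] unfolding r_def by blast
  have "\<exists>g. g \<in> carrier_vec r \<and> S *\<^sub>v col J j = J *\<^sub>v g" if "j < r" for j
  proof -
    have "col J j = J *\<^sub>v unit_vec r j" using J(1) that by (intro eq_vecI) auto
    hence "col J j \<in> W" using J(1,2) mran_iff[OF J(1)] by auto
    from inv[OF this] show ?thesis using mran_iff[OF J(1)] J(2) by auto
  qed
  then obtain g where g: "\<And>j. j < r \<Longrightarrow> g j \<in> carrier_vec r \<and> S *\<^sub>v col J j = J *\<^sub>v g j" by metis
  define G where "G = mat_of_cols r (map g [0..<r])"
  have G: "G \<in> carrier_mat r r" unfolding G_def by auto
  have "S * J = J * G"
  proof (rule eq_matI)
    fix i j assume ij: "i < dim_row (J * G)" "j < dim_col (J * G)"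
    hence j: "j < r" "i < m" using J G by auto
    have "col G j = g j" unfolding G_def using j g by simp
    hence "col (S * J) j = col (J * G) j"
      unfolding col_mult2[OF S J(1) j(1)] col_mult2[OF J(1) G j(1)] using g[OF j(1)] by simp
    moreover have "(S * J) $$ (i, j) = col (S * J) j $ i" "(J * G) $$ (i, j) = col (J * G) j $ i"
      using j S J(1) G by auto
    ultimately show "(S * J) $$ (i, j) = (J * G) $$ (i, j)" by simp
  qed (use S J G in auto)
  obtain a c where a: "a \<in> carrier_vec r" "a \<noteq> 0\<^sub>v r" "G *\<^sub>v a = c \<cdot>\<^sub>v a"
    using eigenvector_exists[OF G] pos r_def by metis
  have "S *\<^sub>v (J *\<^sub>v a) = (S * J) *\<^sub>v a" using S J a by simp
  also have "\<dots> = J *\<^sub>v (G *\<^sub>v a)" unfolding \<open>S * J = J * G\<close> using G J a by simp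
  also have "\<dots> = c \<cdot>\<^sub>v (J *\<^sub>v a)" unfolding a(3) by (rule mult_mat_vec[OF J(1) a(1)])
  finally have e: "S *\<^sub>v (J *\<^sub>v a) = c \<cdot>\<^sub>v (J *\<^sub>v a)" .
  have "J *\<^sub>v a \<noteq> 0\<^sub>v m"
  proof
    assume "J *\<^sub>v a = 0\<^sub>v m"
    hence "a \<in> mker J" using a mker_iff[OF J(1)] by simp
    thus False using J(3) a(2) by simp
  qed
  moreover have "J *\<^sub>v a \<in> W" using J a mran_iff[OF J(1)] by auto
  ultimately show ?thesis using e that by blast
qed

definition eigen_frame :: "nat \<Rightarrow> complex mat \<Rightarrow> complex vec list \<Rightarrow> bool" where
  "eigen_frame m S us \<longleftrightarrow> set us \<subseteq> carrier_vec m \<and>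
     (\<forall>i<length us. \<forall>j<length us. us ! i \<bullet>c us ! j = (if i = j then 1 else 0)) \<and>
     (\<forall>u\<in>set us. \<exists>d::real. S *\<^sub>v u = complex_of_real d \<cdot>\<^sub>v u)"

text \<open>The vectors orthogonal to a partial eigenframe form an invariant subspace, because \<open>S\<close> is Hermitian
with real eigenvalues; it is nonzero as long as the frame is incomplete, so it contains a further
eigenvector.\<close>
lemma eigen_frame_exists:
  assumes S: "S \<in> herm_mats m"
  shows "k \<le> m \<Longrightarrow> \<exists>us. length us = k \<and> eigen_frame m S us"
proof (induction k)
  case 0
  show ?case by (rule exI[of _ "[]"]) (simp add: eigen_frame_def)
next
  case (Suc k)
  then obtain us where us: "length us = k" "eigen_frame m S us" by auto
  have usc: "u \<in> carrier_vec m" if "u \<in> set us" for u using us that by (auto simp: eigen_frame_def)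
  note Sc = hermD(1)[OF S]
  define R where "R = mat_of_rows m (map conjugate us)"
  have R: "R \<in> carrier_mat k m" using us unfolding R_def by auto
  have Rx: "(R *\<^sub>v x) $ i = x \<bullet>c us ! i" if "i < k" "x \<in> carrier_vec m" for i x
  proof -
    have "us ! i \<in> carrier_vec m" using usc us that by auto
    thus ?thesis unfolding R_def using that us usc
      by (simp add: comm_scalar_prod[of _ m])
  qed
  have W: "lin_sub m (mker R)" by (rule lin_sub_mker[OF R])
  have memW: "x \<in> mker R \<longleftrightarrow> x \<in> carrier_vec m \<and> (\<forall>u\<in>set us. x \<bullet>c u = 0)" for x
  proof -
    have "R *\<^sub>v x = 0\<^sub>v k \<longleftrightarrow> (\<forall>i<k. x \<bullet>c us ! i = 0)" if "x \<in> carrier_vec m"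
    proof
      assume "R *\<^sub>v x = 0\<^sub>v k"
      thus "\<forall>i<k. x \<bullet>c us ! i = 0" using Rx[OF _ that] by auto
    next
      assume "\<forall>i<k. x \<bullet>c us ! i = 0"
      thus "R *\<^sub>v x = 0\<^sub>v k" using Rx[OF _ that] R by (intro eq_vecI) auto
    qed
    thus ?thesis unfolding mker_iff[OF R] using us(1) by (auto simp: all_set_conv_all_nth)
  qed
  have "mat_rank R \<le> k" using vdim_le[OF lin_sub_mran[OF R]] R by (simp add: rank_eq_vdim)
  hence "0 < vdim m (mker R)" using rank_mker[OF R] Suc.prems by simp
  moreover have "S *\<^sub>v x \<in> mker R" if "x \<in> mker R" for x
  proof -
    have xc: "x \<in> carrier_vec m" using that memW by simp
    have "(S *\<^sub>v x) \<bullet>c u = 0" if u: "u \<in> set us" for u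
    proof -
      obtain d :: real where d: "S *\<^sub>v u = complex_of_real d \<cdot>\<^sub>v u"
        using us(2) u by (auto simp: eigen_frame_def)
      have "(S *\<^sub>v x) \<bullet>c u = cnj d * (x \<bullet>c u)"
        unfolding herm_cip[OF S xc usc[OF u]] d by (rule cip_smult_right[OF xc usc[OF u]])
      thus ?thesis using \<open>x \<in> mker R\<close> memW u by simp
    qed
    thus ?thesis using memW Sc by simp
  qed
  ultimately obtain w c where w: "w \<in> mker R" "w \<noteq> 0\<^sub>v m" "S *\<^sub>v w = c \<cdot>\<^sub>v w"
    using invariant_subspace_eigenvector[OF Sc W] by metis
  have wc: "w \<in> carrier_vec m" using w memW by simp
  define n where "n = (\<Sum>i<m. (cmod (w $ i))\<^sup>2)"
  have wn: "w \<bullet>c w = complex_of_real n" unfolding cip_self_real n_def using wc by simp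
  have "w \<bullet>c w \<noteq> 0" using cip_self_eq_0[OF wc] w(2) by simp
  hence n0: "n > 0" unfolding wn using n_def by (metis less_eq_real_def of_real_0 sum_nonneg zero_le_power2)
  define a where "a = complex_of_real (1 / sqrt n)"
  define u where "u = a \<cdot>\<^sub>v w"
  have uc: "u \<in> carrier_vec m" unfolding u_def using wc by simp
  have "u \<bullet>c u = a * (cnj a * (w \<bullet>c w))"
    unfolding u_def using wc by (simp add: cip_smult_left[of _ m] cip_smult_right[of _ m])
  also have "\<dots> = complex_of_real (1 / sqrt n * (1 / sqrt n) * n)" unfolding wn a_def
    by (simp only: complex_cnj_complex_of_real of_real_mult mult.assoc)
  also have "1 / sqrt n * (1 / sqrt n) * n = 1" using n0 by (simp add: field_simps)
  finally have uu: "u \<bullet>c u = 1" by simp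
  have Su: "S *\<^sub>v u = c \<cdot>\<^sub>v u" unfolding u_def mult_mat_vec[OF Sc wc] w(3)
    by (simp add: smult_smult_assoc mult.commute)
  have "c = complex_of_real (qf S u)"
  proof -
    have "(S *\<^sub>v u) \<bullet>c u = c * (u \<bullet>c u)" unfolding Su using uc by (rule cip_smult_left) (rule uc)
    thus ?thesis using herm_qf_complex[OF S uc] uu by simp
  qed
  hence ev: "\<exists>d::real. S *\<^sub>v u = complex_of_real d \<cdot>\<^sub>v u" using Su by blast
  have orth: "u \<bullet>c v = 0" "v \<bullet>c u = 0" if v: "v \<in> set us" for v
  proof -
    have "w \<bullet>c v = 0" using w(1) memW v by simp
    thus "u \<bullet>c v = 0" unfolding u_def using wc usc[OF v] by (simp add: cip_smult_left[of _ m])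
    thus "v \<bullet>c u = 0" using cip_sym[OF uc usc[OF v]] by simp
  qed
  have "eigen_frame m S (us @ [u])"
    unfolding eigen_frame_def
  proof (intro conjI allI impI)
    show "set (us @ [u]) \<subseteq> carrier_vec m" using us uc by (auto simp: eigen_frame_def)
    show "\<forall>v\<in>set (us @ [u]). \<exists>d::real. S *\<^sub>v v = complex_of_real d \<cdot>\<^sub>v v"
      using us ev by (auto simp: eigen_frame_def)
    fix i j assume "i < length (us @ [u])" "j < length (us @ [u])"
    thus "(us @ [u]) ! i \<bullet>c (us @ [u]) ! j = (if i = j then 1 else 0)"
      using us uu orth by (auto simp: eigen_frame_def nth_append less_Suc_eq)
  qed
  thus ?case using us(1) by (intro exI[of _ "us @ [u]"]) simp
qed

lemma hermitian_spectral:
  assumes S: "S \<in> herm_mats m"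
  obtains U and d :: "nat \<Rightarrow> real" where "U \<in> carrier_mat m m" "mat_adjoint U * U = 1\<^sub>m m" "U * mat_adjoint U = 1\<^sub>m m"
    "S * U = U * mat_diag m (\<lambda>i. complex_of_real (d i))"
proof -
  obtain us where us: "length us = m" "eigen_frame m S us" using eigen_frame_exists[OF S order_refl] by auto
  have usc: "us ! i \<in> carrier_vec m" if "i < m" for i using us that by (auto simp: eigen_frame_def)
  have "\<forall>i<m. \<exists>d::real. S *\<^sub>v us ! i = complex_of_real d \<cdot>\<^sub>v us ! i"
    using us by (auto simp: eigen_frame_def)
  then obtain d :: "nat \<Rightarrow> real" where d: "\<And>i. i < m \<Longrightarrow> S *\<^sub>v us ! i = complex_of_real (d i) \<cdot>\<^sub>v us ! i" by metis
  define U where "U = mat_of_cols m us"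
  have U: "U \<in> carrier_mat m m" unfolding U_def using us by auto
  have colU: "col U i = us ! i" if "i < m" for i unfolding U_def using usc that us by simp
  have UU: "mat_adjoint U * U = 1\<^sub>m m"
  proof (rule eq_matI)
    fix i j assume "i < dim_row (1\<^sub>m m)" "j < dim_col (1\<^sub>m m)"
    hence ij: "i < m" "j < m" by auto
    have r: "row (mat_adjoint U) i = conjugate (us ! i)"
      unfolding colU[OF ij(1), symmetric] using ij U by (intro eq_vecI) simp_all
    have "(mat_adjoint U * U) $$ (i,j) = conjugate (us ! i) \<bullet> us ! j"
      using ij U r colU[OF ij(2)] by simp
    also have "\<dots> = us ! j \<bullet>c us ! i" using usc ij by (intro comm_scalar_prod[of _ m]) auto
    also have "\<dots> = (if j = i then 1 else 0)" using us ij by (auto simp: eigen_frame_def)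
    finally show "(mat_adjoint U * U) $$ (i,j) = 1\<^sub>m m $$ (i, j)" using ij by auto
  qed (use U in auto)
  have "U * mat_adjoint U = 1\<^sub>m m" by (rule mat_mult_left_right_inverse[OF _ U UU]) (use U in simp)
  moreover have "S * U = U * mat_diag m (\<lambda>i. complex_of_real (d i))"
  proof (rule eq_matI)
    fix i j assume "i < dim_row (U * mat_diag m (\<lambda>i. complex_of_real (d i)))"
      "j < dim_col (U * mat_diag m (\<lambda>i. complex_of_real (d i)))"
    hence ij: "i < m" "j < m" using U by (auto simp: mat_diag_def)
    have "(S * U) $$ (i,j) = (S *\<^sub>v us ! j) $ i" using ij U hermD(1)[OF S] colU by simp
    also have "\<dots> = complex_of_real (d j) * us ! j $ i" using d[OF ij(2)] usc[OF ij(2)] ij by simp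
    also have "us ! j $ i = U $$ (i, j)" using colU[OF ij(2)] ij U by (metis carrier_matD index_col)
    finally show "(S * U) $$ (i,j) = (U * mat_diag m (\<lambda>i. complex_of_real (d i))) $$ (i,j)"
      using ij mat_diag_mult_right[OF U] by (simp add: mult.commute)
  qed (use U hermD(1)[OF S] in \<open>auto simp: mat_diag_def\<close>)
  ultimately show ?thesis using that[OF U UU] by blast
qed

section \<open>Inertia counts eigenvalue signs\<close>

lemma mat_vec_zero [simp]: "A \<in> carrier_mat nr nc \<Longrightarrow> A *\<^sub>v 0\<^sub>v nc = (0\<^sub>v nr :: complex vec)"
  by (intro eq_vecI) auto

definition spectral_frame :: "nat \<Rightarrow> complex mat \<Rightarrow> complex mat \<Rightarrow> (nat \<Rightarrow> real) \<Rightarrow> bool" where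
  "spectral_frame m S U d \<longleftrightarrow> S \<in> carrier_mat m m \<and> U \<in> carrier_mat m m \<and>
     mat_adjoint U * U = 1\<^sub>m m \<and> U * mat_adjoint U = 1\<^sub>m m \<and>
     S * U = U * mat_diag m (\<lambda>i. complex_of_real (d i))"

lemma spectral_frame_exists: "S \<in> herm_mats m \<Longrightarrow> \<exists>U d. spectral_frame m S U d"
  using hermitian_spectral[of S m] hermD(1)[of S m] unfolding spectral_frame_def by metis

lemma spectral_frame_char_poly:
  assumes f: "spectral_frame m S U d"
  shows "char_poly S = (\<Prod>a\<leftarrow>map (\<lambda>i. complex_of_real (d i)) [0..<m]. [:- a, 1:])"
proof -
  let ?D = "mat_diag m (\<lambda>i. complex_of_real (d i))"
  note f = f[unfolded spectral_frame_def]
  have c: "S \<in> carrier_mat m m" "U \<in> carrier_mat m m" "mat_adjoint U \<in> carrier_mat m m" using f by auto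
  have "U * ?D * mat_adjoint U = S * U * mat_adjoint U" using f by simp
  also have "\<dots> = S * (U * mat_adjoint U)" using c by (simp add: assoc_mult_mat[of _ m m _ m _ m])
  also have "\<dots> = S" using f c by simp
  finally have "similar_mat S ?D" unfolding similar_mat_def similar_mat_wit_def Let_def
    using f c by (intro exI[of _ U] exI[of _ "mat_adjoint U"]) auto
  hence "char_poly S = char_poly ?D" by (rule char_poly_similar)
  also have "\<dots> = (\<Prod>a\<leftarrow>diag_mat ?D. [:- a, 1:])"
    by (rule char_poly_upper_triangular[of _ m]) (auto simp: mat_diag_def)
  also have "diag_mat ?D = map (\<lambda>i. complex_of_real (d i)) [0..<m]"
    by (auto simp: diag_mat_def mat_diag_def)
  finally show ?thesis .
qed

lemma order_prod_linear: "order x (\<Prod>a\<leftarrow>as. [:- a, 1:]) = length (filter (\<lambda>a. a = x) as)"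
  for x :: complex
proof (induction as)
  case (Cons a as)
  have "[:- a, 1:] * (\<Prod>a\<leftarrow>as. [:- a, 1:]) \<noteq> 0" by (auto simp: prod_list_zero_iff simp del: mult_pCons_left)
  hence "order x ([:- a, 1:] * (\<Prod>a\<leftarrow>as. [:- a, 1:])) = order x [:- a, 1:] + order x (\<Prod>a\<leftarrow>as. [:- a, 1:])"
    by (rule order_mult)
  thus ?case using Cons by (auto simp: order_linear' simp del: mult_pCons_left)
qed simp

text \<open>The characteristic polynomial is the product of the factors \<open>x - d i\<close>, so the order of a root counts
how often it occurs among the \<open>d i\<close>.\<close>
lemma sum_order_char_poly:
  assumes f: "spectral_frame m S U d"
  shows "(\<Sum>x | P x \<and> eigenvalue S (complex_of_real x). order (complex_of_real x) (char_poly S))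
    = card {i. i < m \<and> P (d i)}"
proof -
  let ?A = "{i. i < m \<and> P (d i)}"
  have S: "S \<in> carrier_mat m m" using f by (simp add: spectral_frame_def)
  have ev: "eigenvalue S (complex_of_real x) \<longleftrightarrow> (\<exists>i<m. d i = x)" for x
    unfolding eigenvalue_root_char_poly[OF S] spectral_frame_char_poly[OF f]
    by (auto simp: poly_prod_list prod_list_zero_iff)
  have ord: "order (complex_of_real x) (char_poly S) = card {i. i < m \<and> d i = x}" for x
  proof -
    have "order (complex_of_real x) (char_poly S) = length (filter (\<lambda>i. d i = x) [0..<m])"
      unfolding spectral_frame_char_poly[OF f] order_prod_linear filter_map length_map by (simp add: o_def)
    also have "\<dots> = card (set (filter (\<lambda>i. d i = x) [0..<m]))"
      by (rule distinct_card[symmetric]) simp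
    also have "set (filter (\<lambda>i. d i = x) [0..<m]) = {i. i < m \<and> d i = x}" by auto
    finally show ?thesis .
  qed
  have set: "{x. P x \<and> eigenvalue S (complex_of_real x)} = d ` ?A" unfolding ev by auto
  have "card ?A = (\<Sum>i\<in>?A. 1)" by simp
  also have "\<dots> = (\<Sum>x\<in>d ` ?A. \<Sum>i\<in>{i \<in> ?A. d i = x}. 1)" by (rule sum.image_gen) simp
  also have "\<dots> = (\<Sum>x\<in>d ` ?A. order (complex_of_real x) (char_poly S))"
  proof (rule sum.cong[OF refl])
    fix x assume "x \<in> d ` ?A"
    hence "{i \<in> ?A. d i = x} = {i. i < m \<and> d i = x}" by auto
    thus "(\<Sum>i\<in>{i \<in> ?A. d i = x}. 1) = order (complex_of_real x) (char_poly S)" unfolding ord by simp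
  qed
  finally show ?thesis unfolding set by simp
qed

lemma inertia_card:
  assumes "spectral_frame m S U d"
  shows "pos_inertia S = card {i. i < m \<and> 0 < d i}" "neg_inertia S = card {i. i < m \<and> d i < 0}"
  using sum_order_char_poly[OF assms, of "\<lambda>x. 0 < x"] sum_order_char_poly[OF assms, of "\<lambda>x. x < 0"]
  unfolding pos_inertia_def neg_inertia_def by auto

lemma spectral_frame_uminus:
  assumes f: "spectral_frame m S U d"
  shows "spectral_frame m (- S) U (\<lambda>i. - d i)"
proof -
  have c: "S \<in> carrier_mat m m" "U \<in> carrier_mat m m" using f by (auto simp: spectral_frame_def)
  have "(- S) * U = - (S * U)" using c by simp
  also have "S * U = U * mat_diag m (\<lambda>i. complex_of_real (d i))" using f by (simp add: spectral_frame_def)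
  also have "- (U * mat_diag m (\<lambda>i. complex_of_real (d i))) = U * (- mat_diag m (\<lambda>i. complex_of_real (d i)))"
    using c by (subst uminus_mult_right_mat) (auto simp: mat_diag_def)
  also have "- mat_diag m (\<lambda>i. complex_of_real (d i)) = mat_diag m (\<lambda>i. complex_of_real (- d i))"
    by (intro eq_matI) (auto simp: mat_diag_def)
  finally show ?thesis using f by (simp add: spectral_frame_def)
qed

lemma inertia_uminus:
  assumes S: "S \<in> herm_mats m"
  shows "pos_inertia (- S) = neg_inertia S" "neg_inertia (- S) = pos_inertia S"
proof -
  obtain U d where f: "spectral_frame m S U d" using spectral_frame_exists[OF S] by blast
  show "pos_inertia (- S) = neg_inertia S" "neg_inertia (- S) = pos_inertia S"
    unfolding inertia_card[OF f] inertia_card[OF spectral_frame_uminus[OF f]] by simp_all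
qed

definition coord_sub :: "nat \<Rightarrow> complex mat \<Rightarrow> nat set \<Rightarrow> complex vec set" where
  "coord_sub m U I = {x \<in> carrier_vec m. \<forall>i<m. i \<notin> I \<longrightarrow> (mat_adjoint U *\<^sub>v x) $ i = 0}"

lemma lin_sub_coord:
  assumes U: "U \<in> carrier_mat m m"
  shows "lin_sub m (coord_sub m U I)"
proof (rule lin_subI)
  have U': "mat_adjoint U \<in> carrier_mat m m" using U by simp
  show "0\<^sub>v m \<in> coord_sub m U I" using U by (simp add: coord_sub_def)
  fix x y assume "x \<in> coord_sub m U I" "y \<in> coord_sub m U I"
  thus "x + y \<in> coord_sub m U I" using U
    by (auto simp: coord_sub_def mult_add_distrib_mat_vec[OF U'] simp del: index_mult_mat_vec)
next
  have U': "mat_adjoint U \<in> carrier_mat m m" using U by simp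
  fix c x assume "x \<in> coord_sub m U I"
  thus "c \<cdot>\<^sub>v x \<in> coord_sub m U I" using U
    by (auto simp: coord_sub_def mult_mat_vec[OF U'] simp del: index_mult_mat_vec)
qed (auto simp: coord_sub_def)

text \<open>Adding an index to \<open>I\<close> frees one more coordinate, which raises the dimension by one.\<close>
lemma vdim_coord:
  assumes f: "spectral_frame m S U d" and I: "I \<subseteq> {..<m}"
  shows "vdim m (coord_sub m U I) = card I"
proof -
  have U: "U \<in> carrier_mat m m" "mat_adjoint U * U = 1\<^sub>m m" "U * mat_adjoint U = 1\<^sub>m m"
    using f by (auto simp: spectral_frame_def)
  have U': "mat_adjoint U \<in> carrier_mat m m" using U by simp
  have "finite I" using I finite_subset by blast
  thus ?thesis using I
  proof (induction I)
    case empty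
    have "coord_sub m U {} = {0\<^sub>v m}"
    proof (intro equalityI subsetI)
      fix x assume x: "x \<in> coord_sub m U {}"
      hence xc: "x \<in> carrier_vec m" by (simp add: coord_sub_def)
      have "mat_adjoint U *\<^sub>v x = 0\<^sub>v m" using x U by (intro eq_vecI) (auto simp: coord_sub_def)
      hence "(U * mat_adjoint U) *\<^sub>v x = 0\<^sub>v m" using assoc_mult_mat_vec[OF U(1) U' xc] U(1)
        by (auto intro!: eq_vecI)
      thus "x \<in> {0\<^sub>v m}" using U(3) xc by simp
    qed (use lin_subD(2)[OF lin_sub_coord[OF U(1)]] in auto)
    thus ?case using vdim_zero by simp
  next
    case (insert j I)
    let ?C = "coord_sub m U (insert j I)"
    let ?f = "\<lambda>x. vec 1 (\<lambda>_. (mat_adjoint U *\<^sub>v x) $ j)"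
    have j: "j < m" using insert by simp
    have C: "lin_sub m ?C" by (rule lin_sub_coord[OF U(1)])
    have l: "lin_on ?C 1 ?f" unfolding lin_on_def
      using lin_subD(5)[OF C] j U
      by (auto simp: mult_add_distrib_mat_vec[OF U'] mult_mat_vec[OF U'] intro!: eq_vecI)
    have "?f ` ?C = carrier_vec 1"
    proof (intro equalityI subsetI)
      fix v :: "complex vec" assume v: "v \<in> carrier_vec 1"
      let ?x = "U *\<^sub>v ((v $ 0) \<cdot>\<^sub>v unit_vec m j)"
      have "mat_adjoint U *\<^sub>v ?x = (mat_adjoint U * U) *\<^sub>v ((v $ 0) \<cdot>\<^sub>v unit_vec m j)"
        using U U' by (subst assoc_mult_mat_vec[OF U' U(1)]) auto
      hence a: "mat_adjoint U *\<^sub>v ?x = (v $ 0) \<cdot>\<^sub>v unit_vec m j" using U by simp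
      have "?x \<in> ?C" unfolding coord_sub_def mem_Collect_eq a using U by (auto simp: unit_vec_def)
      moreover have "v = ?f ?x" unfolding a using v j by (intro eq_vecI) auto
      ultimately show "v \<in> ?f ` ?C" by blast
    qed auto
    moreover have "{x \<in> ?C. ?f x = 0\<^sub>v 1} = coord_sub m U I"
    proof -
      have "?f x = 0\<^sub>v 1 \<longleftrightarrow> (mat_adjoint U *\<^sub>v x) $ j = 0" for x
        by (metis (no_types, lifting) eq_vecI index_vec index_zero_vec less_one dim_vec)
      thus ?thesis using j insert.hyps by (auto simp: coord_sub_def)
    qed
    ultimately have "vdim m ?C = 1 + vdim m (coord_sub m U I)"
      using rank_nullity[OF l C] vdim_carrier[of 1] by simp
    thus ?case using insert by simp
  qed
qed

lemma spectral_frame_qf: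
  assumes f: "spectral_frame m S U d" and x: "x \<in> carrier_vec m"
  shows "qf S x = (\<Sum>i<m. d i * (cmod ((mat_adjoint U *\<^sub>v x) $ i))\<^sup>2)"
    and "S *\<^sub>v x = 0\<^sub>v m \<longleftrightarrow> (\<forall>i<m. d i \<noteq> 0 \<longrightarrow> (mat_adjoint U *\<^sub>v x) $ i = 0)"
proof -
  let ?D = "mat_diag m (\<lambda>i. complex_of_real (d i))"
  have U: "U \<in> carrier_mat m m" "mat_adjoint U * U = 1\<^sub>m m" "U * mat_adjoint U = 1\<^sub>m m"
    "S \<in> carrier_mat m m" "S * U = U * ?D" using f by (auto simp: spectral_frame_def)
  have U': "mat_adjoint U \<in> carrier_mat m m" using U by simp
  define a where "a = mat_adjoint U *\<^sub>v x"
  have a: "a \<in> carrier_vec m" unfolding a_def using U' by simp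
  have xa: "x = U *\<^sub>v a" unfolding a_def using assoc_mult_mat_vec[OF U(1) U' x] U(3) x by simp
  have Da: "?D *\<^sub>v a = vec m (\<lambda>i. complex_of_real (d i) * a $ i)"
  proof (rule eq_vecI)
    fix i assume "i < dim_vec (vec m (\<lambda>i. complex_of_real (d i) * a $ i))"
    hence i: "i < m" by simp
    have "(?D *\<^sub>v a) $ i = (\<Sum>j\<in>{0..<m}. (if i = j then complex_of_real (d j) * a $ j else 0))"
    proof -
      have "(?D *\<^sub>v a) $ i = (\<Sum>j\<in>{0..<m}. (if i = j then complex_of_real (d j) else 0) * a $ j)"
        using i a by (simp add: mat_diag_def scalar_prod_def)
      also have "\<dots> = (\<Sum>j\<in>{0..<m}. (if i = j then complex_of_real (d j) * a $ j else 0))"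
        by (rule sum.cong) auto
      finally show ?thesis .
    qed
    also have "\<dots> = complex_of_real (d i) * a $ i" using i by simp
    finally show "(?D *\<^sub>v a) $ i = vec m (\<lambda>i. complex_of_real (d i) * a $ i) $ i" using i by simp
  qed (simp add: mat_diag_def)
  have "S *\<^sub>v x = S *\<^sub>v (U *\<^sub>v a)" using xa by (rule arg_cong)
  also have "\<dots> = (S * U) *\<^sub>v a" by (rule assoc_mult_mat_vec[OF U(4) U(1) a, symmetric])
  also have "\<dots> = U *\<^sub>v (?D *\<^sub>v a)" unfolding U(5)
    by (rule assoc_mult_mat_vec[OF U(1) mat_diag_dim a])
  finally have Sx: "S *\<^sub>v x = U *\<^sub>v (?D *\<^sub>v a)" .
  have Dac: "?D *\<^sub>v a \<in> carrier_vec m" unfolding Da by simp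
  have "(S *\<^sub>v x) \<bullet>c x = (?D *\<^sub>v a) \<bullet>c a" unfolding Sx using cip_adjoint[OF U(1) Dac x] a_def by simp
  also have "\<dots> = (\<Sum>i<m. complex_of_real (d i) * (a $ i * cnj (a $ i)))"
    unfolding Da scalar_prod_def using a by (simp add: atLeast0LessThan mult.assoc)
  also have "\<dots> = complex_of_real (\<Sum>i<m. d i * (cmod (a $ i))\<^sup>2)"
    by (simp add: complex_norm_square[symmetric] del: of_real_power)
  finally show "qf S x = (\<Sum>i<m. d i * (cmod ((mat_adjoint U *\<^sub>v x) $ i))\<^sup>2)"
    unfolding qf_def a_def[symmetric] by simp
  have "S *\<^sub>v x = 0\<^sub>v m \<longleftrightarrow> ?D *\<^sub>v a = 0\<^sub>v m"
  proof
    assume "S *\<^sub>v x = 0\<^sub>v m"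
    hence "mat_adjoint U *\<^sub>v (U *\<^sub>v (?D *\<^sub>v a)) = 0\<^sub>v m"
      unfolding Sx[symmetric] using mat_vec_zero[OF U'] by simp
    thus "?D *\<^sub>v a = 0\<^sub>v m" using assoc_mult_mat_vec[OF U' U(1) Dac] U(2) Dac by simp
  qed (use Sx U in simp)
  also have "\<dots> \<longleftrightarrow> (\<forall>i<m. d i \<noteq> 0 \<longrightarrow> a $ i = 0)"
  proof -
    have "?D *\<^sub>v a = 0\<^sub>v m \<longleftrightarrow> (\<forall>i<m. (?D *\<^sub>v a) $ i = 0)"
      using Dac by (metis carrier_vecD eq_vecI index_zero_vec)
    thus ?thesis unfolding Da by auto
  qed
  finally show "S *\<^sub>v x = 0\<^sub>v m \<longleftrightarrow> (\<forall>i<m. d i \<noteq> 0 \<longrightarrow> (mat_adjoint U *\<^sub>v x) $ i = 0)"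
    unfolding a_def .
qed

text \<open>The span of the eigenvectors with positive eigenvalue.\<close>
lemma positive_subspace_exists:
  assumes S: "S \<in> herm_mats m"
  obtains P where "lin_sub m P" "vdim m P = pos_inertia S" "\<And>x. x \<in> P \<Longrightarrow> x \<noteq> 0\<^sub>v m \<Longrightarrow> 0 < qf S x"
proof -
  obtain U d where f: "spectral_frame m S U d" using spectral_frame_exists[OF S] by blast
  have U: "U \<in> carrier_mat m m" "U * mat_adjoint U = 1\<^sub>m m" using f by (auto simp: spectral_frame_def)
  let ?I = "{i. i < m \<and> 0 < d i}"
  let ?P = "coord_sub m U ?I"
  show ?thesis
  proof (rule that)
    show "lin_sub m ?P" by (rule lin_sub_coord[OF U(1)])
    show "vdim m ?P = pos_inertia S" unfolding inertia_card[OF f] by (rule vdim_coord[OF f]) auto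
    fix x assume x: "x \<in> ?P" "x \<noteq> 0\<^sub>v m"
    hence xc: "x \<in> carrier_vec m" by (simp add: coord_sub_def)
    let ?a = "mat_adjoint U *\<^sub>v x"
    have nn: "0 \<le> d i * (cmod (?a $ i))\<^sup>2" if "i < m" for i
      using x(1) that by (cases "0 < d i") (auto simp: coord_sub_def)
    have "\<exists>i<m. ?a $ i \<noteq> 0"
    proof (rule ccontr)
      assume "\<not> ?thesis"
      hence "?a = 0\<^sub>v m" using U by (intro eq_vecI) auto
      hence "(U * mat_adjoint U) *\<^sub>v x = 0\<^sub>v m"
        using assoc_mult_mat_vec[OF U(1) _ xc, of "mat_adjoint U"] U(1) by (auto intro!: eq_vecI)
      thus False using U x(2) xc by simp
    qed
    then obtain i where i: "i < m" "?a $ i \<noteq> 0" by blast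
    hence "0 < d i" using x(1) by (auto simp: coord_sub_def)
    hence "0 < d i * (cmod (?a $ i))\<^sup>2" using i by simp
    also have "\<dots> \<le> (\<Sum>i<m. d i * (cmod (?a $ i))\<^sup>2)"
      by (rule member_le_sum) (use i nn in auto)
    finally show "0 < qf S x" unfolding spectral_frame_qf(1)[OF f xc] .
  qed
qed

text \<open>The span of the eigenvectors with nonpositive eigenvalue. The last property, that the form vanishes
there only on the kernel, is what makes semidefinite subspaces usable below.\<close>
lemma nonpositive_subspace_exists:
  assumes S: "S \<in> herm_mats m"
  obtains N where "lin_sub m N" "vdim m N + pos_inertia S = m" "\<And>x. x \<in> N \<Longrightarrow> qf S x \<le> 0"
    "\<And>x. x \<in> N \<Longrightarrow> 0 \<le> qf S x \<Longrightarrow> x \<in> mker S"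
proof -
  obtain U d where f: "spectral_frame m S U d" using spectral_frame_exists[OF S] by blast
  have U: "U \<in> carrier_mat m m" "U * mat_adjoint U = 1\<^sub>m m" using f by (auto simp: spectral_frame_def)
  let ?I = "{i. i < m \<and> \<not> 0 < d i}"
  let ?N = "coord_sub m U ?I"
  have np: "d i * (cmod ((mat_adjoint U *\<^sub>v x) $ i))\<^sup>2 \<le> 0" if "i < m" "x \<in> ?N" for i x
    using that by (cases "0 < d i") (auto simp: coord_sub_def mult_nonpos_nonneg)
  have le: "qf S x \<le> 0" if x: "x \<in> ?N" for x
  proof -
    have xc: "x \<in> carrier_vec m" using x by (simp add: coord_sub_def)
    show ?thesis unfolding spectral_frame_qf(1)[OF f xc] by (rule sum_nonpos) (use np x in auto)
  qed
  show ?thesis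
  proof (rule that)
    show "lin_sub m ?N" by (rule lin_sub_coord[OF U(1)])
    have "vdim m ?N = card ?I" by (rule vdim_coord[OF f]) auto
    moreover have "card ?I + card {i. i < m \<and> 0 < d i} = card {..<m}"
    proof -
      have "?I \<union> {i. i < m \<and> 0 < d i} = {..<m}" by auto
      thus ?thesis by (subst card_Un_disjoint[symmetric]) auto
    qed
    ultimately show "vdim m ?N + pos_inertia S = m" unfolding inertia_card[OF f] by simp
    show "qf S x \<le> 0" if "x \<in> ?N" for x by (rule le[OF that])
    fix x assume x: "x \<in> ?N" "0 \<le> qf S x"
    have xc: "x \<in> carrier_vec m" using x by (simp add: coord_sub_def)
    let ?a = "mat_adjoint U *\<^sub>v x"
    have "(\<Sum>i<m. - (d i * (cmod (?a $ i))\<^sup>2)) = 0"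
      using le[OF x(1)] x(2) unfolding spectral_frame_qf(1)[OF f xc] sum_negf by simp
    hence "\<forall>i\<in>{..<m}. - (d i * (cmod (?a $ i))\<^sup>2) = 0"
      by (subst (asm) sum_nonneg_eq_0_iff) (use np x(1) in auto)
    hence "S *\<^sub>v x = 0\<^sub>v m" unfolding spectral_frame_qf(2)[OF f xc] by auto
    thus "x \<in> mker S" using mker_iff[OF hermD(1)[OF S]] xc by simp
  qed
qed

lemma rank_eq_inertia:
  assumes S: "S \<in> herm_mats m"
  shows "mat_rank S = pos_inertia S + neg_inertia S"
proof -
  obtain U d where f: "spectral_frame m S U d" using spectral_frame_exists[OF S] by blast
  let ?I = "{i. i < m \<and> d i = 0}"
  have Sc: "S \<in> carrier_mat m m" using hermD(1)[OF S] .
  have "mker S = coord_sub m U ?I"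
    using spectral_frame_qf(2)[OF f] by (auto simp: mker_iff[OF Sc] coord_sub_def)
  hence "vdim m (mker S) = card ?I" using vdim_coord[OF f, of ?I] by auto
  moreover have "card ?I + (card {i. i < m \<and> 0 < d i} + card {i. i < m \<and> d i < 0}) = card {..<m}"
  proof -
    have "?I \<union> ({i. i < m \<and> 0 < d i} \<union> {i. i < m \<and> d i < 0}) = {..<m}" by auto
    moreover have "card ({i. i < m \<and> 0 < d i} \<union> {i. i < m \<and> d i < 0}) =
        card {i. i < m \<and> 0 < d i} + card {i. i < m \<and> d i < 0}"
      by (rule card_Un_disjoint) auto
    moreover have "card (?I \<union> ({i. i < m \<and> 0 < d i} \<union> {i. i < m \<and> d i < 0})) =
        card ?I + card ({i. i < m \<and> 0 < d i} \<union> {i. i < m \<and> d i < 0})"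
      by (rule card_Un_disjoint) auto
    ultimately show ?thesis by simp
  qed
  ultimately show ?thesis using rank_mker[OF Sc] unfolding inertia_card[OF f] by simp
qed

section \<open>Inertia as a bound on dimensions of definite subspaces\<close>

text \<open>Let \<open>G\<close> be the span of the eigenvectors with nonpositive eigenvalue. A vector in both \<open>N\<close> and \<open>G\<close>
has form value zero and therefore lies in the kernel, while \<open>G\<close> has codimension \<open>pos_inertia S\<close>.\<close>
lemma nonneg_dim_le:
  assumes S: "S \<in> herm_mats m" and N: "lin_sub m N" and nn: "\<And>x. x \<in> N \<Longrightarrow> 0 \<le> qf S x"
  shows "vdim m N \<le> pos_inertia S + vdim m (N \<inter> mker S)"
proof -
  obtain G where G: "lin_sub m G" "vdim m G + pos_inertia S = m"
    "\<And>x. x \<in> G \<Longrightarrow> 0 \<le> qf S x \<Longrightarrow> x \<in> mker S"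
    by (rule nonpositive_subspace_exists[OF S]) blast
  have "vdim m (N \<inter> G) \<le> vdim m (N \<inter> mker S)"
    by (rule vdim_mono[OF lin_sub_Int[OF N G(1)] lin_sub_Int[OF N lin_sub_mker[OF hermD(1)[OF S]]]])
       (use nn G(3) in blast)
  thus ?thesis using vdim_Int_ge[OF N G(1)] G(2) by simp
qed

lemma nonpos_dim_le:
  assumes S: "S \<in> herm_mats m" and N: "lin_sub m N" and np: "\<And>x. x \<in> N \<Longrightarrow> qf S x \<le> 0"
  shows "vdim m N + pos_inertia S \<le> m"
proof -
  obtain P where P: "lin_sub m P" "vdim m P = pos_inertia S" "\<And>x. x \<in> P \<Longrightarrow> x \<noteq> 0\<^sub>v m \<Longrightarrow> 0 < qf S x"
    by (rule positive_subspace_exists[OF S]) blast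
  have "N \<inter> P = {0\<^sub>v m}"
  proof -
    have "x = 0\<^sub>v m" if "x \<in> N" "x \<in> P" for x using np[OF that(1)] P(3)[OF that(2)] by fastforce
    thus ?thesis using lin_subD(2)[OF N] lin_subD(2)[OF P(1)] by blast
  qed
  hence "vdim m (N \<inter> P) = 0" using vdim_zero by simp
  thus ?thesis using vdim_Int_ge[OF N P(1)] P(2) by simp
qed

lemma pos_dim_le:
  assumes S: "S \<in> herm_mats m" and P: "lin_sub m P" and p: "\<And>x. x \<in> P \<Longrightarrow> x \<noteq> 0\<^sub>v m \<Longrightarrow> 0 < qf S x"
  shows "vdim m P \<le> pos_inertia S"
proof -
  note Sc = hermD(1)[OF S]
  have "0 \<le> qf S x" if "x \<in> P" for x using p[OF that] qf_zero[OF Sc] by (cases "x = 0\<^sub>v m") auto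
  moreover have "P \<inter> mker S = {0\<^sub>v m}"
  proof -
    have "x = 0\<^sub>v m" if "x \<in> P" "x \<in> mker S" for x using p[OF that(1)] mker_qf[OF Sc that(2)] by auto
    thus ?thesis using lin_subD(2)[OF P] lin_subD(2)[OF lin_sub_mker[OF Sc]] by blast
  qed
  ultimately show ?thesis using nonneg_dim_le[OF S P] vdim_zero[of m] by simp
qed

lemma pos_semidef_iff: "S \<in> carrier_mat m m \<Longrightarrow>
    pos_semidef S \<longleftrightarrow> S \<in> herm_mats m \<and> (\<forall>x\<in>carrier_vec m. 0 \<le> qf S x)"
  unfolding pos_semidef_def qf_def by auto

lemma pos_def_iff: "S \<in> carrier_mat m m \<Longrightarrow>
    pos_def S \<longleftrightarrow> S \<in> herm_mats m \<and> (\<forall>x\<in>carrier_vec m. x \<noteq> 0\<^sub>v m \<longrightarrow> 0 < qf S x)"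
  unfolding pos_def_def qf_def by auto

lemma mker_uminus:
  assumes S: "S \<in> carrier_mat m k"
  shows "mker (- S) = mker S"
proof -
  have "- (S *\<^sub>v x) = 0\<^sub>v m \<longleftrightarrow> S *\<^sub>v x = 0\<^sub>v m" for x
  proof
    assume z: "- (S *\<^sub>v x) = 0\<^sub>v m"
    have "S *\<^sub>v x = - (- (S *\<^sub>v x))" by simp
    thus "S *\<^sub>v x = 0\<^sub>v m" unfolding z by simp
  qed simp
  thus ?thesis using S by (auto simp: mker_iff[of _ m k])
qed

lemma pos_semidef_inertia:
  assumes S: "S \<in> herm_mats m"
  shows "pos_semidef S \<longleftrightarrow> neg_inertia S = 0"
proof
  note Sc = hermD(1)[OF S]
  assume "pos_semidef S"
  hence "qf (- S) x \<le> 0" if "x \<in> carrier_vec m" for x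
    using that pos_semidef_iff[OF Sc] qf_uminus[OF Sc that] by auto
  from nonpos_dim_le[OF herm_uminus[OF S] lin_sub_carrier this] vdim_carrier[of m]
  show "neg_inertia S = 0" using inertia_uminus[OF S] by simp
next
  note Sc = hermD(1)[OF S]
  assume "neg_inertia S = 0"
  hence 0: "pos_inertia (- S) = 0" using inertia_uminus[OF S] by simp
  obtain N where N: "lin_sub m N" "vdim m N + pos_inertia (- S) = m" "\<And>x. x \<in> N \<Longrightarrow> qf (- S) x \<le> 0"
    by (rule nonpositive_subspace_exists[OF herm_uminus[OF S]]) blast
  have "N = carrier_vec m"
    by (rule vdim_eq_imp_eq[OF N(1) lin_sub_carrier lin_subD(1)[OF N(1)]]) (use N(2) 0 vdim_carrier in simp)
  hence "0 \<le> qf S x" if "x \<in> carrier_vec m" for x using N(3)[of x] qf_uminus[OF Sc that] that by simp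
  thus "pos_semidef S" using pos_semidef_iff[OF Sc] S by simp
qed

lemma pos_def_inertia:
  assumes S: "S \<in> herm_mats m"
  shows "pos_def S \<longleftrightarrow> pos_inertia S = m"
proof
  note Sc = hermD(1)[OF S]
  assume "pos_def S"
  hence "0 < qf S x" if "x \<in> carrier_vec m" "x \<noteq> 0\<^sub>v m" for x
    using that pos_def_iff[OF Sc] by auto
  from pos_dim_le[OF S lin_sub_carrier this] vdim_carrier[of m]
  have "m \<le> pos_inertia S" by simp
  moreover have "pos_inertia S \<le> m" using nonpos_dim_le[OF S lin_sub_zero] qf_zero[OF Sc] by simp
  ultimately show "pos_inertia S = m" by simp
next
  note Sc = hermD(1)[OF S]
  assume i: "pos_inertia S = m"
  obtain P where P: "lin_sub m P" "vdim m P = pos_inertia S" "\<And>x. x \<in> P \<Longrightarrow> x \<noteq> 0\<^sub>v m \<Longrightarrow> 0 < qf S x"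
    by (rule positive_subspace_exists[OF S]) blast
  have "P = carrier_vec m"
    by (rule vdim_eq_imp_eq[OF P(1) lin_sub_carrier lin_subD(1)[OF P(1)]]) (use P(2) i vdim_carrier in simp)
  thus "pos_def S" using pos_def_iff[OF Sc] S P(3) by blast
qed

lemma rank_less:
  assumes S: "S \<in> carrier_mat m m" and S': "S' \<in> carrier_mat m m" and sub: "mker S \<subseteq> mker S'"
    and x: "x \<in> mker S'" "x \<notin> mker S"
  shows "mat_rank S' < mat_rank S"
proof -
  have "vdim m (mker S) < vdim m (mker S')"
    using vdim_eq_imp_eq[OF lin_sub_mker[OF S] lin_sub_mker[OF S'] sub] x
    by (metis linorder_not_le)
  thus ?thesis using rank_mker[OF S] rank_mker[OF S'] S S' by simp
qed

lemma rank_le: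
  assumes S: "S \<in> carrier_mat m m" and S': "S' \<in> carrier_mat m m" and sub: "mker S \<subseteq> mker S'"
  shows "mat_rank S' \<le> mat_rank S"
  using rank_mker[OF S] rank_mker[OF S'] vdim_mono[OF lin_sub_mker[OF S] lin_sub_mker[OF S'] sub] by simp

section \<open>Matrices with appended columns\<close>

lemma append_cols_carrier [simp]:
  "A \<in> carrier_mat m k \<Longrightarrow> B \<in> carrier_mat m n \<Longrightarrow> A @\<^sub>c B \<in> carrier_mat m (k + n)"
  unfolding append_cols_def by (intro carrier_matI) auto

lemma append_cols_mult:
  assumes A: "A \<in> carrier_mat m k" and B: "B \<in> carrier_mat m n" and x: "x \<in> carrier_vec k" and y: "y \<in> carrier_vec n"
  shows "(A @\<^sub>c B) *\<^sub>v (x @\<^sub>v y) = A *\<^sub>v x + B *\<^sub>v (y :: complex vec)"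
proof -
  have "(A @\<^sub>c B) *\<^sub>v (x @\<^sub>v y) = (A *\<^sub>v x + B *\<^sub>v y) @\<^sub>v (0\<^sub>m 0 k *\<^sub>v x + 0\<^sub>m 0 n *\<^sub>v y)"
    unfolding append_cols_def using A B x y
    by (subst four_block_mat_mult_vec[of _ m k _ n _ 0]) auto
  also have "\<dots> = A *\<^sub>v x + B *\<^sub>v y" using A B by (intro eq_vecI) auto
  finally show ?thesis .
qed

lemma carrier_vec_appendE:
  assumes "z \<in> carrier_vec (m + n)"
  obtains x y where "z = x @\<^sub>v y" "x \<in> carrier_vec m" "y \<in> carrier_vec n"
  using that[of "vec_first z m" "vec_last z n"] vec_first_last_append[OF assms] by simp

lemma mran_append_cols:
  assumes A: "A \<in> carrier_mat m k" and B: "B \<in> carrier_mat m n"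
  shows "mran (A @\<^sub>c B) = vsum (mran A) (mran B)"
proof (intro equalityI subsetI)
  fix z assume "z \<in> mran (A @\<^sub>c B)"
  then obtain w where w: "w \<in> carrier_vec (k + n)" "z = (A @\<^sub>c B) *\<^sub>v w"
    using mran_iff[OF append_cols_carrier[OF A B]] by auto
  obtain x y where "w = x @\<^sub>v y" "x \<in> carrier_vec k" "y \<in> carrier_vec n" by (rule carrier_vec_appendE[OF w(1)])
  thus "z \<in> vsum (mran A) (mran B)" unfolding w(2)
    using append_cols_mult[OF A B] mran_iff[OF A] mran_iff[OF B] by (auto intro!: vsumI)
next
  fix z assume "z \<in> vsum (mran A) (mran B)"
  then obtain x y where "z = A *\<^sub>v x + B *\<^sub>v y" "x \<in> carrier_vec k" "y \<in> carrier_vec n"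
    by (auto elim!: vsumE simp: mran_iff[OF A] mran_iff[OF B])
  hence "z = (A @\<^sub>c B) *\<^sub>v (x @\<^sub>v y)" "x @\<^sub>v y \<in> carrier_vec (k + n)" using append_cols_mult[OF A B] by auto
  thus "z \<in> mran (A @\<^sub>c B)" using mran_iff[OF append_cols_carrier[OF A B]] by blast
qed

lemma mker_adjoint_append_cols:
  assumes A: "A \<in> carrier_mat m k" and B: "B \<in> carrier_mat m n"
  shows "mker (mat_adjoint (A @\<^sub>c B)) = mker (mat_adjoint A) \<inter> mker (mat_adjoint B)"
proof (intro equalityI subsetI)
  fix x assume "x \<in> mker (mat_adjoint (A @\<^sub>c B))"
  hence x: "x \<in> carrier_vec m" "\<And>z. z \<in> carrier_vec (k + n) \<Longrightarrow> ((A @\<^sub>c B) *\<^sub>v z) \<bullet>c x = 0"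
    using mker_adjoint_iff[OF append_cols_carrier[OF A B]] by auto
  have "(A *\<^sub>v y) \<bullet>c x = 0" if y: "y \<in> carrier_vec k" for y
    using x(2)[of "y @\<^sub>v 0\<^sub>v n"] append_cols_mult[OF A B y, of "0\<^sub>v n"] y A B by simp
  moreover have "(B *\<^sub>v y) \<bullet>c x = 0" if y: "y \<in> carrier_vec n" for y
    using x(2)[of "0\<^sub>v k @\<^sub>v y"] append_cols_mult[OF A B _ y, of "0\<^sub>v k"] y A B by simp
  ultimately show "x \<in> mker (mat_adjoint A) \<inter> mker (mat_adjoint B)"
    using x(1) by (simp add: mker_adjoint_iff[OF A] mker_adjoint_iff[OF B])
next
  fix x assume "x \<in> mker (mat_adjoint A) \<inter> mker (mat_adjoint B)"
  hence x: "x \<in> carrier_vec m" "\<And>y. y \<in> carrier_vec k \<Longrightarrow> (A *\<^sub>v y) \<bullet>c x = 0"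
     "\<And>y. y \<in> carrier_vec n \<Longrightarrow> (B *\<^sub>v y) \<bullet>c x = 0"
    by (auto simp: mker_adjoint_iff[OF A] mker_adjoint_iff[OF B])
  have "((A @\<^sub>c B) *\<^sub>v z) \<bullet>c x = 0" if z: "z \<in> carrier_vec (k + n)" for z
  proof -
    obtain u v where "z = u @\<^sub>v v" "u \<in> carrier_vec k" "v \<in> carrier_vec n" by (rule carrier_vec_appendE[OF z])
    thus ?thesis using x append_cols_mult[OF A B] A B by (simp add: cip_add_left[of _ m])
  qed
  thus "x \<in> mker (mat_adjoint (A @\<^sub>c B))" using x(1) mker_adjoint_iff[OF append_cols_carrier[OF A B]] by simp
qed

lemma rank_append_cols:
  assumes A: "A \<in> carrier_mat m k" and B: "B \<in> carrier_mat m n"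
  shows "mat_rank (A @\<^sub>c B) + vdim m (mker (mat_adjoint A) \<inter> mker (mat_adjoint B)) = m"
  using rank_mker_adjoint[OF append_cols_carrier[OF A B]] mker_adjoint_append_cols[OF A B] by simp

text \<open>The range of the appended matrix is the sum of the two ranges.\<close>
lemma rank_append_cols_sum:
  assumes A: "A \<in> carrier_mat m k" and B: "B \<in> carrier_mat m n"
  shows "mat_rank (A @\<^sub>c B) + vdim m (mran A \<inter> mran B) = mat_rank A + mat_rank B"
proof -
  have "mat_rank (A @\<^sub>c B) = vdim m (vsum (mran A) (mran B))"
    using append_cols_carrier[OF A B] unfolding mat_rank_eq mran_append_cols[OF A B] by simp
  thus ?thesis using vdim_vsum[OF lin_sub_mran[OF A] lin_sub_mran[OF B]] A B
    by (simp add: rank_eq_vdim[OF A] rank_eq_vdim[OF B])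
qed

section \<open>The form-orthogonal complement of a kernel\<close>

text \<open>The vectors \<open>x\<close> with \<open>Q x\<close> in the range of \<open>B\<close> are those that are orthogonal, with respect to the
form of \<open>Q\<close>, to the kernel of \<open>B*\<close>.\<close>
definition form_perp :: "complex mat \<Rightarrow> complex mat \<Rightarrow> complex vec set" where
  "form_perp Q B = {x \<in> carrier_vec (dim_col Q). Q *\<^sub>v x \<in> mran B}"

lemma lin_sub_form_perp:
  assumes Q: "Q \<in> carrier_mat m m" and B: "B \<in> carrier_mat m n"
  shows "lin_sub m (form_perp Q B)"
  using lin_subD[OF lin_sub_mran[OF B]] Q
  by (intro lin_subI) (auto simp: form_perp_def mult_add_distrib_mat_vec mult_mat_vec)

text \<open>\<open>Q\<close> maps this subspace onto the intersection of the ranges of \<open>Q\<close> and \<open>B\<close>, with kernel that of \<open>Q\<close>.\<close>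
lemma vdim_form_perp:
  assumes Q: "Q \<in> herm_mats m" and B: "B \<in> carrier_mat m n"
  shows "vdim m (form_perp Q B) = mat_rank B + vdim m (mker Q \<inter> mker (mat_adjoint B))"
proof -
  note Qc = hermD(1)[OF Q]
  have L: "lin_sub m (form_perp Q B)" by (rule lin_sub_form_perp[OF Qc B])
  have l: "lin_on (form_perp Q B) m (\<lambda>x. Q *\<^sub>v x)" by (rule lin_on_mat[OF Qc lin_subD(1)[OF L]])
  have im: "(\<lambda>x. Q *\<^sub>v x) ` form_perp Q B = mran Q \<inter> mran B"
    using Qc by (auto simp: form_perp_def mran_def)
  have ker: "{x \<in> form_perp Q B. Q *\<^sub>v x = 0\<^sub>v m} = mker Q"
    using Qc lin_subD(2)[OF lin_sub_mran[OF B]] by (auto simp: form_perp_def mker_def)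
  have "vdim m (mran Q \<inter> mran B) + vdim m (mker Q) = vdim m (form_perp Q B)"
    using rank_nullity[OF l L] im ker by simp
  thus ?thesis
    using rank_append_cols_sum[OF Qc B] rank_append_cols[OF Qc B] rank_mker[OF Qc] hermD(2)[OF Q] by simp
qed

lemma qf_vsum_form_perp:
  assumes Q: "Q \<in> herm_mats m" and B: "B \<in> carrier_mat m n" and G: "G \<subseteq> mker (mat_adjoint B)"
    and z: "z \<in> vsum (form_perp Q B) G"
  obtains x y where "x \<in> form_perp Q B" "y \<in> G" "z = x + y" "qf Q z = qf Q x + qf Q y"
proof -
  obtain x y where h: "z = x + y" "x \<in> form_perp Q B" "y \<in> G" by (rule vsumE[OF z])
  note Qc = hermD(1)[OF Q]
  have xc: "x \<in> carrier_vec m" using h Qc by (simp add: form_perp_def)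
  have yk: "y \<in> mker (mat_adjoint B)" using h G by auto
  hence yc: "y \<in> carrier_vec m" using mker_adjoint_iff[OF B] by simp
  obtain a where "a \<in> carrier_vec n" "Q *\<^sub>v x = B *\<^sub>v a" using h(2) mran_iff[OF B] by (auto simp: form_perp_def)
  hence "(Q *\<^sub>v x) \<bullet>c y = 0" using yk mker_adjoint_iff[OF B] by simp
  hence "qf Q z = qf Q x + qf Q y" unfolding h(1) qf_add[OF Q xc yc] by simp
  thus ?thesis using that h by blast
qed

section \<open>Inertia of bordered matrices\<close>

lemma cip_append:
  fixes a b c d :: "complex vec"
  assumes "a \<in> carrier_vec m" "b \<in> carrier_vec n" "c \<in> carrier_vec m" "d \<in> carrier_vec n"
  shows "(a @\<^sub>v b) \<bullet>c (c @\<^sub>v d) = a \<bullet>c c + b \<bullet>c d"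
proof -
  have "conjugate (c @\<^sub>v d) = conjugate c @\<^sub>v conjugate d" by (intro eq_vecI) auto
  thus ?thesis using assms by (simp add: scalar_prod_append[of _ m _ n])
qed

text \<open>\<open>H\<close> is the block matrix with rows \<open>(A, B)\<close> and \<open>(B*, 0)\<close>. It is described through its action on stacked
vectors so that block matrices bracketed in different ways fit the same description.\<close>
definition bordered :: "nat \<Rightarrow> nat \<Rightarrow> complex mat \<Rightarrow> complex mat \<Rightarrow> complex mat \<Rightarrow> bool" where
  "bordered m n A B H \<longleftrightarrow> A \<in> herm_mats m \<and> B \<in> carrier_mat m n \<and> H \<in> carrier_mat (m + n) (m + n) \<and>
     (\<forall>v\<in>carrier_vec m. \<forall>u\<in>carrier_vec n. H *\<^sub>v (v @\<^sub>v u) = (A *\<^sub>v v + B *\<^sub>v u) @\<^sub>v (mat_adjoint B *\<^sub>v v))"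

lemma borderedD:
  assumes "bordered m n A B H"
  shows "A \<in> herm_mats m" "A \<in> carrier_mat m m" "B \<in> carrier_mat m n" "H \<in> carrier_mat (m + n) (m + n)"
    "\<And>v u. v \<in> carrier_vec m \<Longrightarrow> u \<in> carrier_vec n \<Longrightarrow>
       H *\<^sub>v (v @\<^sub>v u) = (A *\<^sub>v v + B *\<^sub>v u) @\<^sub>v (mat_adjoint B *\<^sub>v v)"
  using assms hermD(1)[of A m] by (auto simp: bordered_def)

lemma bordered_herm:
  assumes H: "bordered m n A B H"
  shows "H \<in> herm_mats (m + n)"
proof (rule hermI)
  note D = borderedD[OF H]
  show "H \<in> carrier_mat (m + n) (m + n)" by (rule D)
  fix x y :: "complex vec" assume x: "x \<in> carrier_vec (m + n)" and y: "y \<in> carrier_vec (m + n)"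
  obtain v u where x': "x = v @\<^sub>v u" "v \<in> carrier_vec m" "u \<in> carrier_vec n" by (rule carrier_vec_appendE[OF x])
  obtain v' u' where y': "y = v' @\<^sub>v u'" "v' \<in> carrier_vec m" "u' \<in> carrier_vec n" by (rule carrier_vec_appendE[OF y])
  have B': "mat_adjoint B \<in> carrier_mat n m" using D by simp
  have "(mat_adjoint B *\<^sub>v v) \<bullet>c u' = v \<bullet>c (B *\<^sub>v u')"
    using cip_adjoint[OF B' x'(2) y'(3)] by simp
  moreover have "(B *\<^sub>v u) \<bullet>c v' = u \<bullet>c (mat_adjoint B *\<^sub>v v')" by (rule cip_adjoint[OF D(3) x'(3) y'(2)])
  ultimately show "(H *\<^sub>v x) \<bullet>c y = x \<bullet>c (H *\<^sub>v y)"
    unfolding x'(1) y'(1) D(5)[OF x'(2,3)] D(5)[OF y'(2,3)]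
    using D x' y' herm_cip[OF D(1) x'(2) y'(2)]
    by (simp add: cip_append[of _ m _ n] cip_add_left[of _ m] cip_add_right[of _ m])
qed

lemma bordered_qf:
  assumes H: "bordered m n A B H" and v: "v \<in> carrier_vec m" and u: "u \<in> carrier_vec n"
  shows "qf H (v @\<^sub>v u) = qf A v + 2 * Re ((B *\<^sub>v u) \<bullet>c v)"
proof -
  note D = borderedD[OF H]
  have "(B *\<^sub>v u) \<bullet>c v = u \<bullet>c (mat_adjoint B *\<^sub>v v)" by (rule cip_adjoint[OF D(3) u v])
  also have "\<dots> = cnj ((mat_adjoint B *\<^sub>v v) \<bullet>c u)"
    using cip_sym[of "mat_adjoint B *\<^sub>v v" n u] D(3) u by simp
  finally have "Re ((mat_adjoint B *\<^sub>v v) \<bullet>c u) = Re ((B *\<^sub>v u) \<bullet>c v)" by simp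
  thus ?thesis unfolding qf_def D(5)[OF v u] using D u v
    by (simp add: cip_append[of _ m _ n] cip_add_left[of _ m])
qed

lemma bordered_qf_ker:
  assumes H: "bordered m n A B H" and v: "v \<in> mker (mat_adjoint B)" and u: "u \<in> carrier_vec n"
  shows "qf H (v @\<^sub>v u) = qf A v"
  using bordered_qf[OF H _ u] v mker_adjoint_iff[OF borderedD(3)[OF H]] u by auto

lemma bordered_mker:
  assumes H: "bordered m n A B H" and v: "v \<in> carrier_vec m" and u: "u \<in> carrier_vec n"
  shows "v @\<^sub>v u \<in> mker H \<longleftrightarrow> A *\<^sub>v v + B *\<^sub>v u = 0\<^sub>v m \<and> mat_adjoint B *\<^sub>v v = 0\<^sub>v n"
proof -
  note D = borderedD[OF H]
  have "(A *\<^sub>v v + B *\<^sub>v u) @\<^sub>v (mat_adjoint B *\<^sub>v v) = 0\<^sub>v m @\<^sub>v 0\<^sub>v n \<longleftrightarrow>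
     A *\<^sub>v v + B *\<^sub>v u = 0\<^sub>v m \<and> mat_adjoint B *\<^sub>v v = 0\<^sub>v n"
    by (rule append_vec_eq[of _ m]) (use D in auto)
  thus ?thesis unfolding mker_iff[OF D(4)] D(5)[OF v u] zero_append_vec using v u by simp
qed

lemma vdim_first_le:
  assumes D: "lin_sub (m + n) D" and Y: "lin_sub n Y" and k: "\<And>u. u \<in> carrier_vec n \<Longrightarrow> 0\<^sub>v m @\<^sub>v u \<in> D \<Longrightarrow> u \<in> Y"
  shows "vdim (m + n) D \<le> vdim m ((\<lambda>z. vec_first z m) ` D) + vdim n Y"
proof -
  have l: "lin_on D m (\<lambda>x. vec_first x m)" by (rule lin_on_vec_first[OF lin_subD(1)[OF D]])
  have "{z \<in> D. vec_first z m = 0\<^sub>v m} \<subseteq> vprod {0\<^sub>v m} Y"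
  proof
    fix z assume z: "z \<in> {z \<in> D. vec_first z m = 0\<^sub>v m}"
    hence "z \<in> carrier_vec (m + n)" using lin_subD(1)[OF D] by auto
    then obtain x y where h: "z = x @\<^sub>v y" "x \<in> carrier_vec m" "y \<in> carrier_vec n" by (rule carrier_vec_appendE)
    hence "x = 0\<^sub>v m" using z by (simp add: vec_first_append)
    thus "z \<in> vprod {0\<^sub>v m} Y" using h z k by (auto intro!: vprodI)
  qed
  hence "vdim (m + n) {z \<in> D. vec_first z m = 0\<^sub>v m} \<le> vdim (m + n) (vprod {0\<^sub>v m} Y)"
    by (rule vdim_mono[OF lin_sub_ker[OF l D] lin_sub_vprod[OF lin_sub_zero Y]])
  thus ?thesis using rank_nullity[OF l D] vdim_vprod[OF lin_sub_zero Y, of m] vdim_zero[of m] by simp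
qed

text \<open>For \<open>v\<close> in the kernel of \<open>B*\<close> the form of \<open>H\<close> at \<open>(v, u)\<close> is that of \<open>A\<close> at \<open>v\<close>, for every \<open>u\<close>. So
\<open>N\<close> times the whole of the second factor is nonnegative for \<open>H\<close>, and it meets the kernel of \<open>H\<close> at most in vectors
\<open>(v, u)\<close> with \<open>v\<close> in \<open>Z\<close>, with \<open>u\<close> in the kernel of \<open>B\<close> when \<open>v = 0\<close>.\<close>
lemma bordered_upper:
  assumes H: "bordered m n A B H" and N: "lin_sub m N" "N \<subseteq> mker (mat_adjoint B)"
    and nn: "\<And>x. x \<in> N \<Longrightarrow> 0 \<le> qf A x"
    and Z: "lin_sub m Z" "\<And>x. x \<in> N \<Longrightarrow> qf A x = 0 \<Longrightarrow> x \<in> Z"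
  shows "vdim m N + mat_rank B \<le> pos_inertia H + vdim m Z"
proof -
  note D = borderedD[OF H]
  let ?X = "vprod N (carrier_vec n)"
  have X: "lin_sub (m + n) ?X" by (rule lin_sub_vprod[OF N(1) lin_sub_carrier])
  have Hh: "H \<in> herm_mats (m + n)" by (rule bordered_herm[OF H])
  have q: "qf H (v @\<^sub>v u) = qf A v" if "v \<in> N" "u \<in> carrier_vec n" for v u
    using bordered_qf_ker[OF H _ that(2)] that N(2) by auto
  have "0 \<le> qf H z" if "z \<in> ?X" for z using that q nn by (auto elim!: vprodE)
  hence 1: "vdim (m + n) ?X \<le> pos_inertia H + vdim (m + n) (?X \<inter> mker H)" by (rule nonneg_dim_le[OF Hh X])
  have K: "lin_sub (m + n) (?X \<inter> mker H)" by (rule lin_sub_Int[OF X lin_sub_mker[OF D(4)]])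
  have "vdim (m + n) (?X \<inter> mker H) \<le> vdim m ((\<lambda>z. vec_first z m) ` (?X \<inter> mker H)) + vdim n (mker B)"
  proof (rule vdim_first_le[OF K lin_sub_mker[OF D(3)]])
    fix u assume u: "u \<in> carrier_vec n" "0\<^sub>v m @\<^sub>v u \<in> ?X \<inter> mker H"
    hence "A *\<^sub>v 0\<^sub>v m + B *\<^sub>v u = 0\<^sub>v m" using bordered_mker[OF H _ u(1), of "0\<^sub>v m"] by auto
    thus "u \<in> mker B" using D u mker_iff[OF D(3)] by simp
  qed
  also have "vdim m ((\<lambda>z. vec_first z m) ` (?X \<inter> mker H)) \<le> vdim m Z"
  proof (rule vdim_mono[OF lin_sub_image[OF lin_on_vec_first[OF lin_subD(1)[OF K]] K] Z(1)])
    show "(\<lambda>z. vec_first z m) ` (?X \<inter> mker H) \<subseteq> Z"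
    proof
      fix x assume "x \<in> (\<lambda>z. vec_first z m) ` (?X \<inter> mker H)"
      then obtain z where z: "z \<in> ?X" "z \<in> mker H" "x = vec_first z m" by blast
      then obtain v u where vu: "z = v @\<^sub>v u" "v \<in> N" "u \<in> carrier_vec n" by (blast elim: vprodE)
      have "x = v" using z vu lin_subD(5)[OF N(1)] by (simp add: vec_first_append)
      thus "x \<in> Z" using Z(2)[OF vu(2)] q[OF vu(2,3)] mker_qf[OF D(4) z(2)] vu by simp
    qed
  qed
  finally have "vdim (m + n) (?X \<inter> mker H) \<le> vdim m Z + vdim n (mker B)" by simp
  thus ?thesis using 1 vdim_vprod[OF N(1) lin_sub_carrier, of n] vdim_carrier[of n] rank_mker[OF D(3)] by simp
qed

text \<open>In a maximal positive subspace for \<open>H\<close>, the vectors \<open>(v, u)\<close> with \<open>B* v = 0\<close> have codimension at most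
\<open>rank B\<close>, and projecting them to \<open>v\<close> preserves the form.\<close>
lemma bordered_lower:
  assumes H: "bordered m n A B H"
  obtains P where "lin_sub m P" "P \<subseteq> mker (mat_adjoint B)" "\<And>x. x \<in> P \<Longrightarrow> x \<noteq> 0\<^sub>v m \<Longrightarrow> 0 < qf A x"
    "pos_inertia H \<le> vdim m P + mat_rank B"
proof -
  note D = borderedD[OF H]
  have Hh: "H \<in> herm_mats (m + n)" by (rule bordered_herm[OF H])
  obtain P where P: "lin_sub (m + n) P" "vdim (m + n) P = pos_inertia H"
    "\<And>x. x \<in> P \<Longrightarrow> x \<noteq> 0\<^sub>v (m + n) \<Longrightarrow> 0 < qf H x" by (rule positive_subspace_exists[OF Hh]) blast
  have B': "mat_adjoint B \<in> carrier_mat n m" using D by simp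
  let ?f = "\<lambda>z. mat_adjoint B *\<^sub>v vec_first z m"
  have l1: "lin_on P m (\<lambda>z. vec_first z m)" by (rule lin_on_vec_first[OF lin_subD(1)[OF P(1)]])
  hence l: "lin_on P n ?f" unfolding lin_on_def
    by (simp add: mult_add_distrib_mat_vec[OF B'] mult_mat_vec[OF B'] mat_vec_carrier[OF B'])
  let ?K = "{z \<in> P. ?f z = 0\<^sub>v n}"
  have K: "lin_sub (m + n) ?K" by (rule lin_sub_ker[OF l P(1)])
  have "vdim n (?f ` P) \<le> vdim n (mran (mat_adjoint B))"
    by (rule vdim_mono[OF lin_sub_image[OF l P(1)] lin_sub_mran[OF B']])
       (use mran_iff[OF B'] vec_first_carrier in blast)
  also have "\<dots> = mat_rank B" using rank_adjoint[OF D(3)] B' by (simp add: rank_eq_vdim[OF B'])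
  finally have 1: "pos_inertia H \<le> vdim (m + n) ?K + mat_rank B" using rank_nullity[OF l P(1)] P(2) by simp
  have KE: "\<exists>v u. z = v @\<^sub>v u \<and> v \<in> mker (mat_adjoint B) \<and> v \<in> carrier_vec m \<and> u \<in> carrier_vec n \<and> vec_first z m = v \<and> qf H z = qf A v"
    if "z \<in> ?K" for z
  proof -
    have "z \<in> carrier_vec (m + n)" using that lin_subD(5)[OF K] by simp
    then obtain v u where h: "z = v @\<^sub>v u" "v \<in> carrier_vec m" "u \<in> carrier_vec n" by (rule carrier_vec_appendE)
    have "vec_first z m = v" using h by (simp add: vec_first_append)
    moreover have "v \<in> mker (mat_adjoint B)" using that calculation h mker_iff[OF B'] by auto
    moreover have "qf H z = qf A v" unfolding h(1) by (rule bordered_qf_ker[OF H calculation(2) h(3)])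
    ultimately show ?thesis using h by blast
  qed
  have lK: "lin_on ?K m (\<lambda>z. vec_first z m)" by (rule lin_on_vec_first[OF lin_subD(1)[OF K]])
  show ?thesis
  proof (rule that)
    show "lin_sub m ((\<lambda>z. vec_first z m) ` ?K)" by (rule lin_sub_image[OF lK K])
    have "vdim m ((\<lambda>z. vec_first z m) ` ?K) = vdim (m + n) ?K"
    proof (rule vdim_inj_image[OF lK K])
      fix z assume z: "z \<in> ?K" "vec_first z m = 0\<^sub>v m"
      from KE[OF z(1)] z(2) have "qf H z = qf A (0\<^sub>v m)" by metis
      hence "qf H z = 0" using qf_zero[OF D(2)] by simp
      thus "z = 0\<^sub>v (m + n)" using P(3)[of z] z(1) by force
    qed
    thus "pos_inertia H \<le> vdim m ((\<lambda>z. vec_first z m) ` ?K) + mat_rank B" using 1 by simp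
    show "(\<lambda>z. vec_first z m) ` ?K \<subseteq> mker (mat_adjoint B)" using KE by force
    fix x assume "x \<in> (\<lambda>z. vec_first z m) ` ?K" "x \<noteq> 0\<^sub>v m"
    then obtain z where z: "z \<in> ?K" "x = vec_first z m" "x \<noteq> 0\<^sub>v m" by blast
    from KE[OF z(1)] z(2) obtain u where u: "z = x @\<^sub>v u" "qf H z = qf A x" "x \<in> carrier_vec m" "u \<in> carrier_vec n" by metis
    have "z \<noteq> 0\<^sub>v (m + n)" using u z(3) append_vec_eq[of x m "0\<^sub>v m" u "0\<^sub>v n"] by (auto simp: zero_append_vec)
    thus "0 < qf A x" using P(3)[of z] z(1) u by simp
  qed
qed

text \<open>The same projection applied to a maximal nonpositive subspace of \<open>H\<close>. Vectors \<open>(0, u)\<close> in it have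
form value zero, hence lie in the kernel of \<open>H\<close>, so the projection loses at most the kernel of \<open>B\<close>.\<close>
lemma bordered_nonpos:
  assumes H: "bordered m n A B H"
  obtains G where "lin_sub m G" "G \<subseteq> mker (mat_adjoint B)" "\<And>x. x \<in> G \<Longrightarrow> qf A x \<le> 0"
    "m \<le> vdim m G + pos_inertia H"
proof -
  note D = borderedD[OF H]
  have Hh: "H \<in> herm_mats (m + n)" by (rule bordered_herm[OF H])
  obtain N where N: "lin_sub (m + n) N" "vdim (m + n) N + pos_inertia H = m + n"
    "\<And>x. x \<in> N \<Longrightarrow> qf H x \<le> 0" "\<And>x. x \<in> N \<Longrightarrow> 0 \<le> qf H x \<Longrightarrow> x \<in> mker H"
    by (rule nonpositive_subspace_exists[OF Hh]) blast
  have B': "mat_adjoint B \<in> carrier_mat n m" using D by simp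
  let ?U = "mker (mat_adjoint B)"
  have U: "lin_sub m ?U" by (rule lin_sub_mker[OF B'])
  let ?X = "vprod ?U (carrier_vec n) \<inter> N"
  have X: "lin_sub (m + n) ?X" by (rule lin_sub_Int[OF lin_sub_vprod[OF U lin_sub_carrier] N(1)])
  have q: "qf H (v @\<^sub>v u) = qf A v" if "v \<in> ?U" "u \<in> carrier_vec n" for v u
    using bordered_qf_ker[OF H that] .
  have XE: "\<exists>v u. z = v @\<^sub>v u \<and> v \<in> ?U \<and> vec_first z m = v \<and> qf H z = qf A v" if "z \<in> ?X" for z
    using that q vec_first_append lin_subD(5)[OF U] by (blast elim!: vprodE)
  have lX: "lin_on ?X m (\<lambda>z. vec_first z m)" by (rule lin_on_vec_first[OF lin_subD(1)[OF X]])
  let ?G = "(\<lambda>z. vec_first z m) ` ?X"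
  show ?thesis
  proof (rule that)
    show "lin_sub m ?G" by (rule lin_sub_image[OF lX X])
    show "?G \<subseteq> ?U" using XE by force
    show "qf A x \<le> 0" if "x \<in> ?G" for x using that XE N(3) by force
    have "vdim (m + n) ?X \<le> vdim m ?G + vdim n (mker B)"
    proof (rule vdim_first_le[OF X lin_sub_mker[OF D(3)]])
      fix u assume u: "u \<in> carrier_vec n" "0\<^sub>v m @\<^sub>v u \<in> ?X"
      have "qf H (0\<^sub>v m @\<^sub>v u) = qf A (0\<^sub>v m)" using q[OF lin_subD(2)[OF U] u(1)] .
      hence "0\<^sub>v m @\<^sub>v u \<in> mker H" using qf_zero[OF D(2)] N(4) u(2) by simp
      hence "A *\<^sub>v 0\<^sub>v m + B *\<^sub>v u = 0\<^sub>v m" using bordered_mker[OF H _ u(1), of "0\<^sub>v m"] by auto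
      thus "u \<in> mker B" using D u mker_iff[OF D(3)] by simp
    qed
    moreover have "vdim (m + n) (vprod ?U (carrier_vec n)) + vdim (m + n) N \<le> (m + n) + vdim (m + n) ?X"
      by (rule vdim_Int_ge[OF lin_sub_vprod[OF U lin_sub_carrier] N(1)])
    ultimately show "m \<le> vdim m ?G + pos_inertia H"
      using N(2) vdim_vprod[OF U lin_sub_carrier, of n] vdim_carrier[of n] rank_mker[OF D(3)] rank_mker_adjoint[OF D(3)]
      by simp
  qed
qed

lemma cip_minus_left: "x \<in> carrier_vec n \<Longrightarrow> y \<in> carrier_vec n \<Longrightarrow> z \<in> carrier_vec n \<Longrightarrow>
    (x - y) \<bullet>c z = x \<bullet>c z - y \<bullet>c (z :: complex vec)"
  by (simp add: minus_scalar_prod_distrib[of _ n])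

section \<open>Rank-one matrices\<close>

definition outer :: "complex vec \<Rightarrow> complex vec \<Rightarrow> complex mat" where
  "outer y z = mat (dim_vec y) (dim_vec z) (\<lambda>(i, j). y $ i * cnj (z $ j))"

lemma outer_carrier [simp]: "y \<in> carrier_vec n \<Longrightarrow> z \<in> carrier_vec k \<Longrightarrow> outer y z \<in> carrier_mat n k"
  by (auto simp: outer_def)

lemma outer_mult:
  assumes "y \<in> carrier_vec n" "z \<in> carrier_vec k" "x \<in> carrier_vec k"
  shows "outer y z *\<^sub>v x = (x \<bullet>c z) \<cdot>\<^sub>v y"
proof (rule eq_vecI)
  fix i assume "i < dim_vec ((x \<bullet>c z) \<cdot>\<^sub>v y)"
  hence i: "i < n" using assms by simp
  have "(outer y z *\<^sub>v x) $ i = (\<Sum>j\<in>{0..<k}. y $ i * cnj (z $ j) * x $ j)"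
    using i assms by (simp add: outer_def scalar_prod_def)
  also have "\<dots> = (\<Sum>j\<in>{0..<k}. x $ j * cnj (z $ j)) * y $ i"
    unfolding sum_distrib_right by (intro sum.cong) (auto simp: mult_ac)
  finally show "(outer y z *\<^sub>v x) $ i = ((x \<bullet>c z) \<cdot>\<^sub>v y) $ i"
    using i assms by (simp add: scalar_prod_def)
qed (use assms in \<open>simp add: outer_def\<close>)

lemma outer_cip:
  assumes y: "y \<in> carrier_vec n" and z: "z \<in> carrier_vec n" and x: "x \<in> carrier_vec n" and w: "w \<in> carrier_vec n"
  shows "(outer y z *\<^sub>v x) \<bullet>c w = (x \<bullet>c z) * (y \<bullet>c w)"
  unfolding outer_mult[OF y z x] using y w by (rule cip_smult_left)

lemma herm_add:
  assumes X: "X \<in> herm_mats n" and Y: "Y \<in> herm_mats n"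
  shows "X + Y \<in> herm_mats n"
proof (rule hermI)
  note c = hermD(1)[OF X] hermD(1)[OF Y]
  fix x y :: "complex vec" assume xy: "x \<in> carrier_vec n" "y \<in> carrier_vec n"
  show "((X + Y) *\<^sub>v x) \<bullet>c y = x \<bullet>c ((X + Y) *\<^sub>v y)"
    unfolding add_mult_distrib_mat_vec[OF c xy(1)] add_mult_distrib_mat_vec[OF c xy(2)]
    using c xy herm_cip[OF X xy] herm_cip[OF Y xy]
    by (simp add: cip_add_left[of _ n] cip_add_right[of _ n])
qed (use hermD(1)[OF X] hermD(1)[OF Y] in simp)

lemma smult_mat_vec: "A \<in> carrier_mat nr nc \<Longrightarrow> v \<in> carrier_vec nc \<Longrightarrow>
    (c \<cdot>\<^sub>m A) *\<^sub>v v = c \<cdot>\<^sub>v (A *\<^sub>v (v :: complex vec))"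
  by (intro eq_vecI) (auto simp: scalar_prod_def sum_distrib_left mult.assoc)

lemma herm_smult:
  assumes X: "X \<in> herm_mats n"
  shows "complex_of_real t \<cdot>\<^sub>m X \<in> herm_mats n"
proof (rule hermI)
  note c = hermD(1)[OF X]
  fix x y :: "complex vec" assume xy: "x \<in> carrier_vec n" "y \<in> carrier_vec n"
  show "((complex_of_real t \<cdot>\<^sub>m X) *\<^sub>v x) \<bullet>c y = x \<bullet>c ((complex_of_real t \<cdot>\<^sub>m X) *\<^sub>v y)"
    unfolding smult_mat_vec[OF c xy(1)] smult_mat_vec[OF c xy(2)]
    using c xy herm_cip[OF X xy] by (simp add: cip_smult_left[of _ n] cip_smult_right[of _ n])
qed (use hermD(1)[OF X] in simp)

lemma herm_outer2:
  assumes y: "y \<in> carrier_vec n" and z: "z \<in> carrier_vec n"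
  shows "outer y z + outer z y \<in> herm_mats n"
proof (rule hermI)
  have c: "outer y z \<in> carrier_mat n n" "outer z y \<in> carrier_mat n n" using y z by auto
  fix x w :: "complex vec" assume xw: "x \<in> carrier_vec n" "w \<in> carrier_vec n"
  have "x \<bullet>c ((outer y z + outer z y) *\<^sub>v w) = cnj (((outer y z + outer z y) *\<^sub>v w) \<bullet>c x)"
    using c xw by (intro cip_sym[of _ n] mat_vec_carrier[of _ n n]) auto
  also have "\<dots> = cnj ((w \<bullet>c z) * (y \<bullet>c x) + (w \<bullet>c y) * (z \<bullet>c x))"
    unfolding add_mult_distrib_mat_vec[OF c xw(2)]
    using xw y z mat_vec_carrier[OF c(1)] mat_vec_carrier[OF c(2)]
    by (simp add: cip_add_left[of _ n] outer_cip[of _ n])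
  also have "\<dots> = (x \<bullet>c z) * (y \<bullet>c w) + (x \<bullet>c y) * (z \<bullet>c w)"
    using cip_sym[OF z xw(2)] cip_sym[OF y xw(2)] cip_sym[OF xw(1) z] cip_sym[OF xw(1) y]
    by (simp add: mult.commute)
  also have "\<dots> = ((outer y z + outer z y) *\<^sub>v x) \<bullet>c w"
    unfolding add_mult_distrib_mat_vec[OF c xw(1)]
    using xw y z mat_vec_carrier[OF c(1)] mat_vec_carrier[OF c(2)]
    by (simp add: cip_add_left[of _ n] outer_cip[of _ n])
  finally show "((outer y z + outer z y) *\<^sub>v x) \<bullet>c w = x \<bullet>c ((outer y z + outer z y) *\<^sub>v w)" by simp
qed (use y z in auto)

lemma herm_outer:
  assumes y: "y \<in> carrier_vec n"
  shows "outer y y \<in> herm_mats n"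
proof (rule hermI)
  fix x w :: "complex vec" assume xw: "x \<in> carrier_vec n" "w \<in> carrier_vec n"
  have "x \<bullet>c (outer y y *\<^sub>v w) = cnj ((outer y y *\<^sub>v w) \<bullet>c x)"
    using y xw by (intro cip_sym[of _ n] mat_vec_carrier[of _ _ n]) auto
  also have "\<dots> = (x \<bullet>c y) * (y \<bullet>c w)"
    using cip_sym[OF y xw(2)] cip_sym[OF xw(1) y] unfolding outer_cip[OF y y xw(2,1)] by (simp add: mult.commute)
  finally show "(outer y y *\<^sub>v x) \<bullet>c w = x \<bullet>c (outer y y *\<^sub>v w)" unfolding outer_cip[OF y y xw] by simp
qed (use y in simp)

lemma qf_outer:
  assumes y: "y \<in> carrier_vec n" and x: "x \<in> carrier_vec n"
  shows "qf (outer y y) x = (cmod (x \<bullet>c y))\<^sup>2"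
proof -
  have "(outer y y *\<^sub>v x) \<bullet>c x = (x \<bullet>c y) * cnj (x \<bullet>c y)"
    unfolding outer_cip[OF y y x x] cip_sym[OF x y] ..
  also have "\<dots> = complex_of_real ((cmod (x \<bullet>c y))\<^sup>2)" by (simp only: complex_norm_square)
  finally show ?thesis unfolding qf_def by (simp only: Re_complex_of_real)
qed

lemma qf_smult_mat:
  assumes X: "X \<in> carrier_mat n n" and x: "x \<in> carrier_vec n"
  shows "qf (complex_of_real t \<cdot>\<^sub>m X) x = t * qf X x"
  unfolding qf_def smult_mat_vec[OF X x] using X x by (subst cip_smult_left[of _ n]) auto

lemma qf_add_mat:
  assumes X: "X \<in> carrier_mat n n" and Y: "Y \<in> carrier_mat n n" and x: "x \<in> carrier_vec n"
  shows "qf (X + Y) x = qf X x + qf Y x"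
  unfolding qf_def add_mult_distrib_mat_vec[OF X Y x] using X Y x by (subst cip_add_left[of _ n]) auto

section \<open>Finsler's lemma\<close>

text \<open>If \<open>S\<close> is positive on \<open>E\<close>, the part of \<open>D\<close> orthogonal to \<open>r\<close>, then some nonzero \<open>x0\<close> in \<open>D\<close> is
\<open>S\<close>-orthogonal to \<open>E\<close>, and \<open>x0\<close> is not orthogonal to \<open>r\<close>. The form splits along \<open>E\<close> and \<open>x0\<close>, and a large multiple of
\<open>r r*\<close> makes it positive at \<open>x0\<close>.\<close>
lemma finsler_rank_one:
  assumes S: "S \<in> herm_mats m" and D: "lin_sub m D" and r: "r \<in> carrier_vec m"
    and pos: "\<And>x. x \<in> D \<Longrightarrow> x \<bullet>c r = 0 \<Longrightarrow> x \<noteq> 0\<^sub>v m \<Longrightarrow> 0 < qf S x"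
  obtains t where "0 \<le> t" "\<And>x. x \<in> D \<Longrightarrow> x \<noteq> 0\<^sub>v m \<Longrightarrow> 0 < qf S x + t * (cmod (x \<bullet>c r))\<^sup>2"
proof (cases "\<forall>x\<in>D. x \<bullet>c r = 0")
  case True
  thus ?thesis using pos by (intro that[of 0]) auto
next
  case False
  note Sc = hermD(1)[OF S]
  note Dc = lin_subD(5)[OF D]
  define E where "E = {x \<in> D. x \<bullet>c r = 0}"
  have E: "lin_sub m E" unfolding E_def
    using lin_subD[OF D] r by (intro lin_subI) (auto simp: cip_add_left[of _ m] cip_smult_left[of _ m])
  have ED: "E \<subseteq> D" "E \<noteq> D" using False by (auto simp: E_def)
  have "vdim m E < vdim m D" using vdim_eq_imp_eq[OF E D ED(1)] ED(2) by (meson linorder_not_le)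
  obtain J where J: "J \<in> carrier_mat m (vdim m E)" "mran J = E" by (rule basis_matrix[OF E])
  let ?k = "vdim m E"
  have J': "mat_adjoint J \<in> carrier_mat ?k m" using J by simp
  let ?f = "\<lambda>x. mat_adjoint J *\<^sub>v (S *\<^sub>v x)"
  have l: "lin_on D ?k ?f" unfolding lin_on_def
    using Dc mat_vec_carrier[OF Sc] mat_vec_carrier[OF J']
    by (simp add: mult_add_distrib_mat_vec[OF Sc] mult_add_distrib_mat_vec[OF J'] mult_mat_vec[OF Sc] mult_mat_vec[OF J'])
  have "vdim ?k (?f ` D) \<le> ?k" by (rule vdim_le[OF lin_sub_image[OF l D]])
  hence "0 < vdim m {x \<in> D. ?f x = 0\<^sub>v ?k}" using rank_nullity[OF l D] \<open>vdim m E < vdim m D\<close> by simp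
  hence "{x \<in> D. ?f x = 0\<^sub>v ?k} \<noteq> {0\<^sub>v m}" using vdim_zero[of m] by force
  then obtain x0 where x0: "x0 \<in> D" "?f x0 = 0\<^sub>v ?k" "x0 \<noteq> 0\<^sub>v m"
    using lin_subD(2)[OF lin_sub_ker[OF l D]] by blast
  have x0c: "x0 \<in> carrier_vec m" using x0 Dc by simp
  have orth: "(S *\<^sub>v x) \<bullet>c x0 = 0" if xE: "x \<in> E" for x
  proof -
    obtain a where a: "a \<in> carrier_vec ?k" "x = J *\<^sub>v a"
      using xE mran_iff[OF J(1), of x] unfolding J(2) by blast
    have xc: "x \<in> carrier_vec m" using a J by simp
    have "(S *\<^sub>v x) \<bullet>c x0 = x \<bullet>c (S *\<^sub>v x0)" by (rule herm_cip[OF S xc x0c])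
    also have "\<dots> = a \<bullet>c ?f x0" unfolding a(2) using Sc by (intro cip_adjoint[OF J(1) a(1)]) simp
    finally show ?thesis unfolding x0(2) using a(1) by simp
  qed
  define s where "s = x0 \<bullet>c r"
  have s: "s \<noteq> 0"
  proof
    assume "s = 0"
    hence "x0 \<in> E" using x0 by (simp add: E_def s_def)
    hence "qf S x0 = 0" using orth by (simp add: qf_def)
    thus False using pos[OF x0(1)] \<open>s = 0\<close> x0(3) by (simp add: s_def)
  qed
  define t where "t = (\<bar>qf S x0\<bar> + 1) / (cmod s)\<^sup>2"
  have ts: "t * (cmod s)\<^sup>2 = \<bar>qf S x0\<bar> + 1" unfolding t_def using s by simp
  show ?thesis
  proof (rule that)
    show "0 \<le> t" unfolding t_def by simp
    fix x assume x: "x \<in> D" "x \<noteq> 0\<^sub>v m"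
    have xc: "x \<in> carrier_vec m" using x Dc by simp
    define \<alpha> where "\<alpha> = (x \<bullet>c r) / s"
    define y where "y = x + (- \<alpha>) \<cdot>\<^sub>v x0"
    have yD: "y \<in> D" unfolding y_def using lin_subD(3,4)[OF D] x x0 by simp
    have yc: "y \<in> carrier_vec m" using yD Dc by simp
    have "y \<bullet>c r = x \<bullet>c r + (- \<alpha>) * s"
      unfolding y_def s_def using xc x0c r by (simp add: cip_add_left[of _ m] cip_smult_left[of _ m])
    hence yr: "y \<bullet>c r = 0" unfolding \<alpha>_def using s by simp
    hence yE: "y \<in> E" using yD by (simp add: E_def)
    have xy: "x = y + \<alpha> \<cdot>\<^sub>v x0" unfolding y_def using xc x0c by (intro eq_vecI) auto
    have "(S *\<^sub>v y) \<bullet>c (\<alpha> \<cdot>\<^sub>v x0) = 0"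
      using orth[OF yE] cip_smult_right[of "S *\<^sub>v y" m x0 \<alpha>] Sc x0c by simp
    hence q: "qf S x = qf S y + (cmod \<alpha>)\<^sup>2 * qf S x0"
      using qf_add[OF S yc, of "\<alpha> \<cdot>\<^sub>v x0"] qf_smult[OF Sc x0c] x0c by (simp add: xy)
    have "x \<bullet>c r = \<alpha> * s" unfolding \<alpha>_def using s by simp
    hence "t * (cmod (x \<bullet>c r))\<^sup>2 = (cmod \<alpha>)\<^sup>2 * (t * (cmod s)\<^sup>2)"
      by (simp add: norm_mult power_mult_distrib)
    hence e: "qf S x + t * (cmod (x \<bullet>c r))\<^sup>2 = qf S y + (cmod \<alpha>)\<^sup>2 * (qf S x0 + \<bar>qf S x0\<bar> + 1)"
      unfolding q ts by (simp add: algebra_simps)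
    have g: "1 \<le> qf S x0 + \<bar>qf S x0\<bar> + 1" by simp
    show "0 < qf S x + t * (cmod (x \<bullet>c r))\<^sup>2"
    proof (cases "y = 0\<^sub>v m")
      case True
      hence "\<alpha> \<noteq> 0" using x(2) xy x0c by auto
      hence "0 < (cmod \<alpha>)\<^sup>2 * (qf S x0 + \<bar>qf S x0\<bar> + 1)" using g by (intro mult_pos_pos) auto
      thus ?thesis unfolding e True using qf_zero[OF Sc] by simp
    next
      case False
      have "0 < qf S y" by (rule pos[OF yD yr False])
      moreover have "0 \<le> (cmod \<alpha>)\<^sup>2 * (qf S x0 + \<bar>qf S x0\<bar> + 1)" using g by (intro mult_nonneg_nonneg) auto
      ultimately show ?thesis unfolding e by (rule add_pos_nonneg)
    qed
  qed
qed

text \<open>The vectors \<open>r i\<close> are absorbed into the form one at a time, the last one first, on the subspace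
orthogonal to all the others. This avoids a compactness argument.\<close>
lemma finsler_list:
  fixes k :: nat
  assumes S: "S \<in> herm_mats m" and D: "lin_sub m D" and r: "\<And>i. i < k \<Longrightarrow> r i \<in> carrier_vec m"
    and pos: "\<And>x. x \<in> D \<Longrightarrow> (\<And>i. i < k \<Longrightarrow> x \<bullet>c r i = 0) \<Longrightarrow> x \<noteq> 0\<^sub>v m \<Longrightarrow> 0 < qf S x"
  shows "\<exists>t\<ge>0. \<forall>x\<in>D. x \<noteq> 0\<^sub>v m \<longrightarrow> 0 < qf S x + t * (\<Sum>i<k. (cmod (x \<bullet>c r i))\<^sup>2)"
  using S r pos
proof (induction k arbitrary: S)
  case 0
  show ?case using 0(3) by (intro exI[of _ 0]) auto
next
  case (Suc k)
  note Sc = hermD(1)[OF Suc.prems(1)]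
  define E where "E = {x \<in> D. \<forall>i<k. x \<bullet>c r i = 0}"
  have rc: "r i \<in> carrier_vec m" if "i \<le> k" for i using Suc.prems(2)[of i] that by simp
  have E: "lin_sub m E" unfolding E_def
    using lin_subD[OF D] rc by (intro lin_subI) (auto simp: cip_add_left[of _ m] cip_smult_left[of _ m])
  obtain t where t: "0 \<le> t" "\<And>x. x \<in> E \<Longrightarrow> x \<noteq> 0\<^sub>v m \<Longrightarrow> 0 < qf S x + t * (cmod (x \<bullet>c r k))\<^sup>2"
  proof (rule finsler_rank_one[OF Suc.prems(1) E rc[OF order_refl]])
    fix x assume x: "x \<in> E" "x \<bullet>c r k = 0" "x \<noteq> 0\<^sub>v m"
    show "0 < qf S x" by (rule Suc.prems(3)) (use x in \<open>auto simp: E_def less_Suc_eq\<close>)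
  qed blast
  define S' where "S' = S + complex_of_real t \<cdot>\<^sub>m outer (r k) (r k)"
  have S': "S' \<in> herm_mats m" unfolding S'_def
    by (intro herm_add herm_smult herm_outer Suc.prems(1) rc) simp
  have q: "qf S' x = qf S x + t * (cmod (x \<bullet>c r k))\<^sup>2" if "x \<in> carrier_vec m" for x
    unfolding S'_def using rc[OF order_refl] Sc that
    by (simp add: qf_add_mat[of _ m] qf_smult_mat[of _ m] qf_outer[of _ m])
  have "\<exists>u\<ge>0. \<forall>x\<in>D. x \<noteq> 0\<^sub>v m \<longrightarrow> 0 < qf S' x + u * (\<Sum>i<k. (cmod (x \<bullet>c r i))\<^sup>2)"
  proof (rule Suc.IH[OF S'])
    fix x assume x: "x \<in> D" "\<And>i. i < k \<Longrightarrow> x \<bullet>c r i = 0" "x \<noteq> 0\<^sub>v m"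
    hence "x \<in> E" by (simp add: E_def)
    thus "0 < qf S' x" using t(2)[OF _ x(3)] q lin_subD(5)[OF D x(1)] by simp
  qed (use rc in simp)
  then obtain u where u: "0 \<le> u" "\<And>x. x \<in> D \<Longrightarrow> x \<noteq> 0\<^sub>v m \<Longrightarrow> 0 < qf S' x + u * (\<Sum>i<k. (cmod (x \<bullet>c r i))\<^sup>2)"
    by blast
  show ?case
  proof (intro exI[of _ "t + u"] conjI ballI impI)
    fix x assume x: "x \<in> D" "x \<noteq> 0\<^sub>v m"
    have "0 \<le> u * (cmod (x \<bullet>c r k))\<^sup>2" "0 \<le> t * (\<Sum>i<k. (cmod (x \<bullet>c r i))\<^sup>2)"
      using t(1) u(1) by (auto intro!: mult_nonneg_nonneg sum_nonneg)
    thus "0 < qf S x + (t + u) * (\<Sum>i<Suc k. (cmod (x \<bullet>c r i))\<^sup>2)"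
      using u(2)[OF x] q[OF lin_subD(5)[OF D x(1)]] by (simp add: algebra_simps)
  qed (use t u in simp)
qed

text \<open>Finsler's lemma on the sum of \<open>P\<close> and the range of \<open>C\<close>: there the vectors annihilated by \<open>C*\<close> are
exactly those of \<open>P\<close>. The matrix \<open>S'\<close> is described by its form so that it may be written as a pencil.\<close>
lemma finsler_inertia:
  assumes S: "S \<in> herm_mats m" and C: "C \<in> carrier_mat m n" and P: "lin_sub m P" "P \<subseteq> mker (mat_adjoint C)"
    and pos: "\<And>x. x \<in> P \<Longrightarrow> x \<noteq> 0\<^sub>v m \<Longrightarrow> 0 < qf S x"
  shows "\<exists>t\<ge>0. \<forall>S'\<in>herm_mats m.
      (\<forall>x\<in>carrier_vec m. qf S' x = qf S x + t * Re ((mat_adjoint C *\<^sub>v x) \<bullet>c (mat_adjoint C *\<^sub>v x))) \<longrightarrow>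
      vdim m P + mat_rank C \<le> pos_inertia S'"
proof -
  have C': "mat_adjoint C \<in> carrier_mat n m" using C by simp
  let ?D = "vsum P (mran C)"
  have R: "lin_sub m (mran C)" by (rule lin_sub_mran[OF C])
  have D: "lin_sub m ?D" by (rule lin_sub_vsum[OF P(1) R])
  have rz: "x = 0\<^sub>v m" if "x \<in> mran C" "mat_adjoint C *\<^sub>v x = 0\<^sub>v n" for x
    using that adjoint_mult_self_zero[OF C] by (auto simp: mran_iff[OF C])
  have "P \<inter> mran C = {0\<^sub>v m}"
    using rz P(2) lin_subD(2)[OF P(1)] lin_subD(2)[OF R] mker_iff[OF C'] by blast
  hence dimD: "vdim m ?D = vdim m P + mat_rank C"
    using vdim_vsum[OF P(1) R] vdim_zero[of m] C by (simp add: rank_eq_vdim[OF C])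
  have cC: "(mat_adjoint C *\<^sub>v x) $ i = x \<bullet>c col C i" if "i < n" "x \<in> carrier_vec m" for i x
  proof -
    have "row (mat_adjoint C) i = conjugate (col C i)" using C that by (intro eq_vecI) auto
    thus ?thesis using C that comm_scalar_prod[of "conjugate (col C i)" m x] by simp
  qed
  have nrm: "Re ((mat_adjoint C *\<^sub>v x) \<bullet>c (mat_adjoint C *\<^sub>v x)) = (\<Sum>i<n. (cmod (x \<bullet>c col C i))\<^sup>2)"
    if "x \<in> carrier_vec m" for x
    unfolding cip_self_real using cC[OF _ that] C by simp
  have "\<exists>t\<ge>0. \<forall>x\<in>?D. x \<noteq> 0\<^sub>v m \<longrightarrow> 0 < qf S x + t * (\<Sum>i<n. (cmod (x \<bullet>c col C i))\<^sup>2)"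
  proof (rule finsler_list[OF S D])
    show "col C i \<in> carrier_vec m" if "i < n" for i using C that by auto
    fix x assume x: "x \<in> ?D" "\<And>i. i < n \<Longrightarrow> x \<bullet>c col C i = 0" "x \<noteq> 0\<^sub>v m"
    obtain p c where pc: "x = p + c" "p \<in> P" "c \<in> mran C" by (rule vsumE[OF x(1)])
    have cc: "p \<in> carrier_vec m" "c \<in> carrier_vec m" "x \<in> carrier_vec m"
      using pc lin_subD(5)[OF P(1)] lin_subD(5)[OF R] lin_subD(5)[OF D] x(1) by auto
    have "mat_adjoint C *\<^sub>v x = 0\<^sub>v n"
    proof (rule eq_vecI)
      fix i assume "i < dim_vec (0\<^sub>v n :: complex vec)"
      thus "(mat_adjoint C *\<^sub>v x) $ i = 0\<^sub>v n $ i" using cC[OF _ cc(3), of i] x(2) by (simp del: index_mult_mat_vec)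
    qed (use C in simp)
    moreover have "mat_adjoint C *\<^sub>v p = 0\<^sub>v n" using P(2) pc(2) mker_iff[OF C'] by auto
    ultimately have "mat_adjoint C *\<^sub>v c = 0\<^sub>v n"
      unfolding pc(1) mult_add_distrib_mat_vec[OF C' cc(1,2)] using C' by simp
    hence "c = 0\<^sub>v m" using rz pc(3) by simp
    hence "x = p" using pc cc by simp
    thus "0 < qf S x" using pos pc(2) x(3) by simp
  qed
  then obtain t where t: "0 \<le> t" "\<And>x. x \<in> ?D \<Longrightarrow> x \<noteq> 0\<^sub>v m \<Longrightarrow> 0 < qf S x + t * (\<Sum>i<n. (cmod (x \<bullet>c col C i))\<^sup>2)"
    by blast
  show ?thesis
  proof (intro exI[of _ t] conjI ballI impI t(1))
    fix S' assume S': "S' \<in> herm_mats m"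
      and q: "\<forall>x\<in>carrier_vec m. qf S' x = qf S x + t * Re ((mat_adjoint C *\<^sub>v x) \<bullet>c (mat_adjoint C *\<^sub>v x))"
    have "vdim m ?D \<le> pos_inertia S'"
      by (rule pos_dim_le[OF S' D]) (use t(2) q nrm lin_subD(5)[OF D] in simp)
    thus "vdim m P + mat_rank C \<le> pos_inertia S'" using dimD by simp
  qed
qed

section \<open>The pencil without constraint\<close>

definition pencil :: "complex mat \<Rightarrow> complex mat \<Rightarrow> complex mat \<Rightarrow> complex mat" where
  "pencil A B X = A - B * X * mat_adjoint B"

lemma pencil_carrier [simp]: "A \<in> carrier_mat m m \<Longrightarrow> B \<in> carrier_mat m n \<Longrightarrow> pencil A B X \<in> carrier_mat m m"
  unfolding pencil_def by (intro carrier_matI) auto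

lemma pencil_mult:
  assumes A: "A \<in> carrier_mat m m" and B: "B \<in> carrier_mat m n" and X: "X \<in> carrier_mat n n" and x: "x \<in> carrier_vec m"
  shows "pencil A B X *\<^sub>v x = A *\<^sub>v x - B *\<^sub>v (X *\<^sub>v (mat_adjoint B *\<^sub>v x))"
proof -
  have B': "mat_adjoint B \<in> carrier_mat n m" using B by simp
  have BX: "B * X \<in> carrier_mat m n" using B X by simp
  have "pencil A B X *\<^sub>v x = A *\<^sub>v x - (B * X * mat_adjoint B) *\<^sub>v x"
    unfolding pencil_def using A BX B' x by (intro minus_mult_distrib_mat_vec) auto
  also have "(B * X * mat_adjoint B) *\<^sub>v x = (B * X) *\<^sub>v (mat_adjoint B *\<^sub>v x)"
    by (rule assoc_mult_mat_vec[OF BX B' x])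
  also have "\<dots> = B *\<^sub>v (X *\<^sub>v (mat_adjoint B *\<^sub>v x))"
    by (rule assoc_mult_mat_vec[OF B X]) (use B' in simp)
  finally show ?thesis .
qed

lemma pencil_cip:
  assumes A: "A \<in> carrier_mat m m" and B: "B \<in> carrier_mat m n" and X: "X \<in> carrier_mat n n"
    and x: "x \<in> carrier_vec m" and y: "y \<in> carrier_vec m"
  shows "(pencil A B X *\<^sub>v x) \<bullet>c y = (A *\<^sub>v x) \<bullet>c y - (X *\<^sub>v (mat_adjoint B *\<^sub>v x)) \<bullet>c (mat_adjoint B *\<^sub>v y)"
proof -
  have "(B *\<^sub>v (X *\<^sub>v (mat_adjoint B *\<^sub>v x))) \<bullet>c y = (X *\<^sub>v (mat_adjoint B *\<^sub>v x)) \<bullet>c (mat_adjoint B *\<^sub>v y)"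
    by (rule cip_adjoint[OF B mat_vec_carrier[OF X] y])
  thus ?thesis unfolding pencil_mult[OF A B X x] using A B y by (simp add: cip_minus_left[of _ m])
qed

lemma pencil_herm:
  assumes A: "A \<in> herm_mats m" and B: "B \<in> carrier_mat m n" and X: "X \<in> herm_mats n"
  shows "pencil A B X \<in> herm_mats m"
proof (rule hermI)
  note c = hermD(1)[OF A] hermD(1)[OF X]
  show sc: "pencil A B X \<in> carrier_mat m m" using c B by simp
  fix x y :: "complex vec" assume x: "x \<in> carrier_vec m" and y: "y \<in> carrier_vec m"
  have Bx: "mat_adjoint B *\<^sub>v x \<in> carrier_vec n" "mat_adjoint B *\<^sub>v y \<in> carrier_vec n" using B by simp_all
  have "x \<bullet>c (pencil A B X *\<^sub>v y) = cnj ((pencil A B X *\<^sub>v y) \<bullet>c x)"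
    by (rule cip_sym) (use sc x in auto)
  also have "\<dots> = cnj ((A *\<^sub>v y) \<bullet>c x) - cnj ((X *\<^sub>v (mat_adjoint B *\<^sub>v y)) \<bullet>c (mat_adjoint B *\<^sub>v x))"
    unfolding pencil_cip[OF c(1) B c(2) y x] by simp
  also have "cnj ((A *\<^sub>v y) \<bullet>c x) = (A *\<^sub>v x) \<bullet>c y"
    using herm_cip[OF A x y] cip_sym[of "A *\<^sub>v y" m x] c x by simp
  also have "cnj ((X *\<^sub>v (mat_adjoint B *\<^sub>v y)) \<bullet>c (mat_adjoint B *\<^sub>v x)) = (X *\<^sub>v (mat_adjoint B *\<^sub>v x)) \<bullet>c (mat_adjoint B *\<^sub>v y)"
    using herm_cip[OF X Bx] cip_sym[of "X *\<^sub>v (mat_adjoint B *\<^sub>v y)" n "mat_adjoint B *\<^sub>v x"] c Bx by simp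
  finally show "(pencil A B X *\<^sub>v x) \<bullet>c y = x \<bullet>c (pencil A B X *\<^sub>v y)" unfolding pencil_cip[OF c(1) B c(2) x y] by simp
qed

lemma qf_pencil:
  assumes A: "A \<in> carrier_mat m m" and B: "B \<in> carrier_mat m n" and X: "X \<in> carrier_mat n n" and x: "x \<in> carrier_vec m"
  shows "qf (pencil A B X) x = qf A x - qf X (mat_adjoint B *\<^sub>v x)"
  unfolding qf_def pencil_cip[OF A B X x x] by simp

lemma pencil_mult_ker:
  assumes A: "A \<in> carrier_mat m m" and B: "B \<in> carrier_mat m n" and X: "X \<in> carrier_mat n n"
    and x: "x \<in> mker (mat_adjoint B)"
  shows "pencil A B X *\<^sub>v x = A *\<^sub>v x"
proof -
  have x': "x \<in> carrier_vec m" "mat_adjoint B *\<^sub>v x = 0\<^sub>v n" using x B mker_iff[of "mat_adjoint B" n m] by auto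
  show ?thesis unfolding pencil_mult[OF A B X x'(1)] x'(2) using A B X x' by (intro eq_vecI) auto
qed

text \<open>All pencils \<open>A - B X B*\<close> agree with \<open>A\<close> on the kernel of \<open>B*\<close>. This is why the rank of \<open>(A, B)\<close> can be
computed from any of them.\<close>
lemma pencil_mker_Int:
  assumes A: "A \<in> carrier_mat m m" and B: "B \<in> carrier_mat m n" and X: "X \<in> carrier_mat n n"
  shows "mker (pencil A B X) \<inter> mker (mat_adjoint B) = mker A \<inter> mker (mat_adjoint B)"
  using pencil_mult_ker[OF A B X] A B by (auto simp: mker_iff[of _ m m])

lemma qf_pencil_ker:
  assumes A: "A \<in> carrier_mat m m" and B: "B \<in> carrier_mat m n" and X: "X \<in> carrier_mat n n"
    and x: "x \<in> mker (mat_adjoint B)"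
  shows "qf (pencil A B X) x = qf A x"
  unfolding qf_def pencil_mult_ker[OF assms] ..

context
  fixes m n :: nat and A B H X :: "complex mat"
  assumes H: "bordered m n A B H" and X: "X \<in> herm_mats n"
begin

lemma pencil_facts: "A \<in> herm_mats m" "A \<in> carrier_mat m m" "B \<in> carrier_mat m n" "X \<in> carrier_mat n n"
  "pencil A B X \<in> herm_mats m" "pencil A B X \<in> carrier_mat m m" "mat_adjoint B \<in> carrier_mat n m"
  using borderedD[OF H] hermD(1)[OF X] pencil_herm[OF _ _ X, of A m B] by auto

text \<open>A positive subspace for the pencil loses at most \<open>rank B\<close> dimensions when it is cut down to the kernel of
\<open>B*\<close>, where the form is that of \<open>A\<close>.\<close>
lemma pencil_pos_le: "pos_inertia (pencil A B X) \<le> pos_inertia H"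
proof -
  note F = pencil_facts
  obtain P where P: "lin_sub m P" "vdim m P = pos_inertia (pencil A B X)" "\<And>x. x \<in> P \<Longrightarrow> x \<noteq> 0\<^sub>v m \<Longrightarrow> 0 < qf (pencil A B X) x"
    by (rule positive_subspace_exists[OF F(5)]) blast
  let ?U = "mker (mat_adjoint B)"
  have U: "lin_sub m ?U" by (rule lin_sub_mker[OF F(7)])
  have q: "0 < qf A x" if "x \<in> P \<inter> ?U" "x \<noteq> 0\<^sub>v m" for x
    using P(3)[of x] that qf_pencil_ker[OF F(2,3,4)] by auto
  have "vdim m (P \<inter> ?U) + mat_rank B \<le> pos_inertia H + vdim m {0\<^sub>v m}"
  proof (rule bordered_upper[OF H lin_sub_Int[OF P(1) U] Int_lower2 _ lin_sub_zero])
    show "0 \<le> qf A x" if "x \<in> P \<inter> ?U" for x using q[OF that] qf_zero[OF F(2)] by (cases "x = 0\<^sub>v m") auto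
    show "x \<in> {0\<^sub>v m}" if "x \<in> P \<inter> ?U" "qf A x = 0" for x using q[OF that(1)] that(2) by auto
  qed
  thus ?thesis using vdim_Int_ge[OF P(1) U] rank_mker_adjoint[OF F(3)] P(2) vdim_zero[of m] by simp
qed

text \<open>A large subspace of the kernel of \<open>B*\<close> that is nonpositive for \<open>A\<close> is nonpositive for the pencil too.\<close>
lemma pencil_neg_ge: "mat_rank (A @\<^sub>c B) \<le> neg_inertia (pencil A B X) + pos_inertia H"
proof -
  note F = pencil_facts
  obtain G where G: "lin_sub m G" "G \<subseteq> mker (mat_adjoint B)" "\<And>x. x \<in> G \<Longrightarrow> qf A x \<le> 0"
    "m \<le> vdim m G + pos_inertia H" by (rule bordered_nonpos[OF H]) blast
  have "0 \<le> qf (- pencil A B X) x" if "x \<in> G" for x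
    using G(3)[OF that] qf_pencil_ker[OF F(2,3,4), of x] G(2) that qf_uminus[OF F(6)] lin_subD(5)[OF G(1) that] by auto
  from nonneg_dim_le[OF herm_uminus[OF F(5)] G(1) this]
  have "vdim m G \<le> neg_inertia (pencil A B X) + vdim m (G \<inter> mker (pencil A B X))"
    using inertia_uminus[OF F(5)] mker_uminus[OF F(6)] by simp
  moreover have "vdim m (G \<inter> mker (pencil A B X)) \<le> vdim m (mker A \<inter> mker (mat_adjoint B))"
    by (rule vdim_mono[OF lin_sub_Int[OF G(1) lin_sub_mker[OF F(6)]] lin_sub_Int[OF lin_sub_mker[OF F(2)] lin_sub_mker[OF F(7)]]])
       (use G(2) pencil_mker_Int[OF F(2,3,4)] in blast)
  ultimately show ?thesis using G(4) rank_append_cols[OF F(2,3)] hermD(2)[OF F(1)] by simp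
qed

lemma pencil_rank_le: "mat_rank (pencil A B X) \<le> mat_rank (A @\<^sub>c B)"
proof -
  note F = pencil_facts
  have "vdim m (mker A \<inter> mker (mat_adjoint B)) \<le> vdim m (mker (pencil A B X))"
    by (rule vdim_mono[OF lin_sub_Int[OF lin_sub_mker[OF F(2)] lin_sub_mker[OF F(7)]] lin_sub_mker[OF F(6)]])
       (use pencil_mker_Int[OF F(2,3,4)] in blast)
  thus ?thesis using rank_append_cols[OF F(2,3)] hermD(2)[OF F(1)] rank_mker[OF F(6)] by simp
qed

lemma pencil_pos_attained:
  obtains t where "0 \<le> t" "pos_inertia H \<le> pos_inertia (pencil A B (X + complex_of_real (- t) \<cdot>\<^sub>m 1\<^sub>m n))"
    "X + complex_of_real (- t) \<cdot>\<^sub>m 1\<^sub>m n \<in> herm_mats n"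
proof -
  note F = pencil_facts
  obtain P where P: "lin_sub m P" "P \<subseteq> mker (mat_adjoint B)" "\<And>x. x \<in> P \<Longrightarrow> x \<noteq> 0\<^sub>v m \<Longrightarrow> 0 < qf A x"
    "pos_inertia H \<le> vdim m P + mat_rank B" by (rule bordered_lower[OF H]) blast
  have pos: "0 < qf (pencil A B X) x" if "x \<in> P" "x \<noteq> 0\<^sub>v m" for x
    using P(3)[OF that] qf_pencil_ker[OF F(2,3,4), of x] P(2) that(1) by auto
  obtain t where t: "0 \<le> t" "\<forall>S'\<in>herm_mats m.
      (\<forall>x\<in>carrier_vec m. qf S' x = qf (pencil A B X) x + t * Re ((mat_adjoint B *\<^sub>v x) \<bullet>c (mat_adjoint B *\<^sub>v x))) \<longrightarrow>
      vdim m P + mat_rank B \<le> pos_inertia S'"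
    using finsler_inertia[OF F(5,3) P(1,2) pos] by blast
  let ?X = "X + complex_of_real (- t) \<cdot>\<^sub>m 1\<^sub>m n"
  have one: "1\<^sub>m n \<in> herm_mats n" by (rule hermI) auto
  have X': "?X \<in> herm_mats n" by (intro herm_add X herm_smult one)
  have "vdim m P + mat_rank B \<le> pos_inertia (pencil A B ?X)"
  proof (rule t(2)[rule_format, OF pencil_herm[OF F(1,3) X']])
    fix x :: "complex vec" assume x: "x \<in> carrier_vec m"
    let ?y = "mat_adjoint B *\<^sub>v x"
    have y: "?y \<in> carrier_vec n" using F by simp
    have "qf ?X ?y = qf X ?y + - t * qf (1\<^sub>m n) ?y"
      using qf_add_mat[OF F(4) _ y, of "complex_of_real (- t) \<cdot>\<^sub>m 1\<^sub>m n"] qf_smult_mat[OF one_carrier_mat y, of "- t"]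
      by simp
    moreover have "qf (1\<^sub>m n) ?y = Re (?y \<bullet>c ?y)" unfolding qf_def using y by simp
    ultimately show "qf (pencil A B ?X) x = qf (pencil A B X) x + t * Re (?y \<bullet>c ?y)"
      using qf_pencil[OF F(2,3) hermD(1)[OF X'] x] qf_pencil[OF F(2,3,4) x] by simp
  qed
  thus ?thesis using that[OF t(1) _ X'] P(4) by simp
qed

end

section \<open>Diagonal sums and stacked blocks\<close>

text \<open>The matrix \<open>diag(S, -T)\<close>; the sign turns the constraint on \<open>T\<close> into one on the whole form.\<close>
definition dsum :: "complex mat \<Rightarrow> complex mat \<Rightarrow> complex mat" where
  "dsum S T = four_block_mat S (0\<^sub>m (dim_row S) (dim_col T)) (0\<^sub>m (dim_row T) (dim_col S)) (- T)"

lemma dsum_carrier [simp]: "S \<in> carrier_mat m m \<Longrightarrow> T \<in> carrier_mat k k \<Longrightarrow> dsum S T \<in> carrier_mat (m + k) (m + k)"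
  unfolding dsum_def by (intro carrier_matI) auto

lemma dsum_mult:
  assumes S: "S \<in> carrier_mat m m" and T: "T \<in> carrier_mat k k" and v: "v \<in> carrier_vec m" and w: "w \<in> carrier_vec k"
  shows "dsum S T *\<^sub>v (v @\<^sub>v w) = S *\<^sub>v v @\<^sub>v - (T *\<^sub>v w)"
proof -
  have "dsum S T *\<^sub>v (v @\<^sub>v w) = S *\<^sub>v v @\<^sub>v (- T) *\<^sub>v w"
  proof -
    have d: "dim_row S = m" "dim_col S = m" "dim_row T = k" "dim_col T = k" using S T by auto
    have "dsum S T *\<^sub>v (v @\<^sub>v w) = (S *\<^sub>v v + 0\<^sub>m m k *\<^sub>v w) @\<^sub>v (0\<^sub>m k m *\<^sub>v v + (- T) *\<^sub>v w)"
      unfolding dsum_def d by (rule four_block_mat_mult_vec[of _ m m _ k _ k]) (use S T v w in auto)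
    also have "S *\<^sub>v v + 0\<^sub>m m k *\<^sub>v w = S *\<^sub>v v" using S w by (intro eq_vecI) auto
    also have "0\<^sub>m k m *\<^sub>v v + (- T) *\<^sub>v w = (- T) *\<^sub>v w" using T v w by (intro eq_vecI) auto
    finally show ?thesis .
  qed
  thus ?thesis using T w by simp
qed

lemma cip_uminus_left: "(- x) \<bullet>c y = - (x \<bullet>c (y :: complex vec))" if "x \<in> carrier_vec n" "y \<in> carrier_vec n"
  using that by (simp add: scalar_prod_def sum_negf)

lemma cip_uminus_right: "x \<bullet>c (- y) = - (x \<bullet>c (y :: complex vec))" if "x \<in> carrier_vec n" "y \<in> carrier_vec n"
  using that by (simp add: scalar_prod_def sum_negf)

lemma dsum_herm:
  assumes S: "S \<in> herm_mats m" and T: "T \<in> herm_mats k"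
  shows "dsum S T \<in> herm_mats (m + k)"
proof (rule hermI)
  note c = hermD(1)[OF S] hermD(1)[OF T]
  show "dsum S T \<in> carrier_mat (m + k) (m + k)" using c by simp
  fix x y :: "complex vec" assume x: "x \<in> carrier_vec (m + k)" and y: "y \<in> carrier_vec (m + k)"
  obtain v w where vw: "x = v @\<^sub>v w" "v \<in> carrier_vec m" "w \<in> carrier_vec k" by (rule carrier_vec_appendE[OF x])
  obtain v' w' where vw': "y = v' @\<^sub>v w'" "v' \<in> carrier_vec m" "w' \<in> carrier_vec k" by (rule carrier_vec_appendE[OF y])
  have t: "T *\<^sub>v w \<in> carrier_vec k" "T *\<^sub>v w' \<in> carrier_vec k" "S *\<^sub>v v \<in> carrier_vec m" "S *\<^sub>v v' \<in> carrier_vec m"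
    using c by simp_all
  show "(dsum S T *\<^sub>v x) \<bullet>c y = x \<bullet>c (dsum S T *\<^sub>v y)"
    unfolding vw(1) vw'(1) dsum_mult[OF c vw(2,3)] dsum_mult[OF c vw'(2,3)]
    using t vw vw' herm_cip[OF S vw(2) vw'(2)] herm_cip[OF T vw(3) vw'(3)]
    by (simp add: cip_append[of _ m _ k] cip_uminus_left[of _ k] cip_uminus_right[of _ k])
qed

lemma qf_dsum:
  assumes S: "S \<in> carrier_mat m m" and T: "T \<in> carrier_mat k k" and v: "v \<in> carrier_vec m" and w: "w \<in> carrier_vec k"
  shows "qf (dsum S T) (v @\<^sub>v w) = qf S v - qf T w"
  unfolding qf_def dsum_mult[OF assms] using mat_vec_carrier[OF S] mat_vec_carrier[OF T] v w
  by (simp add: cip_append[of _ m _ k] cip_uminus_left[of _ k])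

lemma uminus_vec_eq_zero: "- x = 0\<^sub>v k \<longleftrightarrow> x = (0\<^sub>v k :: complex vec)"
proof
  assume z: "- x = 0\<^sub>v k"
  have "x = - (- x)" by simp
  thus "x = 0\<^sub>v k" unfolding z by simp
qed simp

lemma dsum_mker:
  assumes S: "S \<in> carrier_mat m m" and T: "T \<in> carrier_mat k k" and v: "v \<in> carrier_vec m" and w: "w \<in> carrier_vec k"
  shows "v @\<^sub>v w \<in> mker (dsum S T) \<longleftrightarrow> v \<in> mker S \<and> w \<in> mker T"
proof -
  have "S *\<^sub>v v @\<^sub>v - (T *\<^sub>v w) = 0\<^sub>v m @\<^sub>v 0\<^sub>v k \<longleftrightarrow> S *\<^sub>v v = 0\<^sub>v m \<and> - (T *\<^sub>v w) = 0\<^sub>v k"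
    by (rule append_vec_eq[of _ m]) (use S in auto)
  thus ?thesis unfolding mker_iff[OF dsum_carrier[OF S T]] dsum_mult[OF assms] zero_append_vec
      uminus_vec_eq_zero mker_iff[OF S] mker_iff[OF T] using v w by simp
qed

lemma append_rows_mult:
  assumes "B1 \<in> carrier_mat m n" "B2 \<in> carrier_mat k n" "y \<in> carrier_vec n"
  shows "(B1 @\<^sub>r B2) *\<^sub>v y = B1 *\<^sub>v y @\<^sub>v B2 *\<^sub>v (y :: complex vec)"
  using mat_mult_append[OF assms] .

lemma adjoint_append_rows_mult:
  fixes v w :: "complex vec"
  assumes B1: "B1 \<in> carrier_mat m n" and B2: "B2 \<in> carrier_mat k n" and v: "v \<in> carrier_vec m" and w: "w \<in> carrier_vec k"
  shows "mat_adjoint (B1 @\<^sub>r B2) *\<^sub>v (v @\<^sub>v w) = mat_adjoint B1 *\<^sub>v v + mat_adjoint B2 *\<^sub>v w"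
proof (rule cip_eqI)
  have c: "B1 @\<^sub>r B2 \<in> carrier_mat (m + k) n" using B1 B2 by auto
  show "mat_adjoint (B1 @\<^sub>r B2) *\<^sub>v (v @\<^sub>v w) \<in> carrier_vec n" using c by simp
  show "mat_adjoint B1 *\<^sub>v v + mat_adjoint B2 *\<^sub>v w \<in> carrier_vec n" using B1 B2 by simp
  fix z :: "complex vec" assume z: "z \<in> carrier_vec n"
  have vw: "v @\<^sub>v w \<in> carrier_vec (m + k)" using v w by simp
  have "z \<bullet>c (mat_adjoint (B1 @\<^sub>r B2) *\<^sub>v (v @\<^sub>v w)) = ((B1 @\<^sub>r B2) *\<^sub>v z) \<bullet>c (v @\<^sub>v w)"
    by (rule cip_adjoint[OF c z vw, symmetric])
  also have "\<dots> = (B1 *\<^sub>v z) \<bullet>c v + (B2 *\<^sub>v z) \<bullet>c w"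
    unfolding append_rows_mult[OF B1 B2 z] using B1 B2 v w by (simp add: cip_append[of _ m _ k])
  also have "\<dots> = z \<bullet>c (mat_adjoint B1 *\<^sub>v v + mat_adjoint B2 *\<^sub>v w)"
    using cip_adjoint[OF B1 z v] cip_adjoint[OF B2 z w] B1 B2 z by (simp add: cip_add_right[of _ n])
  finally show "z \<bullet>c (mat_adjoint (B1 @\<^sub>r B2) *\<^sub>v (v @\<^sub>v w)) = z \<bullet>c (mat_adjoint B1 *\<^sub>v v + mat_adjoint B2 *\<^sub>v w)" .
qed

lemma mker_append_rows:
  assumes B1: "B1 \<in> carrier_mat m n" and B2: "B2 \<in> carrier_mat k n"
  shows "mker (B1 @\<^sub>r B2) = mker B1 \<inter> mker B2"
proof -
  have c: "B1 @\<^sub>r B2 \<in> carrier_mat (m + k) n" using B1 B2 by auto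
  have "B1 *\<^sub>v y @\<^sub>v B2 *\<^sub>v y = 0\<^sub>v m @\<^sub>v 0\<^sub>v k \<longleftrightarrow> B1 *\<^sub>v y = 0\<^sub>v m \<and> B2 *\<^sub>v y = 0\<^sub>v k" for y
    by (rule append_vec_eq[of _ m]) (use B1 in auto)
  thus ?thesis using append_rows_mult[OF B1 B2]
    by (auto simp: mker_iff[OF c] mker_iff[OF B1] mker_iff[OF B2] zero_append_vec)
qed

lemma bordered_uminus:
  assumes H: "bordered m n A B H"
  shows "bordered m n (- A) (- B) (- H)"
proof -
  note D = borderedD[OF H]
  have adj: "mat_adjoint (- B) *\<^sub>v v = - (mat_adjoint B *\<^sub>v v)" if v: "v \<in> carrier_vec m" for v
  proof -
    have "mat_adjoint (- B) = - mat_adjoint B" using D by (intro eq_matI) auto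
    thus ?thesis using v D by simp
  qed
  show ?thesis unfolding bordered_def
  proof (intro conjI ballI)
    fix v u :: "complex vec" assume v: "v \<in> carrier_vec m" and u: "u \<in> carrier_vec n"
    have "(- H) *\<^sub>v (v @\<^sub>v u) = - (H *\<^sub>v (v @\<^sub>v u))" using D v u by simp
    also have "\<dots> = - ((A *\<^sub>v v + B *\<^sub>v u) @\<^sub>v (mat_adjoint B *\<^sub>v v))" unfolding D(5)[OF v u] ..
    also have "\<dots> = (- (A *\<^sub>v v) + - (B *\<^sub>v u)) @\<^sub>v (- (mat_adjoint B *\<^sub>v v))"
      using D by (intro eq_vecI) auto
    also have "- (A *\<^sub>v v) = (- A) *\<^sub>v v" using D v by simp
    also have "- (B *\<^sub>v u) = (- B) *\<^sub>v u" using D u by simp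
    finally show "- H *\<^sub>v (v @\<^sub>v u) = (- A *\<^sub>v v + - B *\<^sub>v u) @\<^sub>v mat_adjoint (- B) *\<^sub>v v"
      unfolding adj[OF v] .
  qed (use D herm_uminus in auto)
qed

lemma mker_adjoint_uminus:
  assumes B: "B \<in> carrier_mat m n"
  shows "mker (mat_adjoint (- B)) = mker (mat_adjoint B)"
proof -
  have "mat_adjoint (- B) = - mat_adjoint B" using B by (intro eq_matI) auto
  thus ?thesis using mker_uminus[of "mat_adjoint B" n m] B by simp
qed

lemma rank_uminus:
  assumes B: "B \<in> carrier_mat m n"
  shows "mat_rank (- B) = mat_rank B"
  using rank_mker[of "- B" m n] rank_mker[OF B] mker_uminus[OF B] B by simp

section \<open>Rank-lowering updates of a pencil\<close>

lemma psd_qf_zero: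
  assumes T: "T \<in> herm_mats m" and p: "pos_semidef T" and x: "x \<in> carrier_vec m" and q: "qf T x = 0"
  shows "x \<in> mker T"
proof -
  note Tc = hermD(1)[OF T]
  obtain N where N: "lin_sub m N" "vdim m N + pos_inertia (- T) = m" 
    "\<And>x. x \<in> N \<Longrightarrow> 0 \<le> qf (- T) x \<Longrightarrow> x \<in> mker (- T)"
    by (rule nonpositive_subspace_exists[OF herm_uminus[OF T]]) blast
  have "pos_inertia (- T) = 0" using p pos_semidef_inertia[OF T] inertia_uminus[OF T] by simp
  hence "N = carrier_vec m"
    by (intro vdim_eq_imp_eq[OF N(1) lin_sub_carrier lin_subD(1)[OF N(1)]]) (use N(2) vdim_carrier in simp)
  thus ?thesis using N(3)[of x] x q qf_uminus[OF Tc x] mker_uminus[OF Tc] by simp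
qed

lemma pencil_pencil:
  assumes A: "A \<in> carrier_mat m m" and B: "B \<in> carrier_mat m n" and X: "X \<in> carrier_mat n n" and Y: "Y \<in> carrier_mat n n"
  shows "pencil (pencil A B X) B Y = pencil A B (X + Y)"
proof -
  have B': "mat_adjoint B \<in> carrier_mat n m" using B by simp
  have c: "B * X * mat_adjoint B \<in> carrier_mat m m" "B * Y * mat_adjoint B \<in> carrier_mat m m" using B B' X Y by auto
  have "B * (X + Y) * mat_adjoint B = B * X * mat_adjoint B + B * Y * mat_adjoint B"
    using B B' X Y by (simp add: mult_add_distrib_mat[of _ m n] add_mult_distrib_mat[of _ m n])
  thus ?thesis unfolding pencil_def using A c by (intro eq_matI) auto
qed

lemma pencil_outer_mult:
  assumes S: "S \<in> carrier_mat m m" and B: "B \<in> carrier_mat m n" and y: "y \<in> carrier_vec n" and x: "x \<in> carrier_vec m"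
  shows "pencil S B (c \<cdot>\<^sub>m outer y y) *\<^sub>v x = S *\<^sub>v x - (c * (x \<bullet>c (B *\<^sub>v y))) \<cdot>\<^sub>v (B *\<^sub>v y)"
proof -
  have B': "mat_adjoint B \<in> carrier_mat n m" using B by simp
  let ?z = "mat_adjoint B *\<^sub>v x"
  have z: "?z \<in> carrier_vec n" using B by simp
  have zy: "?z \<bullet>c y = x \<bullet>c (B *\<^sub>v y)" using cip_adjoint[OF B' x y] by simp
  have o: "(c \<cdot>\<^sub>m outer y y) *\<^sub>v ?z = (c * (x \<bullet>c (B *\<^sub>v y))) \<cdot>\<^sub>v y"
    unfolding smult_mat_vec[OF outer_carrier[OF y y] z] outer_mult[OF y y z] zy by (simp add: smult_smult_assoc)
  have "c \<cdot>\<^sub>m outer y y \<in> carrier_mat n n" using y by simp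
  from pencil_mult[OF S B this x] show ?thesis unfolding o mult_mat_vec[OF B y] .
qed

lemma qf_pencil_outer:
  assumes S: "S \<in> carrier_mat m m" and B: "B \<in> carrier_mat m n" and y: "y \<in> carrier_vec n" and x: "x \<in> carrier_vec m"
  shows "qf (pencil S B (complex_of_real t \<cdot>\<^sub>m outer y y)) x = qf S x - t * (cmod (x \<bullet>c (B *\<^sub>v y)))\<^sup>2"
proof -
  have B': "mat_adjoint B \<in> carrier_mat n m" using B by simp
  have z: "mat_adjoint B *\<^sub>v x \<in> carrier_vec n" using B by simp
  have zy: "(mat_adjoint B *\<^sub>v x) \<bullet>c y = x \<bullet>c (B *\<^sub>v y)" using cip_adjoint[OF B' x y] by simp
  have "complex_of_real t \<cdot>\<^sub>m outer y y \<in> carrier_mat n n" using y by simp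
  from qf_pencil[OF S B this x] show ?thesis
    unfolding qf_smult_mat[OF outer_carrier[OF y y] z] qf_outer[OF y z] zy .
qed

lemma herm_mker_cip:
  assumes S: "S \<in> herm_mats m" and x: "x \<in> carrier_vec m" and k: "k \<in> mker S"
  shows "k \<bullet>c (S *\<^sub>v x) = 0"
proof -
  note Sc = hermD(1)[OF S]
  have kc: "k \<in> carrier_vec m" "S *\<^sub>v k = 0\<^sub>v m" using k mker_iff[OF Sc] by auto
  show ?thesis using herm_cip[OF S kc(1) x] kc(2) x by simp
qed

text \<open>If \<open>B y\<close> lies in the range of \<open>S\<close>, subtracting a multiple of \<open>(B y) (B y)*\<close> keeps the kernel of \<open>S\<close>.\<close>
lemma rank_one_le:
  assumes S: "S \<in> herm_mats m" and B: "B \<in> carrier_mat m n" and y: "y \<in> carrier_vec n"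
    and x: "x \<in> carrier_vec m" and Sx: "S *\<^sub>v x = B *\<^sub>v y"
  shows "mker S \<subseteq> mker (pencil S B (c \<cdot>\<^sub>m outer y y))" "mat_rank (pencil S B (c \<cdot>\<^sub>m outer y y)) \<le> mat_rank S"
proof -
  note Sc = hermD(1)[OF S]
  have S': "pencil S B (c \<cdot>\<^sub>m outer y y) \<in> carrier_mat m m" using Sc B by simp
  show *: "mker S \<subseteq> mker (pencil S B (c \<cdot>\<^sub>m outer y y))"
  proof
    fix k assume k: "k \<in> mker S"
    have kc: "k \<in> carrier_vec m" "S *\<^sub>v k = 0\<^sub>v m" using k mker_iff[OF Sc] by auto
    have "k \<bullet>c (B *\<^sub>v y) = 0" using herm_mker_cip[OF S x k] Sx by simp
    hence "pencil S B (c \<cdot>\<^sub>m outer y y) *\<^sub>v k = 0\<^sub>v m - 0 \<cdot>\<^sub>v (B *\<^sub>v y)"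
      unfolding pencil_outer_mult[OF Sc B y kc(1)] kc(2) by simp
    also have "\<dots> = 0\<^sub>v m" using B by (intro eq_vecI) auto
    finally show "k \<in> mker (pencil S B (c \<cdot>\<^sub>m outer y y))" using mker_iff[OF S'] kc by simp
  qed
  show "mat_rank (pencil S B (c \<cdot>\<^sub>m outer y y)) \<le> mat_rank S" by (rule rank_le[OF Sc S' *])
qed

text \<open>With the coefficient \<open>1 / (x* S x)\<close> the vector \<open>x\<close> enters the kernel.\<close>
lemma rank_one_less:
  assumes S: "S \<in> herm_mats m" and B: "B \<in> carrier_mat m n" and y: "y \<in> carrier_vec n"
    and x: "x \<in> carrier_vec m" and Sx: "S *\<^sub>v x = B *\<^sub>v y" and q: "qf S x \<noteq> 0"
  shows "mat_rank (pencil S B (complex_of_real (1 / qf S x) \<cdot>\<^sub>m outer y y)) < mat_rank S"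
proof -
  note Sc = hermD(1)[OF S]
  let ?S = "pencil S B (complex_of_real (1 / qf S x) \<cdot>\<^sub>m outer y y)"
  have S': "?S \<in> carrier_mat m m" using Sc B by simp
  have "x \<bullet>c (B *\<^sub>v y) = complex_of_real (qf S x)"
    using herm_cip[OF S x x] herm_qf_complex[OF S x] Sx by simp
  hence "complex_of_real (1 / qf S x) * (x \<bullet>c (B *\<^sub>v y)) = 1" using q by simp
  hence "?S *\<^sub>v x = B *\<^sub>v y - 1 \<cdot>\<^sub>v (B *\<^sub>v y)" unfolding pencil_outer_mult[OF Sc B y x] Sx by simp
  also have "\<dots> = 0\<^sub>v m" using B by (intro eq_vecI) auto
  finally have "x \<in> mker ?S" using mker_iff[OF S'] x by simp
  moreover have "x \<notin> mker S" using mker_qf[OF Sc] q by auto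
  ultimately show ?thesis using rank_less[OF Sc S' rank_one_le(1)[OF S B y x Sx]] by blast
qed

lemma rank_one_plus:
  assumes T: "T \<in> carrier_mat m m" and B: "B \<in> carrier_mat m n" and y: "y \<in> carrier_vec n"
  shows "mat_rank (pencil T B (c \<cdot>\<^sub>m outer y y)) \<le> mat_rank T + 1"
proof -
  let ?T = "pencil T B (c \<cdot>\<^sub>m outer y y)"
  let ?r = "B *\<^sub>v y"
  have T': "?T \<in> carrier_mat m m" using T B by simp
  have r: "?r \<in> carrier_vec m" using B by simp
  have K: "lin_sub m (mker T)" by (rule lin_sub_mker[OF T])
  let ?f = "\<lambda>x. vec 1 (\<lambda>_. x \<bullet>c ?r)"
  have l: "lin_on (mker T) 1 ?f" unfolding lin_on_def
  proof (intro conjI ballI allI)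
    fix x y assume "x \<in> mker T" "y \<in> mker T"
    thus "?f (x + y) = ?f x + ?f y" using lin_subD(5)[OF K] r by (intro eq_vecI) (auto simp: cip_add_left[of _ m])
  next
    fix a x assume "x \<in> mker T"
    thus "?f (a \<cdot>\<^sub>v x) = a \<cdot>\<^sub>v ?f x" using lin_subD(5)[OF K] r by (intro eq_vecI) (auto simp: cip_smult_left[of _ m])
  qed simp
  let ?K = "{x \<in> mker T. ?f x = 0\<^sub>v 1}"
  have "?K \<subseteq> mker ?T"
  proof
    fix x assume x: "x \<in> ?K"
    have xc: "x \<in> carrier_vec m" "T *\<^sub>v x = 0\<^sub>v m" using x mker_iff[OF T] by auto
    have "?f x $ 0 = 0\<^sub>v 1 $ 0" using x by simp
    hence "x \<bullet>c ?r = 0" by simp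
    hence "?T *\<^sub>v x = 0\<^sub>v m - 0 \<cdot>\<^sub>v ?r" unfolding pencil_outer_mult[OF T B y xc(1)] xc(2) by simp
    also have "\<dots> = 0\<^sub>v m" using B by (intro eq_vecI) auto
    finally show "x \<in> mker ?T" using mker_iff[OF T'] xc by simp
  qed
  hence "vdim m ?K \<le> vdim m (mker ?T)" by (rule vdim_mono[OF lin_sub_ker[OF l K] lin_sub_mker[OF T']])
  moreover have "vdim 1 (?f ` mker T) \<le> 1" by (rule vdim_le[OF lin_sub_image[OF l K]])
  ultimately show ?thesis using rank_nullity[OF l K] rank_mker[OF T] rank_mker[OF T'] by simp
qed

lemma psd_cauchy_schwarz:
  assumes T: "T \<in> herm_mats m" and p: "pos_semidef T" and v: "v \<in> carrier_vec m" and w: "w \<in> carrier_vec m"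
    and s: "0 < qf T w"
  shows "(cmod (v \<bullet>c (T *\<^sub>v w)))\<^sup>2 \<le> qf T v * qf T w"
proof -
  note Tc = hermD(1)[OF T]
  define b where "b = v \<bullet>c (T *\<^sub>v w)"
  define \<beta> where "\<beta> = - b / complex_of_real (qf T w)"
  have Tv: "(T *\<^sub>v v) \<bullet>c w = b" unfolding b_def by (rule herm_cip[OF T v w])
  have "0 \<le> qf T (v + \<beta> \<cdot>\<^sub>v w)" using p pos_semidef_iff[OF Tc] v w by simp
  also have "\<dots> = qf T v + (cmod \<beta>)\<^sup>2 * qf T w + 2 * Re (cnj \<beta> * b)"
    using qf_add[OF T v, of "\<beta> \<cdot>\<^sub>v w"] qf_smult[OF Tc w] w v Tc Tv
    by (simp add: cip_smult_right[of _ m])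
  also have "cnj \<beta> * b = - complex_of_real ((cmod b)\<^sup>2 / qf T w)"
    unfolding \<beta>_def by (simp add: complex_norm_square mult.commute del: of_real_power)
  also have "(cmod \<beta>)\<^sup>2 * qf T w = (cmod b)\<^sup>2 / qf T w"
    unfolding \<beta>_def using s by (simp add: norm_divide power_divide power2_eq_square)
  finally have "(cmod b)\<^sup>2 / qf T w \<le> qf T v" by simp
  thus ?thesis unfolding b_def[symmetric] using s by (simp add: pos_divide_le_eq)
qed

lemma pencil_outer_herm:
  assumes S: "S \<in> herm_mats m" and B: "B \<in> carrier_mat m n" and y: "y \<in> carrier_vec n"
  shows "pencil S B (complex_of_real t \<cdot>\<^sub>m outer y y) \<in> herm_mats m"
  by (rule pencil_herm[OF S B herm_smult[OF herm_outer[OF y]]])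

text \<open>The coefficient \<open>1 / (w* T w)\<close>, for which \<open>w\<close> just enters the kernel, is still admissible by the
Cauchy-Schwarz inequality for the form of \<open>T\<close>.\<close>
lemma psd_downdate:
  assumes T: "T \<in> herm_mats m" and p: "pos_semidef T" and B: "B \<in> carrier_mat m n" and y: "y \<in> carrier_vec n"
    and w: "w \<in> carrier_vec m" and Tw: "T *\<^sub>v w = B *\<^sub>v y" and s: "0 < qf T w"
  shows "pos_semidef (pencil T B (complex_of_real (1 / qf T w) \<cdot>\<^sub>m outer y y))"
proof -
  note Tc = hermD(1)[OF T]
  have h: "pencil T B (complex_of_real (1 / qf T w) \<cdot>\<^sub>m outer y y) \<in> herm_mats m" by (rule pencil_outer_herm[OF T B y])
  show ?thesis unfolding pos_semidef_iff[OF hermD(1)[OF h]]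
  proof (intro conjI h ballI)
    fix v :: "complex vec" assume v: "v \<in> carrier_vec m"
    have "(cmod (v \<bullet>c (B *\<^sub>v y)))\<^sup>2 \<le> qf T v * qf T w"
      using psd_cauchy_schwarz[OF T p v w s] Tw by simp
    hence "1 / qf T w * (cmod (v \<bullet>c (B *\<^sub>v y)))\<^sup>2 \<le> qf T v" using s by (simp add: pos_divide_le_eq)
    thus "0 \<le> qf (pencil T B (complex_of_real (1 / qf T w) \<cdot>\<^sub>m outer y y)) v"
      unfolding qf_pencil_outer[OF Tc B y v] by simp
  qed
qed

lemma psd_update:
  assumes T: "T \<in> herm_mats m" and p: "pos_semidef T" and B: "B \<in> carrier_mat m n" and y: "y \<in> carrier_vec n"
    and t: "t \<le> 0 \<or> B *\<^sub>v y = 0\<^sub>v m"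
  shows "pos_semidef (pencil T B (complex_of_real t \<cdot>\<^sub>m outer y y))"
proof -
  note Tc = hermD(1)[OF T]
  have h: "pencil T B (complex_of_real t \<cdot>\<^sub>m outer y y) \<in> herm_mats m" by (rule pencil_outer_herm[OF T B y])
  show ?thesis unfolding pos_semidef_iff[OF hermD(1)[OF h]]
  proof (intro conjI h ballI)
    fix v :: "complex vec" assume v: "v \<in> carrier_vec m"
    have "t * (cmod (v \<bullet>c (B *\<^sub>v y)))\<^sup>2 \<le> 0"
    proof (cases "t \<le> 0")
      case True
      thus ?thesis by (simp add: mult_nonpos_nonneg)
    next
      case False
      hence "B *\<^sub>v y = 0\<^sub>v m" using t by simp
      thus ?thesis using v by simp
    qed
    moreover have "0 \<le> qf T v" using p pos_semidef_iff[OF Tc] v by simp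
    ultimately show "0 \<le> qf (pencil T B (complex_of_real t \<cdot>\<^sub>m outer y y)) v"
      unfolding qf_pencil_outer[OF Tc B y v] by simp
  qed
qed

lemma pencil_outer2_mult:
  assumes S: "S \<in> carrier_mat m m" and B: "B \<in> carrier_mat m n" and y: "y \<in> carrier_vec n" and z: "z \<in> carrier_vec n"
    and x: "x \<in> carrier_vec m"
  shows "pencil S B (outer z y + outer y z) *\<^sub>v x =
    S *\<^sub>v x - ((x \<bullet>c (B *\<^sub>v y)) \<cdot>\<^sub>v (B *\<^sub>v z) + (x \<bullet>c (B *\<^sub>v z)) \<cdot>\<^sub>v (B *\<^sub>v y))"
proof -
  have B': "mat_adjoint B \<in> carrier_mat n m" using B by simp
  let ?u = "mat_adjoint B *\<^sub>v x"
  have u: "?u \<in> carrier_vec n" using B by simp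
  have c: "outer z y \<in> carrier_mat n n" "outer y z \<in> carrier_mat n n" using y z by auto
  have uy: "?u \<bullet>c y = x \<bullet>c (B *\<^sub>v y)" "?u \<bullet>c z = x \<bullet>c (B *\<^sub>v z)"
    using cip_adjoint[OF B' x y] cip_adjoint[OF B' x z] by simp_all
  have "(outer z y + outer y z) *\<^sub>v ?u = (x \<bullet>c (B *\<^sub>v y)) \<cdot>\<^sub>v z + (x \<bullet>c (B *\<^sub>v z)) \<cdot>\<^sub>v y"
    unfolding add_mult_distrib_mat_vec[OF c u] outer_mult[OF z y u] outer_mult[OF y z u] uy ..
  moreover have "B *\<^sub>v ((x \<bullet>c (B *\<^sub>v y)) \<cdot>\<^sub>v z + (x \<bullet>c (B *\<^sub>v z)) \<cdot>\<^sub>v y) =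
      (x \<bullet>c (B *\<^sub>v y)) \<cdot>\<^sub>v (B *\<^sub>v z) + (x \<bullet>c (B *\<^sub>v z)) \<cdot>\<^sub>v (B *\<^sub>v y)"
    using y z by (simp add: mult_add_distrib_mat_vec[OF B] mult_mat_vec[OF B])
  ultimately show ?thesis using pencil_mult[OF S B _ x, of "outer z y + outer y z"] c by simp
qed

text \<open>When \<open>x* S x = 0\<close> no rank-one update moves \<open>x\<close> into the kernel. The combination of \<open>S x\<close> with a second
vector \<open>S x'\<close> paired nontrivially with \<open>x\<close> does.\<close>
lemma rank_two_less:
  assumes S: "S \<in> herm_mats m" and B: "B \<in> carrier_mat m n" and y: "y \<in> carrier_vec n" and z: "z \<in> carrier_vec n"
    and x: "x \<in> carrier_vec m" "S *\<^sub>v x = B *\<^sub>v z" and x': "x' \<in> carrier_vec m" "S *\<^sub>v x' = B *\<^sub>v y"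
    and q: "qf S x = 0" and one: "(S *\<^sub>v x) \<bullet>c x' = 1"
  shows "mat_rank (pencil S B (outer z y + outer y z)) < mat_rank S"
proof -
  note Sc = hermD(1)[OF S]
  let ?S = "pencil S B (outer z y + outer y z)"
  have S': "?S \<in> carrier_mat m m" using Sc B by simp
  have sub: "mker S \<subseteq> mker ?S"
  proof
    fix k assume k: "k \<in> mker S"
    have kc: "k \<in> carrier_vec m" "S *\<^sub>v k = 0\<^sub>v m" using k mker_iff[OF Sc] by auto
    have "k \<bullet>c (B *\<^sub>v y) = 0" "k \<bullet>c (B *\<^sub>v z) = 0"
      using herm_mker_cip[OF S x(1) k] herm_mker_cip[OF S x'(1) k] x(2) x'(2) by simp_all
    hence "?S *\<^sub>v k = 0\<^sub>v m - (0 \<cdot>\<^sub>v (B *\<^sub>v z) + 0 \<cdot>\<^sub>v (B *\<^sub>v y))"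
      unfolding pencil_outer2_mult[OF Sc B y z kc(1)] kc(2) by simp
    also have "\<dots> = 0\<^sub>v m" using B by (intro eq_vecI) auto
    finally show "k \<in> mker ?S" using mker_iff[OF S'] kc by simp
  qed
  have "x \<bullet>c (B *\<^sub>v y) = 1" using herm_cip[OF S x(1) x'(1)] x'(2) one by simp
  moreover have "x \<bullet>c (B *\<^sub>v z) = 0"
    using herm_cip[OF S x(1) x(1)] herm_qf_complex[OF S x(1)] q x(2) by simp
  ultimately have "?S *\<^sub>v x = B *\<^sub>v z - (1 \<cdot>\<^sub>v (B *\<^sub>v z) + 0 \<cdot>\<^sub>v (B *\<^sub>v y))"
    unfolding pencil_outer2_mult[OF Sc B y z x(1)] x(2) by simp
  also have "\<dots> = 0\<^sub>v m" using B by (intro eq_vecI) auto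
  finally have "x \<in> mker ?S" using mker_iff[OF S'] x by simp
  moreover have "x \<notin> mker S" using one mker_iff[OF Sc] x'(1) by auto
  ultimately show ?thesis using rank_less[OF Sc S' sub] by blast
qed

section \<open>Two pencils sharing a parameter\<close>

lemma mranE:
  assumes "A \<in> carrier_mat nr nc" "z \<in> mran A"
  obtains x where "x \<in> carrier_vec nc" "z = A *\<^sub>v x"
  using assms(2) unfolding mran_iff[OF assms(1)] by blast

lemma mranI: "A \<in> carrier_mat nr nc \<Longrightarrow> x \<in> carrier_vec nc \<Longrightarrow> A *\<^sub>v x \<in> mran A"
  unfolding mran_def by auto

lemma add_neg_vec: "x \<in> carrier_vec n \<Longrightarrow> x + (-1) \<cdot>\<^sub>v x = (0\<^sub>v n :: complex vec)"
  by (intro eq_vecI) auto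

text \<open>The bordered matrices enter through their characterising property only. The matrix \<open>M\<close> is
\<open>diag(A1, -A2)\<close> bordered by the stacked matrix \<open>B\<close>.\<close>
locale pencil_pair =
  fixes m1 m2 n :: nat and A1 A2 B1 B2 M M1 :: "complex mat"
  assumes A1: "A1 \<in> herm_mats m1" and A2: "A2 \<in> herm_mats m2"
    and B1: "B1 \<in> carrier_mat m1 n" and B2: "B2 \<in> carrier_mat m2 n"
    and M: "bordered (m1 + m2) n (dsum A1 A2) (B1 @\<^sub>r B2) M"
    and M1: "bordered m1 n A1 B1 M1"
begin

abbreviation "B \<equiv> B1 @\<^sub>r B2"
abbreviation "W \<equiv> mker (mat_adjoint (B1 @\<^sub>r B2))"
abbreviation "r1 \<equiv> mat_rank (A1 @\<^sub>c B1)"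
abbreviation "r2 \<equiv> mat_rank (A2 @\<^sub>c B2)"

definition feasible :: "complex mat \<Rightarrow> bool" where
  "feasible X \<longleftrightarrow> X \<in> herm_mats n \<and> pos_semidef (pencil A2 B2 X)"

text \<open>The projection to the first component of the kernel of \<open>N*\<close>; see \<open>rank_N\<close>.\<close>
definition K :: "complex vec set" where
  "K = {k \<in> mker (mat_adjoint B1). A1 *\<^sub>v k \<in> (\<lambda>y. B1 *\<^sub>v y) ` mker B2}"

lemma carriers: "A1 \<in> carrier_mat m1 m1" "A2 \<in> carrier_mat m2 m2" "B \<in> carrier_mat (m1 + m2) n"
  "mat_adjoint B1 \<in> carrier_mat n m1" "mat_adjoint B2 \<in> carrier_mat n m2" "mat_adjoint B \<in> carrier_mat n (m1 + m2)"
proof -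
  show b: "B \<in> carrier_mat (m1 + m2) n" using B1 B2 by (rule carrier_append_rows)
  show "A1 \<in> carrier_mat m1 m1" "A2 \<in> carrier_mat m2 m2" using hermD A1 A2 by auto
  show "mat_adjoint B1 \<in> carrier_mat n m1" "mat_adjoint B2 \<in> carrier_mat n m2" "mat_adjoint B \<in> carrier_mat n (m1 + m2)"
    using B1 B2 b by simp_all
qed

lemma W_iff:
  assumes v: "v \<in> carrier_vec m1" and w: "w \<in> carrier_vec m2"
  shows "v @\<^sub>v w \<in> W \<longleftrightarrow> mat_adjoint B2 *\<^sub>v w = (-1) \<cdot>\<^sub>v (mat_adjoint B1 *\<^sub>v v)"
proof -
  have c: "mat_adjoint B1 *\<^sub>v v \<in> carrier_vec n" "mat_adjoint B2 *\<^sub>v w \<in> carrier_vec n" using B1 B2 by simp_all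
  have "v @\<^sub>v w \<in> W \<longleftrightarrow> mat_adjoint B1 *\<^sub>v v + mat_adjoint B2 *\<^sub>v w = 0\<^sub>v n"
    unfolding mker_iff[OF carriers(6)] adjoint_append_rows_mult[OF B1 B2 v w] using v w by simp
  also have "\<dots> \<longleftrightarrow> mat_adjoint B2 *\<^sub>v w = (-1) \<cdot>\<^sub>v (mat_adjoint B1 *\<^sub>v v)"
  proof
    assume e: "mat_adjoint B2 *\<^sub>v w = (-1) \<cdot>\<^sub>v (mat_adjoint B1 *\<^sub>v v)"
    show "mat_adjoint B1 *\<^sub>v v + mat_adjoint B2 *\<^sub>v w = 0\<^sub>v n" unfolding e by (rule add_neg_vec[OF c(1)])
  qed (rule add_eq_0_vec[OF _ c])
  finally show ?thesis .
qed

lemma WE: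
  assumes "x \<in> W"
  obtains v w where "x = v @\<^sub>v w" "v \<in> carrier_vec m1" "w \<in> carrier_vec m2"
    "mat_adjoint B2 *\<^sub>v w = (-1) \<cdot>\<^sub>v (mat_adjoint B1 *\<^sub>v v)"
proof -
  have "x \<in> carrier_vec (m1 + m2)" using assms mker_iff[OF carriers(6)] by simp
  then obtain v w where "x = v @\<^sub>v w" "v \<in> carrier_vec m1" "w \<in> carrier_vec m2" by (rule carrier_vec_appendE)
  thus ?thesis using that W_iff assms by blast
qed

lemma lin_sub_W: "lin_sub (m1 + m2) W" by (rule lin_sub_mker[OF carriers(6)])

lemma vdim_W: "vdim (m1 + m2) W + mat_rank B = m1 + m2"
  using rank_mker_adjoint[OF carriers(3)] by simp

context
  fixes X assumes fX: "feasible X"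
begin

abbreviation "S \<equiv> pencil A1 B1 X"
abbreviation "T \<equiv> pencil A2 B2 X"

lemma feasX: "X \<in> herm_mats n" "X \<in> carrier_mat n n" using fX hermD by (auto simp: feasible_def)
lemma feasS: "S \<in> herm_mats m1" "S \<in> carrier_mat m1 m1"
  using pencil_herm[OF A1 B1 feasX(1)] hermD by auto
lemma feasT: "T \<in> herm_mats m2" "T \<in> carrier_mat m2 m2" "pos_semidef T"
  using pencil_herm[OF A2 B2 feasX(1)] hermD fX unfolding feasible_def by auto

lemma T_nonneg: "w \<in> carrier_vec m2 \<Longrightarrow> 0 \<le> qf T w" using feasT pos_semidef_iff by auto

text \<open>The terms in \<open>X\<close> cancel because \<open>B2* w = - B1* v\<close> on \<open>W\<close>.\<close>
lemma qf_W:
  assumes v: "v \<in> carrier_vec m1" and w: "w \<in> carrier_vec m2" and W: "v @\<^sub>v w \<in> W"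
  shows "qf (dsum A1 A2) (v @\<^sub>v w) = qf S v - qf T w"
proof -
  have "qf X (mat_adjoint B2 *\<^sub>v w) = qf X (mat_adjoint B1 *\<^sub>v v)"
    using W W_iff[OF v w] qf_smult[OF feasX(2), of "mat_adjoint B1 *\<^sub>v v" "-1"] B1 by simp
  thus ?thesis unfolding qf_dsum[OF carriers(1,2) v w]
      qf_pencil[OF carriers(1) B1 feasX(2) v] qf_pencil[OF carriers(2) B2 feasX(2) w] by simp
qed

lemma mker_T_Int: "mker T \<inter> mker (mat_adjoint B2) = mker A2 \<inter> mker (mat_adjoint B2)"
  by (rule pencil_mker_Int[OF carriers(2) B2 feasX(2)])

lemma mker_S_Int: "mker S \<inter> mker (mat_adjoint B1) = mker A1 \<inter> mker (mat_adjoint B1)"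
  by (rule pencil_mker_Int[OF carriers(1) B1 feasX(2)])

lemma vdim_T_Int: "r2 + vdim m2 (mker T \<inter> mker (mat_adjoint B2)) = m2"
  using rank_append_cols[OF carriers(2) B2] hermD(2)[OF A2] mker_T_Int by simp

lemma vdim_S_Int: "r1 + vdim m1 (mker S \<inter> mker (mat_adjoint B1)) = m1"
  using rank_append_cols[OF carriers(1) B1] hermD(2)[OF A1] mker_S_Int by simp

text \<open>For a negative subspace \<open>P\<close> of \<open>S\<close>, the form of \<open>M\<close> is nonpositive on the pairs in \<open>W\<close> with first
component in \<open>P\<close>. It vanishes only at pairs \<open>(0, w)\<close> with \<open>T w = 0\<close> and \<open>B2* w = 0\<close>, and the space of
these has dimension \<open>m2 - r2\<close>.\<close>
lemma neg_upper: "neg_inertia S + r2 \<le> neg_inertia M"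
proof -
  obtain P where P: "lin_sub m1 P" "vdim m1 P = pos_inertia (- S)" "\<And>x. x \<in> P \<Longrightarrow> x \<noteq> 0\<^sub>v m1 \<Longrightarrow> 0 < qf (- S) x"
    by (rule positive_subspace_exists[OF herm_uminus[OF feasS(1)]]) blast
  have Pc: "v \<in> carrier_vec m1" if "v \<in> P" for v using lin_subD(5)[OF P(1) that] .
  have neg: "qf S v \<le> 0" "qf S v = 0 \<Longrightarrow> v = 0\<^sub>v m1" if "v \<in> P" for v
    using P(3)[OF that] qf_uminus[OF feasS(2) Pc[OF that]] qf_zero[OF feasS(2)] by (cases "v = 0\<^sub>v m1", auto)+
  note D = borderedD[OF M]
  let ?N = "vprod P (carrier_vec m2) \<inter> W"
  let ?Z = "vprod {0\<^sub>v m1} (mker T \<inter> mker (mat_adjoint B2))"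
  have PP: "lin_sub (m1 + m2) (vprod P (carrier_vec m2))" by (rule lin_sub_vprod[OF P(1) lin_sub_carrier])
  have N: "lin_sub (m1 + m2) ?N" by (rule lin_sub_Int[OF PP lin_sub_W])
  have kT: "lin_sub m2 (mker T \<inter> mker (mat_adjoint B2))"
    by (rule lin_sub_Int[OF lin_sub_mker[OF feasT(2)] lin_sub_mker[OF carriers(5)]])
  have NE: "\<exists>v w. x = v @\<^sub>v w \<and> v \<in> P \<and> w \<in> carrier_vec m2 \<and> mat_adjoint B2 *\<^sub>v w = (-1) \<cdot>\<^sub>v (mat_adjoint B1 *\<^sub>v v)
      \<and> qf (- dsum A1 A2) x = qf T w - qf S v" if x: "x \<in> ?N" for x
  proof -
    obtain v w where vw: "x = v @\<^sub>v w" "v \<in> P" "w \<in> carrier_vec m2" using x by (blast elim: vprodE)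
    have "qf (- dsum A1 A2) x = - qf (dsum A1 A2) x"
      by (rule qf_uminus[OF D(2)]) (use vw Pc in simp)
    thus ?thesis using vw x W_iff[OF Pc[OF vw(2)] vw(3)] qf_W[OF Pc[OF vw(2)] vw(3)] by auto
  qed
  have "vdim (m1 + m2) ?N + mat_rank (- B) \<le> pos_inertia (- M) + vdim (m1 + m2) ?Z"
  proof (rule bordered_upper[OF bordered_uminus[OF M] N _ _ lin_sub_vprod[OF lin_sub_zero kT]])
    show "?N \<subseteq> mker (mat_adjoint (- B))" using mker_adjoint_uminus[OF carriers(3)] by auto
    fix x assume x: "x \<in> ?N"
    from NE[OF x] obtain v w where vw: "x = v @\<^sub>v w" "v \<in> P" "w \<in> carrier_vec m2"
      "mat_adjoint B2 *\<^sub>v w = (-1) \<cdot>\<^sub>v (mat_adjoint B1 *\<^sub>v v)" "qf (- dsum A1 A2) x = qf T w - qf S v" by blast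
    show "0 \<le> qf (- dsum A1 A2) x" using vw neg(1) T_nonneg by fastforce
    assume "qf (- dsum A1 A2) x = 0"
    hence 0: "qf T w = 0" "qf S v = 0" using vw neg(1)[of v] T_nonneg[of w] by auto
    have v0: "v = 0\<^sub>v m1" using neg(2)[OF vw(2) 0(2)] .
    have "w \<in> mker T" by (rule psd_qf_zero[OF feasT(1,3) vw(3) 0(1)])
    moreover have "mat_adjoint B2 *\<^sub>v w = 0\<^sub>v n" unfolding vw(4) v0 using carriers(4) by (intro eq_vecI) auto
    ultimately show "x \<in> ?Z" unfolding vw(1) v0 using mker_iff[OF carriers(5)] vw(3) by (intro vprodI) auto
  qed
  moreover have "vdim (m1 + m2) ?Z = vdim m2 (mker T \<inter> mker (mat_adjoint B2))"
    using vdim_vprod[OF lin_sub_zero kT, of m1] vdim_zero[of m1] by simp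
  moreover have "pos_inertia (- M) = neg_inertia M" by (rule inertia_uminus(1)[OF bordered_herm[OF M]])
  moreover have "vdim (m1 + m2) (vprod P (carrier_vec m2)) + vdim (m1 + m2) W \<le> (m1 + m2) + vdim (m1 + m2) ?N"
    by (rule vdim_Int_ge[OF PP lin_sub_W])
  moreover have "vdim (m1 + m2) (vprod P (carrier_vec m2)) = neg_inertia S + m2"
    using vdim_vprod[OF P(1) lin_sub_carrier, of m2] vdim_carrier[of m2] P(2) inertia_uminus[OF feasS(1)] by simp
  ultimately show ?thesis using vdim_W vdim_T_Int rank_uminus[OF carriers(3)] by simp
qed

lemma lin_sub_K: "lin_sub m1 K"
proof -
  have l: "lin_on (mker B2) m1 (\<lambda>y. B1 *\<^sub>v y)" by (rule lin_on_mat[OF B1 lin_subD(1)[OF lin_sub_mker[OF B2]]])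
  have i: "lin_sub m1 ((\<lambda>y. B1 *\<^sub>v y) ` mker B2)" by (rule lin_sub_image[OF l lin_sub_mker[OF B2]])
  have u: "lin_sub m1 (mker (mat_adjoint B1))" by (rule lin_sub_mker[OF carriers(4)])
  have uc: "x \<in> carrier_vec m1" if "x \<in> mker (mat_adjoint B1)" for x using lin_subD(5)[OF u that] .
  show ?thesis
  proof (rule lin_subI)
    show "K \<subseteq> carrier_vec m1" using uc by (auto simp: K_def)
    show "0\<^sub>v m1 \<in> K" using lin_subD(2)[OF u] lin_subD(2)[OF i] carriers(1) by (simp add: K_def)
    fix x y assume "x \<in> K" "y \<in> K"
    thus "x + y \<in> K" using lin_subD(3)[OF u, of x y] lin_subD(3)[OF i, of "A1 *\<^sub>v x" "A1 *\<^sub>v y"] uc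
      unfolding K_def by (simp add: mult_add_distrib_mat_vec[OF carriers(1)])
  next
    fix c x assume "x \<in> K"
    thus "c \<cdot>\<^sub>v x \<in> K" using lin_subD(4)[OF u, of x c] lin_subD(4)[OF i, of "A1 *\<^sub>v x" c] uc
      unfolding K_def by (simp add: mult_mat_vec[OF carriers(1)])
  qed
qed

lemma KE:
  assumes "k \<in> K"
  obtains y where "k \<in> carrier_vec m1" "k \<in> mker (mat_adjoint B1)" "S *\<^sub>v k = B1 *\<^sub>v y" "y \<in> mker B2" "y \<in> carrier_vec n"
proof -
  from assms obtain y where "k \<in> mker (mat_adjoint B1)" "A1 *\<^sub>v k = B1 *\<^sub>v y" "y \<in> mker B2" by (auto simp: K_def)
  moreover have "S *\<^sub>v k = A1 *\<^sub>v k" by (rule pencil_mult_ker[OF carriers(1) B1 feasX(2) calculation(1)])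
  moreover have "k \<in> carrier_vec m1" using calculation(1) mker_iff[OF carriers(4)] by simp
  moreover have "y \<in> carrier_vec n" using calculation(3) mker_iff[OF B2] by simp
  ultimately show ?thesis using that by simp
qed

lemma KI:
  assumes k: "k \<in> mker (mat_adjoint B1)" "S *\<^sub>v k = B1 *\<^sub>v y" "y \<in> mker B2"
  shows "k \<in> K"
proof -
  have "S *\<^sub>v k = A1 *\<^sub>v k" by (rule pencil_mult_ker[OF carriers(1) B1 feasX(2) k(1)])
  thus ?thesis using k unfolding K_def by (simp add: image_eqI[OF _ k(3)])
qed

lemma qf_K: "k \<in> K \<Longrightarrow> qf S k = 0"
proof -
  assume "k \<in> K"
  then obtain y where y: "k \<in> mker (mat_adjoint B1)" "S *\<^sub>v k = B1 *\<^sub>v y" "y \<in> carrier_vec n" by (rule KE)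
  have "(B1 *\<^sub>v y) \<bullet>c k = 0" using y mker_adjoint_iff[OF B1] by simp
  thus ?thesis unfolding qf_def y(2) by simp
qed

lemma vdim_K_mker: "vdim m1 (K \<inter> mker S) = vdim m1 (mker S \<inter> mker (mat_adjoint B1))"
proof -
  have "K \<inter> mker S = mker S \<inter> mker (mat_adjoint B1)"
  proof (intro equalityI subsetI)
    fix x assume "x \<in> K \<inter> mker S"
    thus "x \<in> mker S \<inter> mker (mat_adjoint B1)" by (auto simp: K_def)
  next
    fix x assume x: "x \<in> mker S \<inter> mker (mat_adjoint B1)"
    have "S *\<^sub>v x = B1 *\<^sub>v 0\<^sub>v n" using x mker_iff[OF feasS(2)] B1 by simp
    moreover have "0\<^sub>v n \<in> mker B2" by (rule lin_subD(2)[OF lin_sub_mker[OF B2]])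
    ultimately show "x \<in> K \<inter> mker S" using KI x by auto
  qed
  thus ?thesis by simp
qed

text \<open>A positive subspace of \<open>W\<close> projects injectively to a positive subspace for \<open>S\<close>, because \<open>T\<close> is positive
semidefinite. The subspace \<open>K\<close> is isotropic for \<open>S\<close> and \<open>S\<close>-orthogonal to that projection, so their sum is
nonnegative and meets the kernel of \<open>S\<close> in \<open>K\<close> only.\<close>
lemma pos_lower: "pos_inertia M + vdim m1 K + r1 \<le> pos_inertia S + mat_rank B + m1"
proof -
  obtain P where P: "lin_sub (m1 + m2) P" "P \<subseteq> W" "\<And>x. x \<in> P \<Longrightarrow> x \<noteq> 0\<^sub>v (m1 + m2) \<Longrightarrow> 0 < qf (dsum A1 A2) x"
    "pos_inertia M \<le> vdim (m1 + m2) P + mat_rank B"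
    by (rule bordered_lower[OF M]) blast
  let ?f = "\<lambda>x. vec_first x m1"
  have l: "lin_on P m1 ?f" by (rule lin_on_vec_first[OF lin_subD(1)[OF P(1)]])
  have PE: "\<exists>v w. x = v @\<^sub>v w \<and> v \<in> carrier_vec m1 \<and> w \<in> carrier_vec m2 \<and> vec_first x m1 = v \<and>
      mat_adjoint B2 *\<^sub>v w = (-1) \<cdot>\<^sub>v (mat_adjoint B1 *\<^sub>v v) \<and> qf (dsum A1 A2) x \<le> qf S v"
    if x: "x \<in> P" for x
  proof -
    have xW: "x \<in> W" using P(2) x by auto
    then obtain v w where vw: "x = v @\<^sub>v w" "v \<in> carrier_vec m1" "w \<in> carrier_vec m2"
       "mat_adjoint B2 *\<^sub>v w = (-1) \<cdot>\<^sub>v (mat_adjoint B1 *\<^sub>v v)" by (rule WE)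
    have "qf (dsum A1 A2) x \<le> qf S v" using qf_W[OF vw(2,3)] xW T_nonneg[OF vw(3)] unfolding vw(1) by simp
    thus ?thesis using vw vec_first_append[OF vw(2)] by blast
  qed
  let ?P = "?f ` P"
  have P1: "lin_sub m1 ?P" by (rule lin_sub_image[OF l P(1)])
  have "vdim m1 ?P = vdim (m1 + m2) P"
  proof (rule vdim_inj_image[OF l P(1)])
    fix x assume x: "x \<in> P" "?f x = 0\<^sub>v m1"
    from PE[OF x(1)] x(2) have "qf (dsum A1 A2) x \<le> qf S (0\<^sub>v m1)" by metis
    thus "x = 0\<^sub>v (m1 + m2)" using P(3)[OF x(1)] qf_zero[OF feasS(2)] by fastforce
  qed
  have posP: "0 < qf S v" if v: "v \<in> ?P" "v \<noteq> 0\<^sub>v m1" for v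
  proof -
    obtain x where x: "x \<in> P" "v = ?f x" using v by blast
    have "x \<noteq> 0\<^sub>v (m1 + m2)"
    proof
      assume "x = 0\<^sub>v (m1 + m2)"
      hence "v = 0\<^sub>v m1" using x(2) lin_on_zero[OF l P(1)] by simp
      thus False using v by simp
    qed
    from P(3)[OF x(1) this] PE[OF x(1)] x(2) show ?thesis by force
  qed
  let ?N = "vsum K ?P"
  have N: "lin_sub m1 ?N" by (rule lin_sub_vsum[OF lin_sub_K P1])
  have NE: "\<exists>k p. x = k + p \<and> k \<in> K \<and> k \<in> carrier_vec m1 \<and> p \<in> ?P \<and> p \<in> carrier_vec m1 \<and> qf S x = qf S p"
    if x: "x \<in> ?N" for x
  proof -
    obtain k p where kp: "x = k + p" "k \<in> K" "p \<in> ?P" by (rule vsumE[OF x])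
    obtain y where y: "k \<in> carrier_vec m1" "S *\<^sub>v k = B1 *\<^sub>v y" "y \<in> mker B2" "y \<in> carrier_vec n" by (rule KE[OF kp(2)])
    obtain z where z: "z \<in> P" "p = ?f z" using kp(3) by blast
    from PE[OF z(1)] z(2) obtain w where w: "p \<in> carrier_vec m1" "w \<in> carrier_vec m2"
      "mat_adjoint B2 *\<^sub>v w = (-1) \<cdot>\<^sub>v (mat_adjoint B1 *\<^sub>v p)" by metis
    have c: "mat_adjoint B1 *\<^sub>v p \<in> carrier_vec n" using carriers(4) by simp
    have "(S *\<^sub>v k) \<bullet>c p = y \<bullet>c (mat_adjoint B1 *\<^sub>v p)" unfolding y(2) by (rule cip_adjoint[OF B1 y(4) w(1)])
    moreover have "(B2 *\<^sub>v y) \<bullet>c w = y \<bullet>c (mat_adjoint B2 *\<^sub>v w)" by (rule cip_adjoint[OF B2 y(4) w(2)])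
    moreover have "y \<bullet>c (mat_adjoint B2 *\<^sub>v w) = - (y \<bullet>c (mat_adjoint B1 *\<^sub>v p))"
      unfolding w(3) cip_smult_right[OF y(4) c] by simp
    moreover have "(B2 *\<^sub>v y) \<bullet>c w = 0" using y(3) mker_iff[OF B2] w(2) by simp
    ultimately have "(S *\<^sub>v k) \<bullet>c p = 0" by simp
    hence "qf S x = qf S p" unfolding kp(1) qf_add[OF feasS(1) y(1) w(1)] using qf_K[OF kp(2)] by simp
    thus ?thesis using kp y(1) w(1) by blast
  qed
  have nn: "0 \<le> qf S x" if "x \<in> ?N" for x
  proof -
    from NE[OF that] obtain p where "p \<in> ?P" "qf S x = qf S p" by blast
    thus ?thesis using posP[of p] qf_zero[OF feasS(2)] by (cases "p = 0\<^sub>v m1") auto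
  qed
  have "?N \<inter> mker S \<subseteq> K \<inter> mker S"
  proof
    fix x assume x: "x \<in> ?N \<inter> mker S"
    then obtain k p where kp: "x = k + p" "k \<in> K" "k \<in> carrier_vec m1" "p \<in> ?P" "qf S x = qf S p"
      using NE by blast
    have "qf S x = 0" using x mker_qf[OF feasS(2)] by auto
    hence "p = 0\<^sub>v m1" using posP[OF kp(4)] kp(5) by fastforce
    hence "x = k" using kp(1,3) by simp
    thus "x \<in> K \<inter> mker S" using kp x by simp
  qed
  hence "vdim m1 (?N \<inter> mker S) \<le> vdim m1 (K \<inter> mker S)"
    by (rule vdim_mono[OF lin_sub_Int[OF N lin_sub_mker[OF feasS(2)]] lin_sub_Int[OF lin_sub_K lin_sub_mker[OF feasS(2)]]])
  moreover have "K \<inter> ?P = {0\<^sub>v m1}"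
  proof -
    have "x = 0\<^sub>v m1" if "x \<in> K" "x \<in> ?P" for x using posP[OF that(2)] qf_K[OF that(1)] by fastforce
    thus ?thesis using lin_subD(2)[OF lin_sub_K] lin_subD(2)[OF P1] by blast
  qed
  moreover have "vdim m1 ?N \<le> pos_inertia S + vdim m1 (?N \<inter> mker S)" by (rule nonneg_dim_le[OF feasS(1) N nn])
  ultimately show ?thesis
    using vdim_vsum[OF lin_sub_K P1] vdim_zero[of m1] P(4) vdim_K_mker vdim_S_Int
      \<open>vdim m1 ?P = vdim (m1 + m2) P\<close> by simp
qed

end

section \<open>Optimal parameters\<close>

lemma feasible_update:
  assumes X: "feasible X" and D: "\<Delta> \<in> herm_mats n" and p: "pos_semidef (pencil (pencil A2 B2 X) B2 \<Delta>)"
  shows "feasible (X + \<Delta>)"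
proof -
  have "X \<in> herm_mats n" using X by (simp add: feasible_def)
  thus ?thesis using p pencil_pencil[OF carriers(2) B2 _ _, of X \<Delta>] hermD(1)[OF D] hermD(1)[of X n] herm_add[OF _ D, of X]
    by (simp add: feasible_def)
qed

text \<open>Choose a feasible \<open>X\<close> for which \<open>T\<close> has least rank. If \<open>T w = B2 y\<close> were nonzero, adding a multiple of
\<open>y y*\<close> to \<open>X\<close> would lower that rank; so the ranges of \<open>T\<close> and \<open>B2\<close> meet in zero only, and
\<open>rank T + rank B2 = r2\<close>. Inside a negative subspace of \<open>W\<close>, the pairs with \<open>T w = 0\<close> project to a negative subspace for \<open>S\<close> that is
orthogonal to \<open>B1 z\<close> for every \<open>z\<close> in the kernel of \<open>B2\<close>. Finsler's lemma enlarges it by all these \<open>B1 z\<close>, at the price of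
adding a positive semidefinite matrix with range in the kernel of \<open>B2\<close> to \<open>X\<close>.\<close>
lemma neg_max_attained:
  assumes ex: "\<exists>X. feasible X"
  obtains X where "feasible X" "neg_inertia M \<le> neg_inertia (pencil A1 B1 X) + r2"
proof -
  obtain X0 where "feasible X0" using ex by blast
  from ex_has_least_nat[of feasible, OF this, of "\<lambda>X. mat_rank (pencil A2 B2 X)"]
  obtain X where X: "feasible X" and min: "\<And>Y. feasible Y \<Longrightarrow> mat_rank (pencil A2 B2 X) \<le> mat_rank (pencil A2 B2 Y)"
    by blast
  let ?S = "pencil A1 B1 X" and ?T = "pencil A2 B2 X"
  note Xh = feasX[OF X] and Sh = feasS[OF X] and Th = feasT[OF X]
  have disj: "mran ?T \<inter> mran B2 = {0\<^sub>v m2}"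
  proof -
    have zero: "z = 0\<^sub>v m2" if z: "z \<in> mran ?T" "z \<in> mran B2" for z
    proof -
      obtain w where w: "w \<in> carrier_vec m2" "z = ?T *\<^sub>v w" by (rule mranE[OF Th(2) z(1)])
      obtain y where y: "y \<in> carrier_vec n" "z = B2 *\<^sub>v y" by (rule mranE[OF B2 z(2)])
      have Tw: "?T *\<^sub>v w = B2 *\<^sub>v y" using w y by simp
      have "\<not> 0 < qf ?T w"
      proof
        assume s: "0 < qf ?T w"
        let ?D = "complex_of_real (1 / qf ?T w) \<cdot>\<^sub>m outer y y"
        have D: "?D \<in> herm_mats n" by (intro herm_smult herm_outer y)
        have f: "feasible (X + ?D)"
          by (rule feasible_update[OF X D psd_downdate[OF Th(1,3) B2 y(1) w(1) Tw s]])
        have "mat_rank (pencil ?T B2 ?D) < mat_rank ?T"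
          by (rule rank_one_less[OF Th(1) B2 y(1) w(1) Tw]) (use s in simp)
        thus False using min[OF f] pencil_pencil[OF carriers(2) B2 Xh(2) hermD(1)[OF D]] by simp
      qed
      moreover have "0 \<le> qf ?T w" using Th pos_semidef_iff w(1) by auto
      ultimately have "w \<in> mker ?T" using psd_qf_zero[OF Th(1,3) w(1)] by simp
      thus ?thesis using w mker_iff[OF Th(2)] by simp
    qed
    thus ?thesis using lin_subD(2)[OF lin_sub_mran[OF Th(2)]] lin_subD(2)[OF lin_sub_mran[OF B2]] by blast
  qed
  have rT: "mat_rank ?T + mat_rank B2 = r2"
  proof -
    have "mat_rank (?T @\<^sub>c B2) = mat_rank ?T + mat_rank B2"
      using rank_append_cols_sum[OF Th(2) B2] disj vdim_zero[of m2] by simp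
    moreover have "mat_rank (?T @\<^sub>c B2) + vdim m2 (mker ?T \<inter> mker (mat_adjoint B2)) = m2"
      using rank_append_cols[OF Th(2) B2] hermD(2)[OF Th(1)] by simp
    ultimately show ?thesis using vdim_T_Int[OF X] by simp
  qed
  note Mn = bordered_uminus[OF M]
  note D = borderedD[OF M]
  obtain P where P: "lin_sub (m1 + m2) P" "P \<subseteq> mker (mat_adjoint (- B))" "\<And>x. x \<in> P \<Longrightarrow> x \<noteq> 0\<^sub>v (m1 + m2) \<Longrightarrow> 0 < qf (- dsum A1 A2) x"
    "pos_inertia (- M) \<le> vdim (m1 + m2) P + mat_rank (- B)"
    by (rule bordered_lower[OF Mn]) blast
  have PW: "P \<subseteq> W" using P(2) mker_adjoint_uminus[OF carriers(3)] by simp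
  have dP: "neg_inertia M \<le> vdim (m1 + m2) P + mat_rank B"
    using P(4) rank_uminus[OF carriers(3)] inertia_uminus(1)[OF bordered_herm[OF M]] by simp
  let ?g = "\<lambda>x. ?T *\<^sub>v vec_last x m2"
  have lg: "lin_on P m2 ?g"
    using lin_on_vec_last[OF lin_subD(1)[OF P(1)]] mat_vec_carrier[OF Th(2)] unfolding lin_on_def
    by (simp add: mult_add_distrib_mat_vec[OF Th(2)] mult_mat_vec[OF Th(2)])
  let ?P = "{x \<in> P. ?g x = 0\<^sub>v m2}"
  have P': "lin_sub (m1 + m2) ?P" by (rule lin_sub_ker[OF lg P(1)])
  have "vdim m2 (?g ` P) \<le> vdim m2 (mran ?T)"
    by (rule vdim_mono[OF lin_sub_image[OF lg P(1)] lin_sub_mran[OF Th(2)]])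
       (use mran_iff[OF Th(2)] vec_last_carrier in blast)
  also have "\<dots> = mat_rank ?T" using Th by (simp add: rank_eq_vdim[OF Th(2)])
  finally have dP': "vdim (m1 + m2) P \<le> vdim (m1 + m2) ?P + mat_rank ?T" using rank_nullity[OF lg P(1)] by simp
  let ?f = "\<lambda>x. vec_first x m1"
  have l: "lin_on ?P m1 ?f" by (rule lin_on_vec_first[OF lin_subD(1)[OF P']])
  have PE: "\<exists>v w. x = v @\<^sub>v w \<and> v \<in> carrier_vec m1 \<and> w \<in> carrier_vec m2 \<and> vec_first x m1 = v \<and>
      mat_adjoint B2 *\<^sub>v w = (-1) \<cdot>\<^sub>v (mat_adjoint B1 *\<^sub>v v) \<and> qf (- dsum A1 A2) x = qf (- ?S) v"
    if x: "x \<in> ?P" for x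
  proof -
    have xW: "x \<in> W" using PW x by auto
    then obtain v w where vw: "x = v @\<^sub>v w" "v \<in> carrier_vec m1" "w \<in> carrier_vec m2"
       "mat_adjoint B2 *\<^sub>v w = (-1) \<cdot>\<^sub>v (mat_adjoint B1 *\<^sub>v v)" by (rule WE)
    have "w \<in> mker ?T" using x vw mker_iff[OF Th(2)] by (simp add: vec_last_append)
    hence "qf ?T w = 0" by (rule mker_qf[OF Th(2)])
    hence "qf (dsum A1 A2) x = qf ?S v"
      using qf_W[OF X vw(2,3)] xW unfolding vw(1) by simp
    hence "qf (- dsum A1 A2) x = qf (- ?S) v"
      using qf_uminus[OF D(2), of x] qf_uminus[OF Sh(2) vw(2)] vw by simp
    thus ?thesis using vw vec_first_append[OF vw(2)] by blast
  qed
  let ?Q = "?f ` ?P"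
  have Q: "lin_sub m1 ?Q" by (rule lin_sub_image[OF l P'])
  have dQ: "vdim m1 ?Q = vdim (m1 + m2) ?P"
  proof (rule vdim_inj_image[OF l P'])
    fix x assume x: "x \<in> ?P" "?f x = 0\<^sub>v m1"
    from PE[OF x(1)] x(2) have "qf (- dsum A1 A2) x = qf (- ?S) (0\<^sub>v m1)" by metis
    also have "\<dots> = 0" by (rule qf_zero) (use Sh in simp)
    finally show "x = 0\<^sub>v (m1 + m2)" using P(3)[of x] x(1) by fastforce
  qed
  have posQ: "0 < qf (- ?S) v" if v: "v \<in> ?Q" "v \<noteq> 0\<^sub>v m1" for v
  proof -
    obtain x where x: "x \<in> ?P" "v = ?f x" using v by blast
    have "x \<noteq> 0\<^sub>v (m1 + m2)"
    proof
      assume "x = 0\<^sub>v (m1 + m2)"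
      hence "v = 0\<^sub>v m1" using x(2) lin_on_zero[OF l P'] by simp
      thus False using v by simp
    qed
    hence "0 < qf (- dsum A1 A2) x" using P(3) x(1) by simp
    thus ?thesis using PE[OF x(1)] x(2) by force
  qed
  let ?L = "mker B2"
  have L: "lin_sub n ?L" by (rule lin_sub_mker[OF B2])
  obtain Z where Z: "Z \<in> carrier_mat n (vdim n ?L)" "mran Z = ?L" by (rule basis_matrix[OF L])
  let ?k = "vdim n ?L"
  have Z': "mat_adjoint Z \<in> carrier_mat ?k n" using Z by simp
  let ?C = "B1 * Z"
  have C: "?C \<in> carrier_mat m1 ?k" using B1 Z by simp
  have Cm: "?C *\<^sub>v a = B1 *\<^sub>v (Z *\<^sub>v a)" if "a \<in> carrier_vec ?k" for a using assoc_mult_mat_vec[OF B1 Z(1) that] .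
  have C'm: "mat_adjoint ?C *\<^sub>v x = mat_adjoint Z *\<^sub>v (mat_adjoint B1 *\<^sub>v x)" if x: "x \<in> carrier_vec m1" for x
  proof (rule cip_eqI)
    fix a :: "complex vec" assume a: "a \<in> carrier_vec ?k"
    have "a \<bullet>c (mat_adjoint ?C *\<^sub>v x) = (?C *\<^sub>v a) \<bullet>c x" by (rule cip_adjoint[OF C a x, symmetric])
    also have "\<dots> = (Z *\<^sub>v a) \<bullet>c (mat_adjoint B1 *\<^sub>v x)" unfolding Cm[OF a]
      by (rule cip_adjoint[OF B1 mat_vec_carrier[OF Z(1)] x])
    also have "\<dots> = a \<bullet>c (mat_adjoint Z *\<^sub>v (mat_adjoint B1 *\<^sub>v x))"
      by (rule cip_adjoint[OF Z(1) a mat_vec_carrier[OF carriers(4)]])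
    finally show "a \<bullet>c (mat_adjoint ?C *\<^sub>v x) = a \<bullet>c (mat_adjoint Z *\<^sub>v (mat_adjoint B1 *\<^sub>v x))" .
  next
    show "mat_adjoint ?C *\<^sub>v x \<in> carrier_vec ?k" by (rule adjoint_vec_carrier[OF C])
    show "mat_adjoint Z *\<^sub>v (mat_adjoint B1 *\<^sub>v x) \<in> carrier_vec ?k" by (rule adjoint_vec_carrier[OF Z(1)])
  qed
  have QC: "?Q \<subseteq> mker (mat_adjoint ?C)"
  proof
    fix v assume v: "v \<in> ?Q"
    then obtain x where x: "x \<in> ?P" "v = ?f x" by blast
    from PE[OF x(1)] x(2) obtain w where w: "v \<in> carrier_vec m1" "w \<in> carrier_vec m2"
      "mat_adjoint B2 *\<^sub>v w = (-1) \<cdot>\<^sub>v (mat_adjoint B1 *\<^sub>v v)" by metis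
    have "(?C *\<^sub>v a) \<bullet>c v = 0" if a: "a \<in> carrier_vec ?k" for a
    proof -
      have za: "Z *\<^sub>v a \<in> carrier_vec n" "Z *\<^sub>v a \<in> ?L" using mat_vec_carrier[OF Z(1)] Z(2) mranI[OF Z(1) a] by auto
      have c: "mat_adjoint B1 *\<^sub>v v \<in> carrier_vec n" using mat_vec_carrier[OF carriers(4)] .
      have "(?C *\<^sub>v a) \<bullet>c v = (Z *\<^sub>v a) \<bullet>c (mat_adjoint B1 *\<^sub>v v)" unfolding Cm[OF a] by (rule cip_adjoint[OF B1 za(1) w(1)])
      moreover have "(B2 *\<^sub>v (Z *\<^sub>v a)) \<bullet>c w = - ((Z *\<^sub>v a) \<bullet>c (mat_adjoint B1 *\<^sub>v v))"
        unfolding cip_adjoint[OF B2 za(1) w(2)] w(3) cip_smult_right[OF za(1) c] by simp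
      moreover have "(B2 *\<^sub>v (Z *\<^sub>v a)) \<bullet>c w = 0" using za mker_iff[OF B2] w(2) by simp
      ultimately show ?thesis by simp
    qed
    thus "v \<in> mker (mat_adjoint ?C)" using mker_adjoint_iff[OF C] w(1) by simp
  qed
  have rC: "mat_rank ?C + mat_rank B2 = mat_rank B"
  proof -
    have lB: "lin_on ?L m1 (\<lambda>y. B1 *\<^sub>v y)" by (rule lin_on_mat[OF B1 lin_subD(1)[OF L]])
    have "mran ?C = (\<lambda>y. B1 *\<^sub>v y) ` ?L"
    proof (intro equalityI subsetI)
      fix z assume "z \<in> mran ?C"
      then obtain a where a: "a \<in> carrier_vec ?k" "z = ?C *\<^sub>v a" by (rule mranE[OF C])
      thus "z \<in> (\<lambda>y. B1 *\<^sub>v y) ` ?L" using Cm[OF a(1)] mranI[OF Z(1) a(1)] Z(2) by auto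
    next
      fix z assume "z \<in> (\<lambda>y. B1 *\<^sub>v y) ` ?L"
      then obtain y where y: "y \<in> mran Z" "z = B1 *\<^sub>v y" using Z(2) by blast
      obtain a where a: "a \<in> carrier_vec ?k" "y = Z *\<^sub>v a" by (rule mranE[OF Z(1) y(1)])
      thus "z \<in> mran ?C" using mranI[OF C a(1)] Cm[OF a(1)] y(2) by simp
    qed
    moreover have "{y \<in> ?L. B1 *\<^sub>v y = 0\<^sub>v m1} = mker B"
      unfolding mker_append_rows[OF B1 B2] set_eq_iff Int_iff mem_Collect_eq mker_iff[OF B1] mker_iff[OF B2]
      by blast
    ultimately have "mat_rank ?C + vdim n (mker B) = vdim n ?L"
      using rank_nullity[OF lB L] rank_eq_vdim[OF C] carrier_matD(1)[OF C] by simp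
    thus ?thesis using rank_mker[OF B2] rank_mker[OF carriers(3)] by simp
  qed
  have nS: "- ?S \<in> herm_mats m1" by (rule herm_uminus[OF Sh(1)])
  obtain t where t: "0 \<le> t" "\<forall>S'\<in>herm_mats m1.
      (\<forall>x\<in>carrier_vec m1. qf S' x = qf (- ?S) x + t * Re ((mat_adjoint ?C *\<^sub>v x) \<bullet>c (mat_adjoint ?C *\<^sub>v x))) \<longrightarrow>
      vdim m1 ?Q + mat_rank ?C \<le> pos_inertia S'"
    using finsler_inertia[OF nS C Q QC posQ] by blast
  \<comment> \<open>the direction in which \<open>X\<close> moves; its range is the kernel of \<open>B2\<close>, so \<open>T\<close> stays fixed\<close>
  define Y where "Y = Z * mat_adjoint Z"
  have Ym: "Y *\<^sub>v u = Z *\<^sub>v (mat_adjoint Z *\<^sub>v u)" if "u \<in> carrier_vec n" for u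
    unfolding Y_def by (rule assoc_mult_mat_vec[OF Z(1) Z' that])
  have Yc: "(Y *\<^sub>v u) \<bullet>c v = (mat_adjoint Z *\<^sub>v u) \<bullet>c (mat_adjoint Z *\<^sub>v v)"
    if "u \<in> carrier_vec n" "v \<in> carrier_vec n" for u v
    unfolding Ym[OF that(1)] by (rule cip_adjoint[OF Z(1) mat_vec_carrier[OF Z'] that(2)])
  have Y: "Y \<in> herm_mats n"
  proof (rule hermI)
    show yc: "Y \<in> carrier_mat n n" unfolding Y_def using Z(1) Z' by simp
    fix u v :: "complex vec" assume uv: "u \<in> carrier_vec n" "v \<in> carrier_vec n"
    have "u \<bullet>c (Y *\<^sub>v v) = cnj ((Y *\<^sub>v v) \<bullet>c u)" by (rule cip_sym[OF mat_vec_carrier[OF yc] uv(1)])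
    also have "\<dots> = (Y *\<^sub>v u) \<bullet>c v" unfolding Yc[OF uv] Yc[OF uv(2,1)]
      by (rule cip_sym[symmetric]) (use mat_vec_carrier[OF Z'] in auto)
    finally show "(Y *\<^sub>v u) \<bullet>c v = u \<bullet>c (Y *\<^sub>v v)" by simp
  qed
  let ?D = "complex_of_real t \<cdot>\<^sub>m Y"
  have D': "?D \<in> herm_mats n" by (rule herm_smult[OF Y])
  have qD: "qf ?D u = t * Re ((mat_adjoint Z *\<^sub>v u) \<bullet>c (mat_adjoint Z *\<^sub>v u))" if "u \<in> carrier_vec n" for u
    unfolding qf_smult_mat[OF hermD(1)[OF Y] that] unfolding qf_def Yc[OF that that] ..
  have ZB2: "mat_adjoint Z *\<^sub>v (mat_adjoint B2 *\<^sub>v w) = 0\<^sub>v ?k" if w: "w \<in> carrier_vec m2" for w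
  proof (rule eq_zero_vecI[OF mat_vec_carrier[OF Z']])
    fix a :: "complex vec" assume a: "a \<in> carrier_vec ?k"
    have za: "Z *\<^sub>v a \<in> ?L" using Z(2) mranI[OF Z(1) a] by simp
    have "a \<bullet>c (mat_adjoint Z *\<^sub>v (mat_adjoint B2 *\<^sub>v w)) = (Z *\<^sub>v a) \<bullet>c (mat_adjoint B2 *\<^sub>v w)"
      by (rule cip_adjoint[OF Z(1) a mat_vec_carrier[OF carriers(5)], symmetric])
    also have "\<dots> = (B2 *\<^sub>v (Z *\<^sub>v a)) \<bullet>c w" by (rule cip_adjoint[OF B2 mat_vec_carrier[OF Z(1)] w, symmetric])
    also have "\<dots> = 0" using za mker_iff[OF B2] w by simp
    finally show "a \<bullet>c (mat_adjoint Z *\<^sub>v (mat_adjoint B2 *\<^sub>v w)) = 0" .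
  qed
  have f: "feasible (X + ?D)"
  proof (rule feasible_update[OF X D'])
    have h: "pencil ?T B2 ?D \<in> herm_mats m2" by (rule pencil_herm[OF Th(1) B2 D'])
    show "pos_semidef (pencil ?T B2 ?D)" unfolding pos_semidef_iff[OF hermD(1)[OF h]]
    proof (intro conjI h ballI)
      fix w :: "complex vec" assume w: "w \<in> carrier_vec m2"
      have "qf (pencil ?T B2 ?D) w = qf ?T w"
        unfolding qf_pencil[OF Th(2) B2 hermD(1)[OF D'] w] qD[OF mat_vec_carrier[OF carriers(5)]] ZB2[OF w] by simp
      thus "0 \<le> qf (pencil ?T B2 ?D) w" using Th pos_semidef_iff w by auto
    qed
  qed
  have h1: "pencil ?S B1 ?D \<in> herm_mats m1" by (rule pencil_herm[OF Sh(1) B1 D'])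
  have "vdim m1 ?Q + mat_rank ?C \<le> pos_inertia (- pencil ?S B1 ?D)"
  proof (rule t(2)[rule_format, OF herm_uminus[OF h1]])
    fix x :: "complex vec" assume x: "x \<in> carrier_vec m1"
    show "qf (- pencil ?S B1 ?D) x = qf (- ?S) x + t * Re ((mat_adjoint ?C *\<^sub>v x) \<bullet>c (mat_adjoint ?C *\<^sub>v x))"
      unfolding qf_uminus[OF hermD(1)[OF h1] x] qf_uminus[OF Sh(2) x] qf_pencil[OF Sh(2) B1 hermD(1)[OF D'] x]
        qD[OF mat_vec_carrier[OF carriers(4)]] C'm[OF x] by simp
  qed
  also have "pencil ?S B1 ?D = pencil A1 B1 (X + ?D)" by (rule pencil_pencil[OF carriers(1) B1 Xh(2) hermD(1)[OF D']])
  also have "pos_inertia (- pencil A1 B1 (X + ?D)) = neg_inertia (pencil A1 B1 (X + ?D))"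
    by (rule inertia_uminus(1)[OF feasS(1)[OF f]])
  finally show ?thesis using that[OF f] dP dP' dQ rC rT by simp
qed

end

lemma add_cancel_vec: "u \<in> carrier_vec n \<Longrightarrow> v \<in> carrier_vec n \<Longrightarrow> u + (v + (-1) \<cdot>\<^sub>v u) = (v :: complex vec)"
  by (intro eq_vecI) auto

context pencil_pair begin

text \<open>Choose a feasible \<open>X\<close> minimising \<open>2 rank S + rank T\<close>. The weights are such that lowering \<open>rank S\<close> by one pays
for raising \<open>rank T\<close> by one. Minimality gives three conditions, called \<open>C1\<close>, \<open>C2\<close> and \<open>C3\<close> below.
By \<open>C1\<close> the form-orthogonal complement of the kernel of \<open>B1*\<close> is nonnegative for \<open>S\<close>; together with a positive subspace of that kernel
it leaves no room for more negative inertia than claimed. By \<open>C2\<close> the form-orthogonal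
complement of \<open>W\<close> is nonpositive for \<open>diag(S, -T)\<close>, and together with a nonpositive subspace of \<open>W\<close> it
bounds the positive inertia of \<open>diag(S, -T)\<close>, which is at least that of \<open>S\<close>. The loss in this second count is the intersection of \<open>W\<close> with its
complement, which \<open>C2\<close> and \<open>C3\<close> show to be as small as \<open>K\<close> permits.\<close>
lemma min_attained:
  assumes ex: "\<exists>X. feasible X"
  obtains X where "feasible X" "neg_inertia (pencil A1 B1 X) + pos_inertia M1 \<le> r1"
    "pos_inertia (pencil A1 B1 X) + mat_rank B + m1 \<le> pos_inertia M + vdim m1 K + r1"
proof -
  obtain X0 where "feasible X0" using ex by blast
  from ex_has_least_nat[of feasible, OF this, of "\<lambda>X. 2 * mat_rank (pencil A1 B1 X) + mat_rank (pencil A2 B2 X)"]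
  obtain X where X: "feasible X" and min: "\<And>Y. feasible Y \<Longrightarrow>
    2 * mat_rank (pencil A1 B1 X) + mat_rank (pencil A2 B2 X) \<le> 2 * mat_rank (pencil A1 B1 Y) + mat_rank (pencil A2 B2 Y)"
    by blast
  define S where "S = pencil A1 B1 X"
  define T where "T = pencil A2 B2 X"
  note Xh = feasX[OF X]
  have S: "S \<in> herm_mats m1" "S \<in> carrier_mat m1 m1"
    using feasS[OF X] unfolding S_def by auto
  have T: "T \<in> herm_mats m2" "T \<in> carrier_mat m2 m2" "pos_semidef T"
    using feasT[OF X] unfolding T_def by auto
  have step: "2 * mat_rank S + mat_rank T \<le> 2 * mat_rank (pencil S B1 D) + mat_rank (pencil T B2 D)"
    if D: "D \<in> herm_mats n" and p: "pos_semidef (pencil T B2 D)" for D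
  proof -
    have f: "feasible (X + D)" by (rule feasible_update[OF X D]) (use p in \<open>simp add: T_def\<close>)
    show ?thesis using min[OF f] pencil_pencil[OF carriers(1) B1 Xh(2) hermD(1)[OF D]] pencil_pencil[OF carriers(2) B2 Xh(2) hermD(1)[OF D]]
      unfolding S_def T_def by simp
  qed
  have Tnn: "0 \<le> qf T w" if "w \<in> carrier_vec m2" for w using T pos_semidef_iff that by auto
  \<comment> \<open>otherwise subtracting a multiple of \<open>y y*\<close> from \<open>X\<close> lowers \<open>rank S\<close> and raises \<open>rank T\<close> by at most one\<close>
  have C1: "0 \<le> qf S x" if x: "x \<in> carrier_vec m1" and y: "y \<in> carrier_vec n" and e: "S *\<^sub>v x = B1 *\<^sub>v y" for x y
  proof (rule ccontr)
    assume "\<not> 0 \<le> qf S x"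
    hence neg: "qf S x < 0" by simp
    let ?D = "complex_of_real (1 / qf S x) \<cdot>\<^sub>m outer y y"
    have D: "?D \<in> herm_mats n" by (intro herm_smult herm_outer y)
    have "pos_semidef (pencil T B2 ?D)" by (rule psd_update[OF T(1,3) B2 y]) (use neg in simp)
    from step[OF D this] rank_one_less[OF S(1) B1 y x e] rank_one_plus[OF T(2) B2 y, of "complex_of_real (1 / qf S x)"] neg
    show False using S(2) T(2) by simp
  qed
  \<comment> \<open>otherwise adding \<open>y y*\<close> with coefficient \<open>1 / (w* T w)\<close>, or \<open>1 / (x* S x)\<close> if \<open>T w = 0\<close>, lowers one rank and does not raise the other\<close>
  have C2: "qf S x \<le> qf T w \<and> (qf S x = qf T w \<longrightarrow> qf T w = 0)"
    if x: "x \<in> carrier_vec m1" and w: "w \<in> carrier_vec m2" and y: "y \<in> carrier_vec n"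
      and e: "S *\<^sub>v x = B1 *\<^sub>v y" and e': "T *\<^sub>v w = B2 *\<^sub>v y" for x w y
  proof -
    have a: "\<not> (0 < qf T w \<and> qf T w \<le> qf S x)"
    proof
      assume h: "0 < qf T w \<and> qf T w \<le> qf S x"
      let ?D = "complex_of_real (1 / qf T w) \<cdot>\<^sub>m outer y y"
      have D: "?D \<in> herm_mats n" by (intro herm_smult herm_outer y)
      have "pos_semidef (pencil T B2 ?D)" by (rule psd_downdate[OF T(1,3) B2 y w e']) (use h in simp)
      from step[OF D this] rank_one_less[OF T(1) B2 y w e'] rank_one_le(2)[OF S(1) B1 y x e, of "complex_of_real (1 / qf T w)"] h
      show False using S(2) T(2) by simp
    qed
    have b: "\<not> (qf T w = 0 \<and> 0 < qf S x)"
    proof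
      assume h: "qf T w = 0 \<and> 0 < qf S x"
      have "w \<in> mker T" by (rule psd_qf_zero[OF T(1,3) w]) (use h in simp)
      hence z: "B2 *\<^sub>v y = 0\<^sub>v m2" using mker_iff[OF T(2)] e' by simp
      let ?D = "complex_of_real (1 / qf S x) \<cdot>\<^sub>m outer y y"
      have D: "?D \<in> herm_mats n" by (intro herm_smult herm_outer y)
      have "pos_semidef (pencil T B2 ?D)" by (rule psd_update[OF T(1,3) B2 y]) (use z in simp)
      from step[OF D this] rank_one_less[OF S(1) B1 y x e] rank_one_le(2)[OF T(1) B2 y w e', of "complex_of_real (1 / qf S x)"] h
      show False using S(2) T(2) by simp
    qed
    show ?thesis using a b Tnn[OF w] by linarith
  qed
  \<comment> \<open>otherwise a change of \<open>X\<close> of rank two lowers \<open>rank S\<close>; it leaves \<open>T\<close> unchanged because \<open>B2 z = 0\<close>\<close>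
  have C3: "(S *\<^sub>v x) \<bullet>c x' = 0"
    if x: "x \<in> carrier_vec m1" and z: "z \<in> carrier_vec n" and e: "S *\<^sub>v x = B1 *\<^sub>v z" and zk: "B2 *\<^sub>v z = 0\<^sub>v m2"
      and x': "x' \<in> carrier_vec m1" and y: "y \<in> carrier_vec n" and e': "S *\<^sub>v x' = B1 *\<^sub>v y" for x z x' y
  proof (rule ccontr)
    assume ne: "(S *\<^sub>v x) \<bullet>c x' \<noteq> 0"
    have "T *\<^sub>v 0\<^sub>v m2 = B2 *\<^sub>v z" using T(2) zk by simp
    from C2[OF x _ z e this] C1[OF x z e] have q: "qf S x = 0" using qf_zero[OF T(2)] by simp
    \<comment> \<open>scales \<open>x'\<close> so that its pairing with \<open>S x\<close> becomes one\<close>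
    define c where "c = 1 / cnj ((S *\<^sub>v x) \<bullet>c x')"
    have Sx: "S *\<^sub>v x \<in> carrier_vec m1" using S(2) by simp
    have one: "(S *\<^sub>v x) \<bullet>c (c \<cdot>\<^sub>v x') = 1"
      unfolding cip_smult_right[OF Sx x'] c_def using ne by simp
    have cx: "c \<cdot>\<^sub>v x' \<in> carrier_vec m1" and cy: "c \<cdot>\<^sub>v y \<in> carrier_vec n" using x' y by auto
    have ce: "S *\<^sub>v (c \<cdot>\<^sub>v x') = B1 *\<^sub>v (c \<cdot>\<^sub>v y)" unfolding mult_mat_vec[OF S(2) x'] mult_mat_vec[OF B1 y] e' ..
    let ?D = "outer z (c \<cdot>\<^sub>v y) + outer (c \<cdot>\<^sub>v y) z"
    have D: "?D \<in> herm_mats n" by (rule herm_outer2[OF z cy])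
    have TD: "pencil T B2 ?D *\<^sub>v v = T *\<^sub>v v" if v: "v \<in> carrier_vec m2" for v
      unfolding pencil_outer2_mult[OF T(2) B2 cy z v] zk using v T(2) B2 by (intro eq_vecI) auto
    have hT: "pencil T B2 ?D \<in> herm_mats m2" by (rule pencil_herm[OF T(1) B2 D])
    have "pos_semidef (pencil T B2 ?D)"
      unfolding pos_semidef_iff[OF hermD(1)[OF hT]] using hT TD Tnn by (auto simp: qf_def)
    from step[OF D this] have "2 * mat_rank S + mat_rank T \<le> 2 * mat_rank (pencil S B1 ?D) + mat_rank (pencil T B2 ?D)" .
    moreover have "mat_rank (pencil T B2 ?D) \<le> mat_rank T"
      by (rule rank_le[OF T(2) hermD(1)[OF hT]]) (use TD in \<open>auto simp: mker_iff[OF T(2)] mker_iff[OF hermD(1)[OF hT]]\<close>)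
    moreover have "mat_rank (pencil S B1 ?D) < mat_rank S"
      by (rule rank_two_less[OF S(1) B1 cy z x e cx ce q one])
    ultimately show False using S(2) T(2) by simp
  qed
  have U: "lin_sub m1 (mker (mat_adjoint B1))" by (rule lin_sub_mker[OF carriers(4)])
  have F: "lin_sub m1 (form_perp S B1)" by (rule lin_sub_form_perp[OF S(2) B1])
  have FE: "\<exists>y\<in>carrier_vec n. S *\<^sub>v x = B1 *\<^sub>v y" if "x \<in> form_perp S B1" for x
    using that mran_iff[OF B1] by (auto simp: form_perp_def)
  have Fc: "x \<in> carrier_vec m1" if "x \<in> form_perp S B1" for x using lin_subD(5)[OF F that] .
  have neg: "neg_inertia S + pos_inertia M1 \<le> r1"
  proof -
    obtain P where P: "lin_sub m1 P" "P \<subseteq> mker (mat_adjoint B1)" "\<And>x. x \<in> P \<Longrightarrow> x \<noteq> 0\<^sub>v m1 \<Longrightarrow> 0 < qf A1 x"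
      "pos_inertia M1 \<le> vdim m1 P + mat_rank B1" by (rule bordered_lower[OF M1]) blast
    have Ppos: "0 < qf S x" if x: "x \<in> P" "x \<noteq> 0\<^sub>v m1" for x
    proof -
      have "x \<in> mker (mat_adjoint B1)" using P(2) x(1) by auto
      from P(3)[OF x] qf_pencil_ker[OF carriers(1) B1 Xh(2) this] show ?thesis unfolding S_def by simp
    qed
    let ?D = "vsum (form_perp S B1) P"
    have D: "lin_sub m1 ?D" by (rule lin_sub_vsum[OF F P(1)])
    have nn: "qf (- S) z \<le> 0" if z: "z \<in> ?D" for z
    proof -
      obtain x y where xy: "x \<in> form_perp S B1" "y \<in> P" "z = x + y" "qf S z = qf S x + qf S y"
        by (rule qf_vsum_form_perp[OF S(1) B1 P(2) z])
      have "0 \<le> qf S x" using FE[OF xy(1)] C1[OF Fc[OF xy(1)]] by blast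
      moreover have "0 \<le> qf S y" using Ppos[OF xy(2)] qf_zero[OF S(2)] by (cases "y = 0\<^sub>v m1") auto
      ultimately show ?thesis using qf_uminus[OF S(2) lin_subD(5)[OF D z]] xy(4) by simp
    qed
    have "x = 0\<^sub>v m1" if x: "x \<in> form_perp S B1" "x \<in> P" for x
    proof -
      obtain y where y: "y \<in> carrier_vec n" "S *\<^sub>v x = B1 *\<^sub>v y" using FE[OF x(1)] by blast
      have "x \<in> mker (mat_adjoint B1)" using P(2) x(2) by auto
      hence "(B1 *\<^sub>v y) \<bullet>c x = 0" using y mker_adjoint_iff[OF B1] by simp
      hence "qf S x = 0" unfolding qf_def y(2) by simp
      thus ?thesis using Ppos[OF x(2)] by fastforce
    qed
    hence "form_perp S B1 \<inter> P = {0\<^sub>v m1}" using lin_subD(2)[OF F] lin_subD(2)[OF P(1)] by blast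
    hence "vdim m1 ?D = vdim m1 (form_perp S B1) + vdim m1 P" using vdim_vsum[OF F P(1)] vdim_zero[of m1] by simp
    moreover have "vdim m1 ?D + pos_inertia (- S) \<le> m1" by (rule nonpos_dim_le[OF herm_uminus[OF S(1)] D nn])
    ultimately show ?thesis
      using vdim_form_perp[OF S(1) B1] P(4) vdim_S_Int[OF X] inertia_uminus(1)[OF S(1)] unfolding S_def by simp
  qed
  let ?Q = "dsum S T"
  let ?m = "m1 + m2"
  have Q: "?Q \<in> herm_mats ?m" "?Q \<in> carrier_mat ?m ?m" using dsum_herm[OF S(1) T(1)] hermD by auto
  have FQ: "lin_sub ?m (form_perp ?Q B)" by (rule lin_sub_form_perp[OF Q(2) carriers(3)])
  have QE: "\<exists>v w y. x = v @\<^sub>v w \<and> v \<in> carrier_vec m1 \<and> w \<in> carrier_vec m2 \<and> y \<in> carrier_vec n \<and>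
      S *\<^sub>v v = B1 *\<^sub>v y \<and> T *\<^sub>v ((-1) \<cdot>\<^sub>v w) = B2 *\<^sub>v y \<and> qf T ((-1) \<cdot>\<^sub>v w) = qf T w \<and> qf ?Q x = qf S v - qf T w \<and> ?Q *\<^sub>v x = B *\<^sub>v y"
    if x: "x \<in> form_perp ?Q B" for x
  proof -
    obtain y where y: "y \<in> carrier_vec n" "?Q *\<^sub>v x = B *\<^sub>v y"
      using x mran_iff[OF carriers(3)] by (auto simp: form_perp_def)
    obtain v w where vw: "x = v @\<^sub>v w" "v \<in> carrier_vec m1" "w \<in> carrier_vec m2"
      by (rule carrier_vec_appendE[OF lin_subD(5)[OF FQ x]])
    have "S *\<^sub>v v @\<^sub>v - (T *\<^sub>v w) = B1 *\<^sub>v y @\<^sub>v B2 *\<^sub>v y"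
      using y(2) unfolding vw(1) dsum_mult[OF S(2) T(2) vw(2,3)] append_rows_mult[OF B1 B2 y(1)] .
    hence e: "S *\<^sub>v v = B1 *\<^sub>v y" "- (T *\<^sub>v w) = B2 *\<^sub>v y"
      using append_vec_eq[of "S *\<^sub>v v" m1 "B1 *\<^sub>v y"] S(2) B1 by auto
    have "T *\<^sub>v ((-1) \<cdot>\<^sub>v w) = (-1) \<cdot>\<^sub>v (T *\<^sub>v w)" by (rule mult_mat_vec[OF T(2) vw(3)])
    also have "\<dots> = - (T *\<^sub>v w)" by (intro eq_vecI) auto
    finally have "T *\<^sub>v ((-1) \<cdot>\<^sub>v w) = B2 *\<^sub>v y" using e(2) by simp
    moreover have "qf T ((-1) \<cdot>\<^sub>v w) = qf T w" unfolding qf_smult[OF T(2) vw(3)] by simp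
    moreover have "qf ?Q x = qf S v - qf T w" unfolding vw(1) by (rule qf_dsum[OF S(2) T(2) vw(2,3)])
    ultimately show ?thesis using vw y e by blast
  qed
  obtain G where G: "lin_sub ?m G" "G \<subseteq> W" "\<And>x. x \<in> G \<Longrightarrow> qf (dsum A1 A2) x \<le> 0"
    "?m \<le> vdim ?m G + pos_inertia M" by (rule bordered_nonpos[OF M]) blast
  have Gq: "qf ?Q x \<le> 0" if x: "x \<in> G" for x
  proof -
    have xW: "x \<in> W" using G(2) x by auto
    obtain v w where vw: "x = v @\<^sub>v w" "v \<in> carrier_vec m1" "w \<in> carrier_vec m2" by (rule WE[OF xW])
    have "qf (dsum A1 A2) x = qf ?Q x"
      using qf_W[OF X vw(2,3)] xW qf_dsum[OF S(2) T(2) vw(2,3)] unfolding vw(1) S_def T_def by simp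
    thus ?thesis using G(3)[OF x] by simp
  qed
  let ?D = "vsum (form_perp ?Q B) G"
  have D: "lin_sub ?m ?D" by (rule lin_sub_vsum[OF FQ G(1)])
  have Dnp: "qf ?Q z \<le> 0" if z: "z \<in> ?D" for z
  proof -
    obtain x y where xy: "x \<in> form_perp ?Q B" "y \<in> G" "z = x + y" "qf ?Q z = qf ?Q x + qf ?Q y"
      by (rule qf_vsum_form_perp[OF Q(1) carriers(3) G(2) z])
    from QE[OF xy(1)] obtain v w u where h: "v \<in> carrier_vec m1" "w \<in> carrier_vec m2" "u \<in> carrier_vec n"
      "S *\<^sub>v v = B1 *\<^sub>v u" "T *\<^sub>v ((-1) \<cdot>\<^sub>v w) = B2 *\<^sub>v u" "qf T ((-1) \<cdot>\<^sub>v w) = qf T w" "qf ?Q x = qf S v - qf T w" by blast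
    have "qf S v \<le> qf T w" using C2[OF h(1) _ h(3,4,5)] h(2,6) by simp
    thus ?thesis using xy(4) h(7) Gq[OF xy(2)] by simp
  qed
  have "vdim ?m ?D + pos_inertia ?Q \<le> ?m" by (rule nonpos_dim_le[OF Q(1) D Dnp])
  moreover have "pos_inertia S \<le> pos_inertia ?Q"
  proof -
    obtain P where P: "lin_sub m1 P" "vdim m1 P = pos_inertia S" "\<And>x. x \<in> P \<Longrightarrow> x \<noteq> 0\<^sub>v m1 \<Longrightarrow> 0 < qf S x"
      by (rule positive_subspace_exists[OF S(1)]) blast
    have "vdim ?m (vprod P {0\<^sub>v m2}) \<le> pos_inertia ?Q"
    proof (rule pos_dim_le[OF Q(1) lin_sub_vprod[OF P(1) lin_sub_zero]])
      fix x assume x: "x \<in> vprod P {0\<^sub>v m2}" "x \<noteq> 0\<^sub>v ?m"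
      then obtain v where v: "x = v @\<^sub>v 0\<^sub>v m2" "v \<in> P" by (auto elim: vprodE)
      have "v \<noteq> 0\<^sub>v m1" using x(2) v(1) by (auto simp: zero_append_vec)
      thus "0 < qf ?Q x" unfolding v(1) qf_dsum[OF S(2) T(2) lin_subD(5)[OF P(1) v(2)] zero_carrier_vec]
        using P(3)[OF v(2)] qf_zero[OF T(2)] by simp
    qed
    thus ?thesis using vdim_vprod[OF P(1) lin_sub_zero, of m2] vdim_zero[of m2] P(2) by simp
  qed
  moreover have "vdim ?m ?D + vdim ?m (form_perp ?Q B \<inter> G) = mat_rank B + vdim ?m (mker ?Q \<inter> W) + vdim ?m G"
    using vdim_vsum[OF FQ G(1)] vdim_form_perp[OF Q(1) carriers(3)] by simp
  moreover have "vdim ?m (form_perp ?Q B \<inter> G) + vdim m1 (mker S \<inter> mker (mat_adjoint B1)) \<le> vdim m1 K + vdim ?m (mker ?Q \<inter> W)"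
  proof -
    have KK: "lin_sub m1 K" by (rule lin_sub_K[OF X])
    have K0: "lin_sub ?m (vprod K {0\<^sub>v m2})" by (rule lin_sub_vprod[OF KK lin_sub_zero])
    have QW: "lin_sub ?m (mker ?Q \<inter> W)" by (rule lin_sub_Int[OF lin_sub_mker[OF Q(2)] lin_sub_W])
    have SU: "lin_sub m1 (mker S \<inter> mker (mat_adjoint B1))" by (rule lin_sub_Int[OF lin_sub_mker[OF S(2)] U])
    obtain J where J: "J \<in> carrier_mat m1 (vdim m1 (mker (mat_adjoint B1)))" "mran J = mker (mat_adjoint B1)"
      by (rule basis_matrix[OF U])
    let ?k = "vdim m1 (mker (mat_adjoint B1))"
    have SJ: "S * J \<in> carrier_mat m1 ?k" using S(2) J(1) by simp
    \<comment> \<open>a vector of \<open>W\<close> that is form-orthogonal to \<open>W\<close> comes from \<open>K\<close>, up to the kernel of the form\<close>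
    have "form_perp ?Q B \<inter> G \<subseteq> vsum (vprod K {0\<^sub>v m2}) (mker ?Q \<inter> W)"
    proof
      fix x assume x: "x \<in> form_perp ?Q B \<inter> G"
      hence xf: "x \<in> form_perp ?Q B" and xW: "x \<in> W" using G(2) by auto
      from QE[OF xf] obtain v w y where h: "x = v @\<^sub>v w" "v \<in> carrier_vec m1" "w \<in> carrier_vec m2" "y \<in> carrier_vec n"
        "S *\<^sub>v v = B1 *\<^sub>v y" "T *\<^sub>v ((-1) \<cdot>\<^sub>v w) = B2 *\<^sub>v y" "qf T ((-1) \<cdot>\<^sub>v w) = qf T w" "qf ?Q x = qf S v - qf T w"
        "?Q *\<^sub>v x = B *\<^sub>v y" by blast
      have "qf ?Q x = 0" using xW h(4,9) mker_adjoint_iff[OF carriers(3)] by (simp add: qf_def)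
      hence q: "qf S v = qf T w" using h(8) by simp
      have w': "(-1) \<cdot>\<^sub>v w \<in> carrier_vec m2" using h(3) by simp
      have "qf T w = 0" using C2[OF h(2) w' h(4,5,6)] q h(7) by simp
      hence wk: "w \<in> mker T" and "(-1) \<cdot>\<^sub>v w \<in> mker T"
        using psd_qf_zero[OF T(1,3) h(3)] psd_qf_zero[OF T(1,3) w'] h(7) by auto
      hence yk: "B2 *\<^sub>v y = 0\<^sub>v m2" using h(6) mker_iff[OF T(2)] by simp
      \<comment> \<open>by \<open>C3\<close>, \<open>v\<close> is form-orthogonal to the complement of the kernel of \<open>B1*\<close>, so modulo the kernel of \<open>S\<close> it lies in that kernel\<close>
      have "S *\<^sub>v v \<in> mran (S * J)"
      proof (rule mran_eq_perp_mker_adjoint[OF SJ])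
        show "S *\<^sub>v v \<in> carrier_vec m1" using S(2) by simp
        fix x' assume "x' \<in> mker (mat_adjoint (S * J))"
        hence x': "x' \<in> carrier_vec m1" "\<And>a. a \<in> carrier_vec ?k \<Longrightarrow> ((S * J) *\<^sub>v a) \<bullet>c x' = 0"
          using mker_adjoint_iff[OF SJ] by auto
        have Sx': "S *\<^sub>v x' \<in> carrier_vec m1" using S(2) by simp
        have "S *\<^sub>v x' \<in> mran B1"
        proof (rule mran_eq_perp_mker_adjoint[OF B1 Sx'])
          fix u assume u: "u \<in> mker (mat_adjoint B1)"
          then obtain a where a: "a \<in> carrier_vec ?k" "u = J *\<^sub>v a" using mranE[OF J(1)] J(2) by metis
          have uc: "u \<in> carrier_vec m1" by (rule lin_subD(5)[OF U u])
          have "(S *\<^sub>v u) \<bullet>c x' = 0" using x'(2)[OF a(1)] assoc_mult_mat_vec[OF S(2) J(1) a(1)] a(2) by simp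
          hence "u \<bullet>c (S *\<^sub>v x') = 0" using herm_cip[OF S(1) uc x'(1)] by simp
          thus "(S *\<^sub>v x') \<bullet>c u = 0" using cip_sym[OF uc Sx'] by simp
        qed
        then obtain y' where y': "y' \<in> carrier_vec n" "S *\<^sub>v x' = B1 *\<^sub>v y'" by (rule mranE[OF B1])
        show "(S *\<^sub>v v) \<bullet>c x' = 0" by (rule C3[OF h(2,4,5) yk x'(1) y'])
      qed
      then obtain a where a: "a \<in> carrier_vec ?k" "S *\<^sub>v v = (S * J) *\<^sub>v a" by (rule mranE[OF SJ])
      let ?u = "J *\<^sub>v a"
      have uU: "?u \<in> mker (mat_adjoint B1)" using mranI[OF J(1) a(1)] J(2) by simp
      have uc: "?u \<in> carrier_vec m1" by (rule lin_subD(5)[OF U uU])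
      have Su: "S *\<^sub>v ?u = S *\<^sub>v v" using a(2) assoc_mult_mat_vec[OF S(2) J(1) a(1)] by simp
      have uK: "?u \<in> K"
        by (rule KI[OF X uU, of y]) (use Su h(4,5) yk mker_iff[OF B2] in \<open>simp_all add: S_def[symmetric]\<close>)
      let ?r = "v + (-1) \<cdot>\<^sub>v ?u"
      have rc: "?r \<in> carrier_vec m1" using h(2) uc by simp
      have x_eq: "x = (?u @\<^sub>v 0\<^sub>v m2) + (?r @\<^sub>v w)"
      proof -
        have "(?u @\<^sub>v 0\<^sub>v m2) + (?r @\<^sub>v w) = (?u + ?r) @\<^sub>v (0\<^sub>v m2 + w)" by (rule append_vec_add[OF uc rc _ h(3)]) simp
        also have "?u + ?r = v" by (rule add_cancel_vec[OF uc h(2)])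
        also have "0\<^sub>v m2 + w = w" using h(3) by simp
        finally show ?thesis using h(1) by simp
      qed
      have "S *\<^sub>v ?r = S *\<^sub>v v + (-1) \<cdot>\<^sub>v (S *\<^sub>v ?u)"
        using h(2) uc by (simp add: mult_add_distrib_mat_vec[OF S(2)] mult_mat_vec[OF S(2)])
      also have "\<dots> = 0\<^sub>v m1" unfolding Su by (rule add_neg_vec) (use S(2) in simp)
      finally have "?r \<in> mker S" using mker_iff[OF S(2)] rc by simp
      hence rk: "?r @\<^sub>v w \<in> mker ?Q" using dsum_mker[OF S(2) T(2) rc h(3)] wk by simp
      have "mat_adjoint B1 *\<^sub>v ?r = mat_adjoint B1 *\<^sub>v v + (-1) \<cdot>\<^sub>v (mat_adjoint B1 *\<^sub>v ?u)"
        using h(2) uc by (simp add: mult_add_distrib_mat_vec[OF carriers(4)] mult_mat_vec[OF carriers(4)])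
      also have "mat_adjoint B1 *\<^sub>v ?u = 0\<^sub>v n" using uU mker_iff[OF carriers(4)] by simp
      also have "mat_adjoint B1 *\<^sub>v v + (-1) \<cdot>\<^sub>v 0\<^sub>v n = mat_adjoint B1 *\<^sub>v v" using B1 by (intro eq_vecI) auto
      finally have "?r @\<^sub>v w \<in> W" using xW W_iff[OF h(2,3)] W_iff[OF rc h(3)] unfolding h(1) by simp
      thus "x \<in> vsum (vprod K {0\<^sub>v m2}) (mker ?Q \<inter> W)"
        by (subst x_eq) (use rk uK in \<open>intro vsumI vprodI, auto\<close>)
    qed
    hence "vdim ?m (form_perp ?Q B \<inter> G) \<le> vdim ?m (vsum (vprod K {0\<^sub>v m2}) (mker ?Q \<inter> W))"
      by (rule vdim_mono[OF lin_sub_Int[OF FQ G(1)] lin_sub_vsum[OF K0 QW]])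
    moreover have "vdim ?m (vprod (mker S \<inter> mker (mat_adjoint B1)) {0\<^sub>v m2}) \<le> vdim ?m (vprod K {0\<^sub>v m2} \<inter> (mker ?Q \<inter> W))"
    proof (rule vdim_mono[OF lin_sub_vprod[OF SU lin_sub_zero] lin_sub_Int[OF K0 QW]], rule subsetI)
      fix x assume "x \<in> vprod (mker S \<inter> mker (mat_adjoint B1)) {0\<^sub>v m2}"
      then obtain v where v: "x = v @\<^sub>v 0\<^sub>v m2" "v \<in> mker S" "v \<in> mker (mat_adjoint B1)" by (auto elim: vprodE)
      have vc: "v \<in> carrier_vec m1" by (rule lin_subD(5)[OF U v(3)])
      have "v \<in> K"
        by (rule KI[OF X v(3), of "0\<^sub>v n"])
           (use v(2) mker_iff[OF S(2)] B1 lin_subD(2)[OF lin_sub_mker[OF B2]] in \<open>simp_all add: S_def[symmetric]\<close>)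
      moreover have "x \<in> mker ?Q"
        unfolding v(1) using dsum_mker[OF S(2) T(2) vc zero_carrier_vec] v(2) lin_subD(2)[OF lin_sub_mker[OF T(2)]] by simp
      moreover have "x \<in> W"
      proof -
        have "mat_adjoint B1 *\<^sub>v v = 0\<^sub>v n" using v(3) mker_iff[OF carriers(4)] by simp
        moreover have "(-1) \<cdot>\<^sub>v 0\<^sub>v n = (0\<^sub>v n :: complex vec)" by (intro eq_vecI) auto
        ultimately show ?thesis unfolding v(1) W_iff[OF vc zero_carrier_vec] using carriers(5) by simp
      qed
      ultimately show "x \<in> vprod K {0\<^sub>v m2} \<inter> (mker ?Q \<inter> W)" unfolding v(1) by (auto intro: vprodI)
    qed
    ultimately show ?thesis
      using vdim_vsum[OF K0 QW] vdim_vprod[OF KK lin_sub_zero, of m2] vdim_vprod[OF SU lin_sub_zero, of m2] vdim_zero[of m2]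
      by simp
  qed
  ultimately have "pos_inertia S + mat_rank B + m1 \<le> pos_inertia M + vdim m1 K + r1"
    using G(4) vdim_S_Int[OF X] unfolding S_def by simp
  thus ?thesis using that[OF X] neg unfolding S_def by simp
qed

end

section \<open>The block matrices of the statement\<close>

lemma append_vec_assoc: "(a @\<^sub>v b) @\<^sub>v c = a @\<^sub>v (b @\<^sub>v (c :: complex vec))"
  by (intro eq_vecI) auto

lemma bordered_blocks:
  assumes A: "A \<in> herm_mats m" and B: "B \<in> carrier_mat m n"
  shows "bordered m n A B ((A @\<^sub>c B) @\<^sub>r (mat_adjoint B @\<^sub>c 0\<^sub>m n n))"
  unfolding bordered_def
proof (intro conjI ballI A B)
  note Ac = hermD(1)[OF A]
  have B': "mat_adjoint B \<in> carrier_mat n m" using B by simp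
  note c1 = append_cols_carrier[OF Ac B] and c2 = append_cols_carrier[OF B' zero_carrier_mat]
  show "(A @\<^sub>c B) @\<^sub>r (mat_adjoint B @\<^sub>c 0\<^sub>m n n) \<in> carrier_mat (m + n) (m + n)"
    by (rule carrier_append_rows[OF c1 c2])
  fix v u :: "complex vec" assume v: "v \<in> carrier_vec m" and u: "u \<in> carrier_vec n"
  have vu: "v @\<^sub>v u \<in> carrier_vec (m + n)" using v u by simp
  have "0\<^sub>m n n *\<^sub>v u = 0\<^sub>v n" using u by (intro eq_vecI) auto
  moreover have "mat_adjoint B *\<^sub>v v \<in> carrier_vec n" using B by simp
  ultimately show "((A @\<^sub>c B) @\<^sub>r (mat_adjoint B @\<^sub>c 0\<^sub>m n n)) *\<^sub>v (v @\<^sub>v u) = (A *\<^sub>v v + B *\<^sub>v u) @\<^sub>v mat_adjoint B *\<^sub>v v"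
    unfolding append_rows_mult[OF c1 c2 vu] append_cols_mult[OF Ac B v u] append_cols_mult[OF B' zero_carrier_mat v u]
    by simp
qed

lemma zero_mat_vec: "u \<in> carrier_vec k \<Longrightarrow> 0\<^sub>m m k *\<^sub>v u = (0\<^sub>v m :: complex vec)"
  by (intro eq_vecI) auto

lemma bordered_blocks3:
  assumes A1: "A1 \<in> herm_mats m1" and A2: "A2 \<in> herm_mats m2"
    and B1: "B1 \<in> carrier_mat m1 n" and B2: "B2 \<in> carrier_mat m2 n"
  shows "bordered (m1 + m2) n (dsum A1 A2) (B1 @\<^sub>r B2)
    ((A1             @\<^sub>c 0\<^sub>m m1 m2      @\<^sub>c B1) @\<^sub>r
     (0\<^sub>m m2 m1      @\<^sub>c (- A2)         @\<^sub>c B2) @\<^sub>r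
     (mat_adjoint B1 @\<^sub>c mat_adjoint B2 @\<^sub>c 0\<^sub>m n n))" (is "bordered _ _ _ _ (?R1 @\<^sub>r ?R2 @\<^sub>r ?R3)")
  unfolding bordered_def
proof (intro conjI ballI)
  note c = hermD(1)[OF A1] hermD(1)[OF A2]
  have mA2: "- A2 \<in> carrier_mat m2 m2" using c by simp
  have B': "mat_adjoint B1 \<in> carrier_mat n m1" "mat_adjoint B2 \<in> carrier_mat n m2" using B1 B2 by simp_all
  note i1 = append_cols_carrier[OF zero_carrier_mat B1] and i2 = append_cols_carrier[OF mA2 B2]
    and i3 = append_cols_carrier[OF B'(2) zero_carrier_mat]
  note r1 = append_cols_carrier[OF c(1) i1] and r2 = append_cols_carrier[OF zero_carrier_mat i2]
    and r3 = append_cols_carrier[OF B'(1) i3]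
  note r23 = carrier_append_rows[OF r2 r3]
  show "dsum A1 A2 \<in> herm_mats (m1 + m2)" by (rule dsum_herm[OF A1 A2])
  show "B1 @\<^sub>r B2 \<in> carrier_mat (m1 + m2) n" by (rule carrier_append_rows[OF B1 B2])
  show "?R1 @\<^sub>r ?R2 @\<^sub>r ?R3 \<in> carrier_mat (m1 + m2 + n) (m1 + m2 + n)"
    using carrier_append_rows[OF r1 r23] by (simp add: add.assoc)
  fix x u :: "complex vec" assume x: "x \<in> carrier_vec (m1 + m2)" and u: "u \<in> carrier_vec n"
  obtain v w where vw: "x = v @\<^sub>v w" "v \<in> carrier_vec m1" "w \<in> carrier_vec m2" by (rule carrier_vec_appendE[OF x])
  have wu: "w @\<^sub>v u \<in> carrier_vec (m2 + n)" and vwu: "v @\<^sub>v (w @\<^sub>v u) \<in> carrier_vec (m1 + (m2 + n))" using vw u by auto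
  have z: "0\<^sub>m m1 m2 *\<^sub>v w = 0\<^sub>v m1" "0\<^sub>m m2 m1 *\<^sub>v v = 0\<^sub>v m2" "0\<^sub>m n n *\<^sub>v u = 0\<^sub>v n"
    using vw u by (simp_all add: zero_mat_vec)
  have cc: "A1 *\<^sub>v v \<in> carrier_vec m1" "B1 *\<^sub>v u \<in> carrier_vec m1" "A2 *\<^sub>v w \<in> carrier_vec m2" "B2 *\<^sub>v u \<in> carrier_vec m2"
    "mat_adjoint B2 *\<^sub>v w \<in> carrier_vec n" "mat_adjoint B1 *\<^sub>v v \<in> carrier_vec n"
    using c B1 B2 by simp_all
  have "(?R1 @\<^sub>r ?R2 @\<^sub>r ?R3) *\<^sub>v (x @\<^sub>v u) =
      (A1 *\<^sub>v v + (0\<^sub>m m1 m2 *\<^sub>v w + B1 *\<^sub>v u)) @\<^sub>v (0\<^sub>m m2 m1 *\<^sub>v v + ((- A2) *\<^sub>v w + B2 *\<^sub>v u)) @\<^sub>v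
      (mat_adjoint B1 *\<^sub>v v + (mat_adjoint B2 *\<^sub>v w + 0\<^sub>m n n *\<^sub>v u))"
    unfolding vw(1) append_vec_assoc append_rows_mult[OF r1 r23 vwu] append_rows_mult[OF r2 r3 vwu]
      append_cols_mult[OF c(1) i1 vw(2) wu] append_cols_mult[OF zero_carrier_mat i2 vw(2) wu]
      append_cols_mult[OF B'(1) i3 vw(2) wu] append_cols_mult[OF zero_carrier_mat B1 vw(3) u]
      append_cols_mult[OF mA2 B2 vw(3) u] append_cols_mult[OF B'(2) zero_carrier_mat vw(3) u] ..
  also have "\<dots> = (A1 *\<^sub>v v + B1 *\<^sub>v u) @\<^sub>v (- (A2 *\<^sub>v w) + B2 *\<^sub>v u) @\<^sub>v (mat_adjoint B1 *\<^sub>v v + mat_adjoint B2 *\<^sub>v w)"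
    unfolding z using cc vw c by simp
  also have "\<dots> = ((A1 *\<^sub>v v @\<^sub>v - (A2 *\<^sub>v w)) + (B1 *\<^sub>v u @\<^sub>v B2 *\<^sub>v u)) @\<^sub>v (mat_adjoint B1 *\<^sub>v v + mat_adjoint B2 *\<^sub>v w)"
    using append_vec_add[of "A1 *\<^sub>v v" m1 "B1 *\<^sub>v u" "- (A2 *\<^sub>v w)" m2 "B2 *\<^sub>v u"] cc by (simp add: append_vec_assoc)
  finally show "(?R1 @\<^sub>r ?R2 @\<^sub>r ?R3) *\<^sub>v (x @\<^sub>v u) =
      (dsum A1 A2 *\<^sub>v x + (B1 @\<^sub>r B2) *\<^sub>v u) @\<^sub>v mat_adjoint (B1 @\<^sub>r B2) *\<^sub>v x"
    unfolding vw(1) dsum_mult[OF c vw(2,3)] append_rows_mult[OF B1 B2 u] adjoint_append_rows_mult[OF B1 B2 vw(2,3)] .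
qed

text \<open>Large negative parameters make the positive inertia of the pencil equal to that of \<open>H\<close>. It exhausts the rank
of the pencil precisely when no negative eigenvalue is left.\<close>
lemma feasible_iff:
  assumes H: "bordered m n A B H"
  shows "(\<exists>X\<in>herm_mats n. pos_semidef (pencil A B X)) \<longleftrightarrow> pos_inertia H = mat_rank (A @\<^sub>c B)"
proof -
  have sq: "mat_rank (pencil A B X) = pos_inertia (pencil A B X) + neg_inertia (pencil A B X)" if "X \<in> herm_mats n" for X
    by (rule rank_eq_inertia[OF pencil_facts(5)[OF H that]])
  have up: "pos_inertia H \<le> mat_rank (A @\<^sub>c B)" if X: "X \<in> herm_mats n" for X
  proof -
    obtain t where t: "pos_inertia H \<le> pos_inertia (pencil A B (X + complex_of_real (- t) \<cdot>\<^sub>m 1\<^sub>m n))"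
      "X + complex_of_real (- t) \<cdot>\<^sub>m 1\<^sub>m n \<in> herm_mats n" by (rule pencil_pos_attained[OF H X])
    show ?thesis using t(1) pencil_rank_le[OF H t(2)] sq[OF t(2)] by simp
  qed
  have zero: "0\<^sub>m n n \<in> herm_mats n" by (rule hermI) (auto simp: zero_mat_vec)
  show ?thesis
  proof
    assume "\<exists>X\<in>herm_mats n. pos_semidef (pencil A B X)"
    then obtain X where X: "X \<in> herm_mats n" "pos_semidef (pencil A B X)" by blast
    hence "neg_inertia (pencil A B X) = 0" using pos_semidef_inertia[OF pencil_facts(5)[OF H X(1)]] by simp
    thus "pos_inertia H = mat_rank (A @\<^sub>c B)" using pencil_neg_ge[OF H X(1)] up[OF X(1)] by simp
  next
    assume e: "pos_inertia H = mat_rank (A @\<^sub>c B)"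
    obtain t where t: "pos_inertia H \<le> pos_inertia (pencil A B (0\<^sub>m n n + complex_of_real (- t) \<cdot>\<^sub>m 1\<^sub>m n))"
      "0\<^sub>m n n + complex_of_real (- t) \<cdot>\<^sub>m 1\<^sub>m n \<in> herm_mats n" by (rule pencil_pos_attained[OF H zero])
    hence "neg_inertia (pencil A B (0\<^sub>m n n + complex_of_real (- t) \<cdot>\<^sub>m 1\<^sub>m n)) = 0"
      using pencil_rank_le[OF H t(2)] sq[OF t(2)] e by simp
    thus "\<exists>X\<in>herm_mats n. pos_semidef (pencil A B X)" using pos_semidef_inertia[OF pencil_facts(5)[OF H t(2)]] t(2) by blast
  qed
qed

context pencil_pair begin

text \<open>A vector \<open>(k, y)\<close> lies in the kernel of \<open>N*\<close> when \<open>A1 k + B1 y = 0\<close>, \<open>B1* k = 0\<close> and \<open>B2 y = 0\<close>. So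
this kernel projects onto \<open>K\<close>, and the fibre over zero is the kernel of \<open>B\<close>.\<close>
lemma rank_N:
  assumes ex: "feasible X"
  shows "mat_rank ((A1 @\<^sub>c B1 @\<^sub>c 0\<^sub>m m1 m2) @\<^sub>r (mat_adjoint B1 @\<^sub>c 0\<^sub>m n n @\<^sub>c mat_adjoint B2)) + vdim m1 K = m1 + mat_rank B"
    (is "mat_rank ?N + _ = _")
proof -
  note c = carriers
  note i1 = append_cols_carrier[OF B1 zero_carrier_mat[of m1 m2]] and i2 = append_cols_carrier[OF zero_carrier_mat[of n n] c(5)]
  note r1 = append_cols_carrier[OF c(1) i1] and r2 = append_cols_carrier[OF c(4) i2]
  have N: "?N \<in> carrier_mat (m1 + n) (m1 + (n + m2))" by (rule carrier_append_rows[OF r1 r2])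
  have Nm: "?N *\<^sub>v (v @\<^sub>v u @\<^sub>v w) = (A1 *\<^sub>v v + B1 *\<^sub>v u) @\<^sub>v (mat_adjoint B1 *\<^sub>v v + mat_adjoint B2 *\<^sub>v w)"
    if v: "v \<in> carrier_vec m1" and u: "u \<in> carrier_vec n" and w: "w \<in> carrier_vec m2" for v u w
  proof -
    have uw: "u @\<^sub>v w \<in> carrier_vec (n + m2)" and vuw: "v @\<^sub>v u @\<^sub>v w \<in> carrier_vec (m1 + (n + m2))" using v u w by auto
    have "B1 *\<^sub>v u \<in> carrier_vec m1" "mat_adjoint B2 *\<^sub>v w \<in> carrier_vec n" using B1 B2 by simp_all
    thus ?thesis
      unfolding append_rows_mult[OF r1 r2 vuw] append_cols_mult[OF c(1) i1 v uw] append_cols_mult[OF c(4) i2 v uw]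
        append_cols_mult[OF B1 zero_carrier_mat u w] append_cols_mult[OF zero_carrier_mat c(5) u w]
        zero_mat_vec[OF u] zero_mat_vec[OF w] by simp
  qed
  have ker: "k @\<^sub>v y \<in> mker (mat_adjoint ?N) \<longleftrightarrow>
      A1 *\<^sub>v k + B1 *\<^sub>v y = 0\<^sub>v m1 \<and> k \<in> mker (mat_adjoint B1) \<and> y \<in> mker B2"
    if k: "k \<in> carrier_vec m1" and y: "y \<in> carrier_vec n" for k y
  proof -
    have ky: "k @\<^sub>v y \<in> carrier_vec (m1 + n)" using k y by simp
    have cc: "A1 *\<^sub>v k + B1 *\<^sub>v y \<in> carrier_vec m1" "mat_adjoint B1 *\<^sub>v k \<in> carrier_vec n" "B2 *\<^sub>v y \<in> carrier_vec m2"
      using c(1) B1 B2 by simp_all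
    have e: "(?N *\<^sub>v (v @\<^sub>v u @\<^sub>v w)) \<bullet>c (k @\<^sub>v y) = v \<bullet>c (A1 *\<^sub>v k + B1 *\<^sub>v y) + u \<bullet>c (mat_adjoint B1 *\<^sub>v k) + w \<bullet>c (B2 *\<^sub>v y)"
      if v: "v \<in> carrier_vec m1" and u: "u \<in> carrier_vec n" and w: "w \<in> carrier_vec m2" for v u w
    proof -
      have h: "A1 *\<^sub>v v \<in> carrier_vec m1" "B1 *\<^sub>v u \<in> carrier_vec m1" "mat_adjoint B1 *\<^sub>v v \<in> carrier_vec n" "mat_adjoint B2 *\<^sub>v w \<in> carrier_vec n"
         "A1 *\<^sub>v k \<in> carrier_vec m1" "B1 *\<^sub>v y \<in> carrier_vec m1"
        using c(1) B1 B2 by simp_all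
      have "(?N *\<^sub>v (v @\<^sub>v u @\<^sub>v w)) \<bullet>c (k @\<^sub>v y) = (A1 *\<^sub>v v) \<bullet>c k + (B1 *\<^sub>v u) \<bullet>c k + ((mat_adjoint B1 *\<^sub>v v) \<bullet>c y + (mat_adjoint B2 *\<^sub>v w) \<bullet>c y)"
        unfolding Nm[OF v u w] using h k y by (simp add: cip_append[of _ m1 _ n] cip_add_left[of _ m1] cip_add_left[of _ n])
      also have "(A1 *\<^sub>v v) \<bullet>c k = v \<bullet>c (A1 *\<^sub>v k)" by (rule herm_cip[OF A1 v k])
      also have "(B1 *\<^sub>v u) \<bullet>c k = u \<bullet>c (mat_adjoint B1 *\<^sub>v k)" by (rule cip_adjoint[OF B1 u k])
      also have "(mat_adjoint B1 *\<^sub>v v) \<bullet>c y = v \<bullet>c (B1 *\<^sub>v y)" using cip_adjoint[OF c(4) v y] by simp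
      also have "(mat_adjoint B2 *\<^sub>v w) \<bullet>c y = w \<bullet>c (B2 *\<^sub>v y)" using cip_adjoint[OF c(5) w y] by simp
      finally show ?thesis unfolding cip_add_right[OF v h(5,6)] by simp
    qed
    show ?thesis
    proof
      assume "k @\<^sub>v y \<in> mker (mat_adjoint ?N)"
      hence z: "(?N *\<^sub>v (v @\<^sub>v u @\<^sub>v w)) \<bullet>c (k @\<^sub>v y) = 0"
        if "v \<in> carrier_vec m1" "u \<in> carrier_vec n" "w \<in> carrier_vec m2" for v u w
        using mker_adjoint_iff[OF N] that by simp
      have "A1 *\<^sub>v k + B1 *\<^sub>v y = 0\<^sub>v m1"
        by (rule eq_zero_vecI[OF cc(1)])
           (use z[OF _ zero_carrier_vec zero_carrier_vec] e[OF _ zero_carrier_vec zero_carrier_vec] cip_zero(2)[OF cc(2)] cip_zero(2)[OF cc(3)] in simp)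
      moreover have "mat_adjoint B1 *\<^sub>v k = 0\<^sub>v n"
        by (rule eq_zero_vecI[OF cc(2)])
           (use z[OF zero_carrier_vec _ zero_carrier_vec] e[OF zero_carrier_vec _ zero_carrier_vec] cip_zero(2)[OF cc(1)] cip_zero(2)[OF cc(3)] in simp)
      moreover have "B2 *\<^sub>v y = 0\<^sub>v m2"
        by (rule eq_zero_vecI[OF cc(3)])
           (use z[OF zero_carrier_vec zero_carrier_vec] e[OF zero_carrier_vec zero_carrier_vec] cip_zero(2)[OF cc(1)] cip_zero(2)[OF cc(2)] in simp)
      ultimately show "A1 *\<^sub>v k + B1 *\<^sub>v y = 0\<^sub>v m1 \<and> k \<in> mker (mat_adjoint B1) \<and> y \<in> mker B2"
        using mker_iff[OF c(4)] mker_iff[OF B2] k y by simp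
    next
      assume "A1 *\<^sub>v k + B1 *\<^sub>v y = 0\<^sub>v m1 \<and> k \<in> mker (mat_adjoint B1) \<and> y \<in> mker B2"
      hence z: "A1 *\<^sub>v k + B1 *\<^sub>v y = 0\<^sub>v m1" "mat_adjoint B1 *\<^sub>v k = 0\<^sub>v n" "B2 *\<^sub>v y = 0\<^sub>v m2"
        using mker_iff[OF c(4)] mker_iff[OF B2] by auto
      have "(?N *\<^sub>v x) \<bullet>c (k @\<^sub>v y) = 0" if x: "x \<in> carrier_vec (m1 + (n + m2))" for x
      proof -
        obtain v x' where v: "x = v @\<^sub>v x'" "v \<in> carrier_vec m1" "x' \<in> carrier_vec (n + m2)" by (rule carrier_vec_appendE[OF x])
        obtain u w where u: "x' = u @\<^sub>v w" "u \<in> carrier_vec n" "w \<in> carrier_vec m2" by (rule carrier_vec_appendE[OF v(3)])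
        show ?thesis unfolding v(1) u(1) e[OF v(2) u(2,3)] z using v u by simp
      qed
      thus "k @\<^sub>v y \<in> mker (mat_adjoint ?N)" using mker_adjoint_iff[OF N] ky by simp
    qed
  qed
  let ?L = "mker (mat_adjoint ?N)"
  have L: "lin_sub (m1 + n) ?L" by (rule lin_sub_mker) (use N in simp)
  let ?f = "\<lambda>x. vec_first x m1"
  have l: "lin_on ?L m1 ?f" by (rule lin_on_vec_first[OF lin_subD(1)[OF L]])
  have LE: "\<exists>k y. x = k @\<^sub>v y \<and> k \<in> carrier_vec m1 \<and> y \<in> carrier_vec n \<and> ?f x = k" if x: "x \<in> ?L" for x
  proof -
    obtain k y where "x = k @\<^sub>v y" "k \<in> carrier_vec m1" "y \<in> carrier_vec n"
      by (rule carrier_vec_appendE[OF lin_subD(5)[OF L x]])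
    thus ?thesis using vec_first_append by blast
  qed
  have "?f ` ?L = K"
  proof (intro equalityI subsetI)
    fix k assume "k \<in> ?f ` ?L"
    then obtain x where x: "x \<in> ?L" "k = ?f x" by blast
    from LE[OF x(1)] x(2) obtain y where y: "x = k @\<^sub>v y" "k \<in> carrier_vec m1" "y \<in> carrier_vec n" by metis
    have h: "A1 *\<^sub>v k + B1 *\<^sub>v y = 0\<^sub>v m1" "k \<in> mker (mat_adjoint B1)" "y \<in> mker B2" using x(1) ker[OF y(2,3)] y(1) by auto
    have cc: "A1 *\<^sub>v k \<in> carrier_vec m1" "B1 *\<^sub>v y \<in> carrier_vec m1" using c(1) B1 by simp_all
    have "B1 *\<^sub>v y + A1 *\<^sub>v k = 0\<^sub>v m1" using h(1) comm_add_vec[OF cc] by simp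
    from add_eq_0_vec[OF this cc(2,1)] have "A1 *\<^sub>v k = B1 *\<^sub>v ((-1) \<cdot>\<^sub>v y)" unfolding mult_mat_vec[OF B1 y(3)] .
    moreover have "(-1) \<cdot>\<^sub>v y \<in> mker B2" by (rule lin_subD(4)[OF lin_sub_mker[OF B2] h(3)])
    ultimately show "k \<in> K" unfolding K_def using h(2) by simp
  next
    fix k assume k: "k \<in> K"
    then obtain y where y: "k \<in> mker (mat_adjoint B1)" "A1 *\<^sub>v k = B1 *\<^sub>v y" "y \<in> mker B2" by (auto simp: K_def)
    have kc: "k \<in> carrier_vec m1" "y \<in> carrier_vec n" using y mker_iff[OF c(4)] mker_iff[OF B2] by auto
    have y': "(-1) \<cdot>\<^sub>v y \<in> mker B2" by (rule lin_subD(4)[OF lin_sub_mker[OF B2] y(3)])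
    have yc: "(-1) \<cdot>\<^sub>v y \<in> carrier_vec n" using kc by simp
    have "A1 *\<^sub>v k + B1 *\<^sub>v ((-1) \<cdot>\<^sub>v y) = 0\<^sub>v m1"
      unfolding mult_mat_vec[OF B1 kc(2)] y(2) by (rule add_neg_vec) (use B1 in simp)
    hence "k @\<^sub>v (-1) \<cdot>\<^sub>v y \<in> ?L" using ker[OF kc(1) yc] y(1) y' by simp
    thus "k \<in> ?f ` ?L" using vec_first_append[OF kc(1)] by (metis image_eqI)
  qed
  moreover have "{x \<in> ?L. ?f x = 0\<^sub>v m1} = vprod {0\<^sub>v m1} (mker B)"
  proof (intro equalityI subsetI)
    fix x assume x: "x \<in> {x \<in> ?L. ?f x = 0\<^sub>v m1}"
    with LE[of x] obtain y where y: "x = 0\<^sub>v m1 @\<^sub>v y" "y \<in> carrier_vec n" by auto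
    have "A1 *\<^sub>v 0\<^sub>v m1 + B1 *\<^sub>v y = 0\<^sub>v m1" "y \<in> mker B2" using x ker[OF zero_carrier_vec y(2)] y(1) by auto
    hence "y \<in> mker B" unfolding mker_append_rows[OF B1 B2] using c(1) mker_iff[OF B1] y(2) B1 by simp
    thus "x \<in> vprod {0\<^sub>v m1} (mker B)" unfolding y(1) by (intro vprodI) auto
  next
    fix x assume "x \<in> vprod {0\<^sub>v m1} (mker B)"
    then obtain y where y: "x = 0\<^sub>v m1 @\<^sub>v y" "y \<in> mker B1" "y \<in> mker B2"
      unfolding mker_append_rows[OF B1 B2] by (auto elim: vprodE)
    have yc: "y \<in> carrier_vec n" "B1 *\<^sub>v y = 0\<^sub>v m1" using y mker_iff[OF B1] by auto
    have "A1 *\<^sub>v 0\<^sub>v m1 + B1 *\<^sub>v y = 0\<^sub>v m1" using c(1) yc by simp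
    moreover have "0\<^sub>v m1 \<in> mker (mat_adjoint B1)" by (rule lin_subD(2)[OF lin_sub_mker[OF c(4)]])
    ultimately show "x \<in> {x \<in> ?L. ?f x = 0\<^sub>v m1}"
      unfolding y(1) using ker[OF zero_carrier_vec yc(1)] y(3) vec_first_append[OF zero_carrier_vec] by simp
  qed
  ultimately have "vdim m1 K + vdim n (mker B) = vdim (m1 + n) ?L"
    using rank_nullity[OF l L] vdim_vprod[OF lin_sub_zero lin_sub_mker[OF carriers(3)], of m1] vdim_zero[of m1] by simp
  thus ?thesis using rank_mker_adjoint[OF N] rank_mker[OF carriers(3)] by simp
qed

lemma feasible_pos_attained:
  assumes X: "feasible X"
  obtains Y where "feasible Y" "pos_inertia M1 \<le> pos_inertia (pencil A1 B1 Y)"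
proof -
  note Xh = feasX[OF X]
  obtain t where t: "0 \<le> t" "pos_inertia M1 \<le> pos_inertia (pencil A1 B1 (X + complex_of_real (- t) \<cdot>\<^sub>m 1\<^sub>m n))"
    by (rule pencil_pos_attained[OF M1 Xh(1)])
  let ?D = "complex_of_real (- t) \<cdot>\<^sub>m 1\<^sub>m n"
  have one: "1\<^sub>m n \<in> herm_mats n" by (rule hermI) auto
  have D: "?D \<in> herm_mats n" by (rule herm_smult[OF one])
  have T: "pencil A2 B2 X \<in> herm_mats m2" "pos_semidef (pencil A2 B2 X)"
    using pencil_herm[OF A2 B2 Xh(1)] X by (auto simp: feasible_def)
  have h: "pencil (pencil A2 B2 X) B2 ?D \<in> herm_mats m2" by (rule pencil_herm[OF T(1) B2 D])
  have "feasible (X + ?D)"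
  proof (rule feasible_update[OF X D])
    show "pos_semidef (pencil (pencil A2 B2 X) B2 ?D)" unfolding pos_semidef_iff[OF hermD(1)[OF h]]
    proof (intro conjI h ballI)
      fix w :: "complex vec" assume w: "w \<in> carrier_vec m2"
      let ?y = "mat_adjoint B2 *\<^sub>v w"
      have y: "?y \<in> carrier_vec n" using carriers(5) by simp
      have "qf ?D ?y = - t * Re (?y \<bullet>c ?y)"
        using qf_smult_mat[OF one_carrier_mat y, of "- t"] y by (simp add: qf_def)
      moreover have "0 \<le> t * Re (?y \<bullet>c ?y)" using t(1) cip_self_ge_0 by simp
      moreover have "0 \<le> qf (pencil A2 B2 X) w" using T pos_semidef_iff[OF hermD(1)[OF T(1)]] w by simp
      ultimately show "0 \<le> qf (pencil (pencil A2 B2 X) B2 ?D) w"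
        unfolding qf_pencil[OF hermD(1)[OF T(1)] B2 hermD(1)[OF D] w] by simp
    qed
  qed
  thus ?thesis using that t(2) by blast
qed

text \<open>If the range of \<open>A1\<close> lies in that of \<open>B1\<close>, then \<open>A1\<close> vanishes on the kernel of \<open>B1*\<close>.\<close>
lemma range_subset_facts:
  assumes sub: "mran A1 \<subseteq> mran B1"
  shows "r1 = mat_rank B1" "pos_inertia M1 = mat_rank B1" "K = mker (mat_adjoint B1)"
proof -
  have z: "A1 *\<^sub>v k = 0\<^sub>v m1" if k: "k \<in> mker (mat_adjoint B1)" for k
  proof (rule eq_zero_vecI)
    have kc: "k \<in> carrier_vec m1" using k mker_iff[OF carriers(4)] by simp
    show "A1 *\<^sub>v k \<in> carrier_vec m1" using carriers(1) by simp
    fix x :: "complex vec" assume x: "x \<in> carrier_vec m1"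
    have "A1 *\<^sub>v x \<in> mran B1" using mranI[OF carriers(1) x] sub by auto
    then obtain y where "y \<in> carrier_vec n" "A1 *\<^sub>v x = B1 *\<^sub>v y" by (rule mranE[OF B1])
    hence "(A1 *\<^sub>v x) \<bullet>c k = 0" using k mker_adjoint_iff[OF B1] by simp
    thus "x \<bullet>c (A1 *\<^sub>v k) = 0" using herm_cip[OF A1 x kc] by simp
  qed
  have "mker A1 \<inter> mker (mat_adjoint B1) = mker (mat_adjoint B1)"
    using z mker_iff[OF carriers(1)] mker_iff[OF carriers(4)] by blast
  thus "r1 = mat_rank B1"
    using rank_append_cols[OF carriers(1) B1] hermD(2)[OF A1] rank_mker_adjoint[OF B1] by simp
  show "K = mker (mat_adjoint B1)"
  proof -
    have "A1 *\<^sub>v k \<in> (\<lambda>y. B1 *\<^sub>v y) ` mker B2" if "k \<in> mker (mat_adjoint B1)" for k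
    proof (rule image_eqI)
      show "0\<^sub>v n \<in> mker B2" by (rule lin_subD(2)[OF lin_sub_mker[OF B2]])
      show "A1 *\<^sub>v k = B1 *\<^sub>v 0\<^sub>v n" using z[OF that] B1 by simp
    qed
    thus ?thesis unfolding K_def by blast
  qed
  obtain P where P: "lin_sub m1 P" "P \<subseteq> mker (mat_adjoint B1)" "\<And>x. x \<in> P \<Longrightarrow> x \<noteq> 0\<^sub>v m1 \<Longrightarrow> 0 < qf A1 x"
    "pos_inertia M1 \<le> vdim m1 P + mat_rank B1" by (rule bordered_lower[OF M1]) blast
  have "x = 0\<^sub>v m1" if x: "x \<in> P" for x
  proof (rule ccontr)
    assume ne: "x \<noteq> 0\<^sub>v m1"
    have "A1 *\<^sub>v x = 0\<^sub>v m1" using z P(2) x by auto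
    hence "qf A1 x = 0" unfolding qf_def using lin_subD(5)[OF P(1) x] by simp
    thus False using P(3)[OF x ne] by simp
  qed
  hence "P = {0\<^sub>v m1}" using lin_subD(2)[OF P(1)] by blast
  hence "pos_inertia M1 \<le> mat_rank B1" using P(4) vdim_zero[of m1] by simp
  moreover have "vdim m1 {0\<^sub>v m1} + mat_rank B1 \<le> pos_inertia M1 + vdim m1 {0\<^sub>v m1}"
    by (rule bordered_upper[OF M1 lin_sub_zero _ _ lin_sub_zero])
       (use lin_subD(2)[OF lin_sub_mker[OF carriers(4)]] qf_zero[OF carriers(1)] in auto)
  ultimately show "pos_inertia M1 = mat_rank B1" by simp
qed

lemma rank_B_le: "mat_rank B \<le> pos_inertia M"
proof -
  have "vdim (m1 + m2) {0\<^sub>v (m1 + m2)} + mat_rank B \<le> pos_inertia M + vdim (m1 + m2) {0\<^sub>v (m1 + m2)}"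
    by (rule bordered_upper[OF M lin_sub_zero _ _ lin_sub_zero])
       (use lin_subD(2)[OF lin_sub_W] qf_zero[OF borderedD(2)[OF M]] in auto)
  thus ?thesis by simp
qed

end

section \<open>The extremal values\<close>

lemma invertible_iff_rank:
  assumes S: "(S :: complex mat) \<in> carrier_mat m m"
  shows "invertible_mat S \<longleftrightarrow> mat_rank S = m"
proof -
  have "invertible_mat S \<longleftrightarrow> det S \<noteq> 0"
  proof
    assume "invertible_mat S"
    then obtain R where R: "S * R = 1\<^sub>m m" "R * S = 1\<^sub>m (dim_row R)"
      using S unfolding invertible_mat_def inverts_mat_def by auto
    have "R \<in> carrier_mat m m"
      using arg_cong[OF R(1), of dim_col] arg_cong[OF R(2), of dim_col] S by (intro carrier_matI) auto
    hence "det S * det R = 1" using det_mult[OF S, of R] R(1) by simp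
    thus "det S \<noteq> 0" by auto
  next
    assume "det S \<noteq> 0"
    from det_non_zero_imp_unit[OF S this, of "()"]
    obtain R where "R \<in> carrier_mat m m" "R * S = 1\<^sub>m m" "S * R = 1\<^sub>m m"
      unfolding Units_def ring_mat_def by auto
    thus "invertible_mat S" using S unfolding invertible_mat_def inverts_mat_def square_mat.simps by auto
  qed
  thus ?thesis using vec_space.det_rank_iff[OF S] S by simp
qed

lemma rank_zero_iff:
  assumes S: "(S :: complex mat) \<in> carrier_mat m m"
  shows "mat_rank S = 0 \<longleftrightarrow> S = 0\<^sub>m m m"
proof
  assume "mat_rank S = 0"
  hence "vdim m (mker S) = m" using rank_mker[OF S] by simp
  hence k: "mker S = carrier_vec m"
    by (intro vdim_eq_imp_eq[OF lin_sub_mker[OF S] lin_sub_carrier lin_subD(1)[OF lin_sub_mker[OF S]]])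
       (simp add: vdim_carrier)
  show "S = 0\<^sub>m m m"
  proof (rule eq_matI)
    fix i j assume ij: "i < dim_row (0\<^sub>m m m :: complex mat)" "j < dim_col (0\<^sub>m m m :: complex mat)"
    have "unit_vec m j \<in> mker S" unfolding k by simp
    hence "S *\<^sub>v unit_vec m j = 0\<^sub>v m" using mker_iff[OF S] by blast
    hence "(S *\<^sub>v unit_vec m j) $ i = 0" using ij by simp
    thus "S $$ (i, j) = 0\<^sub>m m m $$ (i, j)" using ij S by simp
  qed (use S in auto)
next
  assume "S = 0\<^sub>m m m"
  hence "mker S = carrier_vec m" by (auto simp: mker_def zero_mat_vec)
  thus "mat_rank S = 0" using rank_mker[OF S] vdim_carrier[of m] by simp
qed

lemma Max_image_eqI:
  fixes f :: "'a \<Rightarrow> nat"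
  assumes "x \<in> T" "f x = v" "\<And>y. y \<in> T \<Longrightarrow> f y \<le> v"
  shows "Max (f ` T) = v"
proof (rule Max_eqI)
  show "finite (f ` T)" by (rule finite_subset[of _ "{..v}"]) (use assms(3) in auto)
qed (use assms in auto)

lemma Min_image_eqI:
  fixes f :: "'a \<Rightarrow> nat"
  assumes "x \<in> T" "f x = v" "\<And>y. y \<in> T \<Longrightarrow> v \<le> f y" "\<And>y. y \<in> T \<Longrightarrow> f y \<le> b"
  shows "Min (f ` T) = v"
proof (rule Min_eqI)
  show "finite (f ` T)" by (rule finite_subset[of _ "{..b}"]) (use assms(4) in auto)
qed (use assms in auto)

theorem theorem3p4:
  fixes m1 m2 n :: nat
    and A1 A2 B1 B2 M N M1 :: "complex mat"
    and S :: "complex mat \<Rightarrow> complex mat"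
    and T2 :: "complex mat set"
  assumes A1: "A1 \<in> herm_mats m1" and A2: "A2 \<in> herm_mats m2"
    and B1: "B1 \<in> carrier_mat m1 n" and B2: "B2 \<in> carrier_mat m2 n"
    and M: "M = (A1             @\<^sub>c 0\<^sub>m m1 m2      @\<^sub>c B1) @\<^sub>r
                (0\<^sub>m m2 m1      @\<^sub>c (- A2)         @\<^sub>c B2) @\<^sub>r
                (mat_adjoint B1 @\<^sub>c mat_adjoint B2 @\<^sub>c 0\<^sub>m n n)"
    and N: "N = (A1             @\<^sub>c B1       @\<^sub>c 0\<^sub>m m1 m2) @\<^sub>r
                (mat_adjoint B1 @\<^sub>c 0\<^sub>m n n @\<^sub>c mat_adjoint B2)"
    and M1: "M1 = (A1             @\<^sub>c B1) @\<^sub>r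
                  (mat_adjoint B1 @\<^sub>c 0\<^sub>m n n)"
    and T2: "T2 = {X \<in> herm_mats n. B2 * X * mat_adjoint B2 \<preceq>\<^sub>L A2}"
    and S: "\<And>X. S X = A1 - B1 * X * mat_adjoint B1"
  shows
    "((\<exists>X \<in> herm_mats n. B2 * X * mat_adjoint B2 \<preceq>\<^sub>L A2) \<longleftrightarrow>
        pos_inertia ((A2 @\<^sub>c B2) @\<^sub>r (mat_adjoint B2 @\<^sub>c 0\<^sub>m n n)) = mat_rank (A2 @\<^sub>c B2)) \<and>
     ((\<exists>X \<in> herm_mats n. B2 * X * mat_adjoint B2 \<preceq>\<^sub>L A2) \<longrightarrow>
        Max ((\<lambda>X. mat_rank (S X)) ` T2) = mat_rank (A1 @\<^sub>c B1) \<and>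
        int (Min ((\<lambda>X. mat_rank (S X)) ` T2)) =
          2 * int (mat_rank (A1 @\<^sub>c B1)) + int (pos_inertia M) - int (pos_inertia M1)
            - int (mat_rank N) \<and>
        Max ((\<lambda>X. pos_inertia (S X)) ` T2) = pos_inertia M1 \<and>
        int (Min ((\<lambda>X. pos_inertia (S X)) ` T2)) =
          int (mat_rank (A1 @\<^sub>c B1)) - int (mat_rank N) + int (pos_inertia M) \<and>
        int (Max ((\<lambda>X. neg_inertia (S X)) ` T2)) =
          int (neg_inertia M) - int (mat_rank (A2 @\<^sub>c B2)) \<and>
        int (Min ((\<lambda>X. neg_inertia (S X)) ` T2)) =
          int (mat_rank (A1 @\<^sub>c B1)) - int (pos_inertia M1) \<and>
        ((\<exists>X \<in> T2. invertible_mat (S X)) \<longleftrightarrow> mat_rank (A1 @\<^sub>c B1) = m1) \<and>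
        ((\<forall>X \<in> T2. invertible_mat (S X)) \<longleftrightarrow>
          mat_rank (A1 @\<^sub>c B1) = m1 \<and>
          int (pos_inertia M) = int (pos_inertia M1) + int (mat_rank N) - int m1) \<and>
        ((\<exists>X \<in> T2. B1 * X * mat_adjoint B1 = A1) \<longleftrightarrow>
          mat_range A1 \<subseteq> mat_range B1 \<and> pos_inertia M = mat_rank (B1 @\<^sub>r B2)) \<and>
        ((\<exists>X \<in> T2. B1 * X * mat_adjoint B1 \<prec>\<^sub>L A1) \<longleftrightarrow> pos_inertia M1 = m1) \<and>
        ((\<exists>X \<in> T2. A1 \<prec>\<^sub>L B1 * X * mat_adjoint B1) \<longleftrightarrow>
          neg_inertia M = mat_rank (A2 @\<^sub>c B2) + m1) \<and>
        ((\<exists>X \<in> T2. B1 * X * mat_adjoint B1 \<preceq>\<^sub>L A1) \<longleftrightarrow>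
          pos_inertia M1 = mat_rank (A1 @\<^sub>c B1)) \<and>
        ((\<exists>X \<in> T2. A1 \<preceq>\<^sub>L B1 * X * mat_adjoint B1) \<longleftrightarrow>
          int (pos_inertia M) = int (mat_rank N) - int (mat_rank (A1 @\<^sub>c B1))) \<and>
        ((\<forall>X \<in> T2. B1 * X * mat_adjoint B1 \<preceq>\<^sub>L A1) \<longleftrightarrow>
          T2 \<subseteq> {X \<in> herm_mats n. B1 * X * mat_adjoint B1 \<preceq>\<^sub>L A1}) \<and>
        ((\<forall>X \<in> T2. B1 * X * mat_adjoint B1 \<preceq>\<^sub>L A1) \<longleftrightarrow>
          neg_inertia M = mat_rank (A2 @\<^sub>c B2)) \<and>
        ((\<exists>c. \<forall>X \<in> T2. mat_rank (S X) = c) \<longleftrightarrow>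
          int (pos_inertia M) =
            int (pos_inertia M1) + int (mat_rank N) - int (mat_rank (A1 @\<^sub>c B1))) \<and>
        ((\<exists>c. \<forall>X \<in> T2. pos_inertia (S X) = c) \<longleftrightarrow>
          pos_inertia M1 + mat_rank N = mat_rank (A1 @\<^sub>c B1) + pos_inertia M) \<and>
        ((\<exists>c. \<forall>X \<in> T2. neg_inertia (S X) = c) \<longleftrightarrow>
          neg_inertia M + pos_inertia M1 = mat_rank (A1 @\<^sub>c B1) + mat_rank (A2 @\<^sub>c B2)))"
proof -
  let ?N = "(A1 @\<^sub>c B1 @\<^sub>c 0\<^sub>m m1 m2) @\<^sub>r (mat_adjoint B1 @\<^sub>c 0\<^sub>m n n @\<^sub>c mat_adjoint B2)"
  have bM: "bordered (m1 + m2) n (dsum A1 A2) (B1 @\<^sub>r B2) M" unfolding M by (rule bordered_blocks3[OF A1 A2 B1 B2])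
  have bM1: "bordered m1 n A1 B1 M1" unfolding M1 by (rule bordered_blocks[OF A1 B1])
  interpret pp: pencil_pair m1 m2 n A1 A2 B1 B2 M M1 by unfold_locales (rule A1 A2 B1 B2 bM bM1)+
  have SX: "S X = pencil A1 B1 X" for X unfolding S pencil_def ..
  have le2: "B2 * X * mat_adjoint B2 \<preceq>\<^sub>L A2 \<longleftrightarrow> pos_semidef (pencil A2 B2 X)" for X
    unfolding loewner_le_def pencil_def ..
  have T2f: "X \<in> T2 \<longleftrightarrow> pp.feasible X" for X unfolding T2 pp.feasible_def le2 by simp
  have feas: "(\<exists>X \<in> herm_mats n. B2 * X * mat_adjoint B2 \<preceq>\<^sub>L A2) \<longleftrightarrow>
        pos_inertia ((A2 @\<^sub>c B2) @\<^sub>r (mat_adjoint B2 @\<^sub>c 0\<^sub>m n n)) = mat_rank (A2 @\<^sub>c B2)"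
    unfolding le2 by (rule feasible_iff[OF bordered_blocks[OF A2 B2]])
  define r1 where "r1 = mat_rank (A1 @\<^sub>c B1)"
  define r2 where "r2 = mat_rank (A2 @\<^sub>c B2)"
  define rN where "rN = mat_rank N"
  define p where "p = pos_inertia M"
  define q where "q = neg_inertia M"
  define p1 where "p1 = pos_inertia M1"
  define rk where "rk X = mat_rank (S X)" for X
  define ps where "ps X = pos_inertia (S X)" for X
  define ng where "ng X = neg_inertia (S X)" for X
  note defs = r1_def r2_def rN_def p_def q_def p1_def
  have main: "Max (rk ` T2) = r1 \<and>
        int (Min (rk ` T2)) = 2 * int r1 + int p - int p1 - int rN \<and>
        Max (ps ` T2) = p1 \<and>
        int (Min (ps ` T2)) = int r1 - int rN + int p \<and>
        int (Max (ng ` T2)) = int q - int r2 \<and>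
        int (Min (ng ` T2)) = int r1 - int p1 \<and>
        ((\<exists>X \<in> T2. invertible_mat (S X)) \<longleftrightarrow> r1 = m1) \<and>
        ((\<forall>X \<in> T2. invertible_mat (S X)) \<longleftrightarrow> r1 = m1 \<and> int p = int p1 + int rN - int m1) \<and>
        ((\<exists>X \<in> T2. B1 * X * mat_adjoint B1 = A1) \<longleftrightarrow>
          mat_range A1 \<subseteq> mat_range B1 \<and> p = mat_rank (B1 @\<^sub>r B2)) \<and>
        ((\<exists>X \<in> T2. B1 * X * mat_adjoint B1 \<prec>\<^sub>L A1) \<longleftrightarrow> p1 = m1) \<and>
        ((\<exists>X \<in> T2. A1 \<prec>\<^sub>L B1 * X * mat_adjoint B1) \<longleftrightarrow> q = r2 + m1) \<and>
        ((\<exists>X \<in> T2. B1 * X * mat_adjoint B1 \<preceq>\<^sub>L A1) \<longleftrightarrow> p1 = r1) \<and>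
        ((\<exists>X \<in> T2. A1 \<preceq>\<^sub>L B1 * X * mat_adjoint B1) \<longleftrightarrow> int p = int rN - int r1) \<and>
        ((\<forall>X \<in> T2. B1 * X * mat_adjoint B1 \<preceq>\<^sub>L A1) \<longleftrightarrow>
          T2 \<subseteq> {X \<in> herm_mats n. B1 * X * mat_adjoint B1 \<preceq>\<^sub>L A1}) \<and>
        ((\<forall>X \<in> T2. B1 * X * mat_adjoint B1 \<preceq>\<^sub>L A1) \<longleftrightarrow> q = r2) \<and>
        ((\<exists>c. \<forall>X \<in> T2. rk X = c) \<longleftrightarrow> int p = int p1 + int rN - int r1) \<and>
        ((\<exists>c. \<forall>X \<in> T2. ps X = c) \<longleftrightarrow> p1 + rN = r1 + p) \<and>
        ((\<exists>c. \<forall>X \<in> T2. ng X = c) \<longleftrightarrow> q + p1 = r1 + r2)"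
    if ex: "\<exists>X \<in> herm_mats n. B2 * X * mat_adjoint B2 \<preceq>\<^sub>L A2"
  proof -
    have ex': "\<exists>X. pp.feasible X" using ex unfolding le2 pp.feasible_def by blast
    then obtain X0 where X0: "pp.feasible X0" by blast
    have Xh: "X \<in> herm_mats n" if "X \<in> T2" for X using that unfolding T2 by simp
    have Sh: "S X \<in> herm_mats m1" "S X \<in> carrier_mat m1 m1" if "X \<in> T2" for X
      using pencil_herm[OF A1 B1 Xh[OF that]] hermD(1) unfolding SX by auto
    have rN: "rN + vdim m1 pp.K = m1 + mat_rank (B1 @\<^sub>r B2)"
      unfolding rN_def N by (rule pp.rank_N[OF X0])
    have rkeq: "rk X = ps X + ng X" if "X \<in> T2" for X
      unfolding rk_def ps_def ng_def by (rule rank_eq_inertia[OF Sh(1)[OF that]])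
    have ps_le: "ps X \<le> p1" if "X \<in> T2" for X
      unfolding ps_def p1_def SX by (rule pencil_pos_le[OF bM1 Xh[OF that]])
    have ng_ge: "r1 \<le> ng X + p1" if "X \<in> T2" for X
      unfolding ng_def p1_def r1_def SX by (rule pencil_neg_ge[OF bM1 Xh[OF that]])
    have rk_le: "rk X \<le> r1" if "X \<in> T2" for X
      unfolding rk_def r1_def SX by (rule pencil_rank_le[OF bM1 Xh[OF that]])
    have rk_m1: "rk X \<le> m1" if "X \<in> T2" for X
      using rank_mker[OF Sh(2)[OF that]] unfolding rk_def by simp
    have ng_le: "ng X + r2 \<le> q" if "X \<in> T2" for X
      using pp.neg_upper[of X] that unfolding T2f ng_def r2_def q_def SX by simp
    have ps_ge: "r1 + p \<le> ps X + rN" if "X \<in> T2" for X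
      using pp.pos_lower[of X] that rN unfolding T2f ps_def r1_def p_def SX by simp
    \<comment> \<open>\<open>Xa\<close> has maximal positive inertia, \<open>Xb\<close> maximal negative inertia, and \<open>Xc\<close> minimal inertias of both signs\<close>
    obtain Xa where Xa: "Xa \<in> T2" "p1 \<le> ps Xa"
      using pp.feasible_pos_attained[OF X0] unfolding T2f ps_def p1_def SX by blast
    obtain Xb where Xb: "Xb \<in> T2" "q \<le> ng Xb + r2"
      using pp.neg_max_attained[OF ex'] unfolding T2f ng_def q_def r2_def SX by blast
    obtain Xc where Xc: "Xc \<in> T2" "ng Xc + p1 \<le> r1" "ps Xc + rN \<le> r1 + p"
    proof -
      obtain X where X: "pp.feasible X" "neg_inertia (pencil A1 B1 X) + pos_inertia M1 \<le> mat_rank (A1 @\<^sub>c B1)"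
        "pos_inertia (pencil A1 B1 X) + mat_rank (B1 @\<^sub>r B2) + m1 \<le> pos_inertia M + vdim m1 pp.K + mat_rank (A1 @\<^sub>c B1)"
        by (rule pp.min_attained[OF ex'])
      show ?thesis
        by (rule that[of X]) (use X rN in \<open>simp_all add: T2f ng_def ps_def p_def p1_def r1_def SX\<close>)
    qed
    note a = rkeq[OF Xa(1)] ps_le[OF Xa(1)] ng_ge[OF Xa(1)] rk_le[OF Xa(1)] ng_le[OF Xa(1)] ps_ge[OF Xa(1)] rk_m1[OF Xa(1)] Xa(2)
    note b = rkeq[OF Xb(1)] ps_le[OF Xb(1)] ng_ge[OF Xb(1)] rk_le[OF Xb(1)] ng_le[OF Xb(1)] ps_ge[OF Xb(1)] rk_m1[OF Xb(1)] Xb(2)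
    note c = rkeq[OF Xc(1)] ps_le[OF Xc(1)] ng_ge[OF Xc(1)] rk_le[OF Xc(1)] ng_le[OF Xc(1)] ps_ge[OF Xc(1)] rk_m1[OF Xc(1)] Xc(2,3)
    have inv: "invertible_mat (S X) \<longleftrightarrow> rk X = m1" if "X \<in> T2" for X
      unfolding rk_def by (rule invertible_iff_rank[OF Sh(2)[OF that]])
    have neg: "B1 * X * mat_adjoint B1 - A1 = - S X" if "X \<in> T2" for X
      using hermD(1)[OF A1] hermD(1)[OF Xh[OF that]] B1 unfolding S by (intro eq_matI) auto
    have lt: "B1 * X * mat_adjoint B1 \<prec>\<^sub>L A1 \<longleftrightarrow> ps X = m1" if "X \<in> T2" for X
      unfolding loewner_less_def S[symmetric] ps_def by (rule pos_def_inertia[OF Sh(1)[OF that]])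
    have gt: "A1 \<prec>\<^sub>L B1 * X * mat_adjoint B1 \<longleftrightarrow> ng X = m1" if "X \<in> T2" for X
      unfolding loewner_less_def neg[OF that] ng_def inertia_uminus(1)[OF Sh(1)[OF that], symmetric]
      by (rule pos_def_inertia[OF herm_uminus[OF Sh(1)[OF that]]])
    have le: "B1 * X * mat_adjoint B1 \<preceq>\<^sub>L A1 \<longleftrightarrow> ng X = 0" if "X \<in> T2" for X
      unfolding loewner_le_def S[symmetric] ng_def by (rule pos_semidef_inertia[OF Sh(1)[OF that]])
    have ge: "A1 \<preceq>\<^sub>L B1 * X * mat_adjoint B1 \<longleftrightarrow> ps X = 0" if "X \<in> T2" for X
      unfolding loewner_le_def neg[OF that] ps_def inertia_uminus(2)[OF Sh(1)[OF that], symmetric]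
      by (rule pos_semidef_inertia[OF herm_uminus[OF Sh(1)[OF that]]])
    have eq: "B1 * X * mat_adjoint B1 = A1 \<longleftrightarrow> rk X = 0" if "X \<in> T2" for X
    proof -
      have "rk X = 0 \<longleftrightarrow> S X = 0\<^sub>m m1 m1" unfolding rk_def by (rule rank_zero_iff[OF Sh(2)[OF that]])
      also have "\<dots> \<longleftrightarrow> B1 * X * mat_adjoint B1 = A1"
      proof
        assume z: "S X = 0\<^sub>m m1 m1"
        have c: "B1 * X * mat_adjoint B1 \<in> carrier_mat m1 m1" using B1 hermD(1)[OF Xh[OF that]] by (intro carrier_matI) auto
        show "B1 * X * mat_adjoint B1 = A1"
        proof (rule eq_matI)
          fix i j assume ij: "i < dim_row A1" "j < dim_col A1"
          hence "S X $$ (i, j) = 0" unfolding z using hermD(1)[OF A1] by simp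
          moreover have "S X $$ (i, j) = A1 $$ (i, j) - (B1 * X * mat_adjoint B1) $$ (i, j)"
            unfolding S by (rule index_minus_mat(1)) (use ij carrier_matD[OF c] carrier_matD[OF hermD(1)[OF A1]] in simp_all)
          ultimately show "(B1 * X * mat_adjoint B1) $$ (i, j) = A1 $$ (i, j)" by simp
        qed (use c hermD(1)[OF A1] in auto)
      next
        assume "B1 * X * mat_adjoint B1 = A1"
        thus "S X = 0\<^sub>m m1 m1" unfolding S using hermD(1)[OF A1] by (simp add: minus_r_inv_mat)
      qed
      finally show ?thesis by simp
    qed
    have rangeC: "(\<exists>X \<in> T2. B1 * X * mat_adjoint B1 = A1) \<longleftrightarrow>
          mat_range A1 \<subseteq> mat_range B1 \<and> p = mat_rank (B1 @\<^sub>r B2)"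
    proof -
      have facts: "r1 = mat_rank B1" "p1 = mat_rank B1" "rN = mat_rank B1 + mat_rank (B1 @\<^sub>r B2)"
        if "mat_range A1 \<subseteq> mat_range B1"
      proof -
        have s: "mran A1 \<subseteq> mran B1" using that unfolding mat_range_eq .
        show "r1 = mat_rank B1" "p1 = mat_rank B1" using pp.range_subset_facts[OF s] unfolding r1_def p1_def by auto
        show "rN = mat_rank B1 + mat_rank (B1 @\<^sub>r B2)"
          using rN rank_mker_adjoint[OF B1] unfolding pp.range_subset_facts(3)[OF s] by simp
      qed
      have B_le: "mat_rank (B1 @\<^sub>r B2) \<le> p" unfolding p_def by (rule pp.rank_B_le)
      show ?thesis
      proof
        assume "\<exists>X \<in> T2. B1 * X * mat_adjoint B1 = A1"
        then obtain X where X: "X \<in> T2" "B1 * X * mat_adjoint B1 = A1" by blast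
        have s: "mat_range A1 \<subseteq> mat_range B1"
        proof
          fix z assume "z \<in> mat_range A1"
          hence "z \<in> mran A1" unfolding mat_range_eq .
          then obtain v where v: "v \<in> carrier_vec m1" "z = A1 *\<^sub>v v" by (rule mranE[OF hermD(1)[OF A1]])
          have BX: "B1 * X \<in> carrier_mat m1 n" using B1 hermD(1)[OF Xh[OF X(1)]] by simp
          have "z = (B1 * X * mat_adjoint B1) *\<^sub>v v" using v X(2) by simp
          also have "\<dots> = (B1 * X) *\<^sub>v (mat_adjoint B1 *\<^sub>v v)" by (rule assoc_mult_mat_vec[OF BX pp.carriers(4) v(1)])
          also have "\<dots> = B1 *\<^sub>v (X *\<^sub>v (mat_adjoint B1 *\<^sub>v v))"
            by (rule assoc_mult_mat_vec[OF B1 hermD(1)[OF Xh[OF X(1)]] mat_vec_carrier[OF pp.carriers(4)]])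
          finally show "z \<in> mat_range B1" unfolding mat_range_eq
            using mranI[OF B1 mat_vec_carrier[OF hermD(1)[OF Xh[OF X(1)]]]] by simp
        qed
        have "rk X = 0" using eq[OF X(1)] X(2) by simp
        hence "ps X = 0" using rkeq[OF X(1)] by simp
        thus "mat_range A1 \<subseteq> mat_range B1 \<and> p = mat_rank (B1 @\<^sub>r B2)"
          using s facts[OF s] B_le ps_ge[OF X(1)] by simp
      next
        assume h: "mat_range A1 \<subseteq> mat_range B1 \<and> p = mat_rank (B1 @\<^sub>r B2)"
        hence "rk Xc = 0" using facts c by simp
        thus "\<exists>X \<in> T2. B1 * X * mat_adjoint B1 = A1" using eq[OF Xc(1)] Xc(1) by blast
      qed
    qed
    have Mx: "Max (rk ` T2) = r1" by (rule Max_image_eqI[OF Xa(1)]) (use a rk_le in auto)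
    have Mn: "Min (rk ` T2) = rk Xc"
      by (rule Min_image_eqI[OF Xc(1) refl _ rk_le]) (use c rkeq ng_ge ps_ge in fastforce)
    have Px: "Max (ps ` T2) = p1" by (rule Max_image_eqI[OF Xa(1)]) (use a ps_le in auto)
    have Pn: "Min (ps ` T2) = ps Xc"
      by (rule Min_image_eqI[OF Xc(1) refl _ ps_le]) (use c ps_ge in fastforce)
    have Nx: "Max (ng ` T2) = ng Xb" by (rule Max_image_eqI[OF Xb(1) refl]) (use b ng_le in fastforce)
    have ngb: "ng X \<le> q" if "X \<in> T2" for X using ng_le[OF that] by simp
    have Nn: "Min (ng ` T2) = ng Xc"
      by (rule Min_image_eqI[OF Xc(1) refl _ ngb]) (use c ng_ge in fastforce)
    show ?thesis
    proof (intro conjI)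
      show "Max (rk ` T2) = r1" by (rule Mx)
      show "int (Min (rk ` T2)) = 2 * int r1 + int p - int p1 - int rN" unfolding Mn using c by linarith
      show "Max (ps ` T2) = p1" by (rule Px)
      show "int (Min (ps ` T2)) = int r1 - int rN + int p" unfolding Pn using c by linarith
      show "int (Max (ng ` T2)) = int q - int r2" unfolding Nx using b by linarith
      show "int (Min (ng ` T2)) = int r1 - int p1" unfolding Nn using c by linarith
      show "(\<exists>X \<in> T2. invertible_mat (S X)) \<longleftrightarrow> r1 = m1"
      proof
        assume "\<exists>X \<in> T2. invertible_mat (S X)"
        then obtain X where X: "X \<in> T2" "rk X = m1" using inv by blast
        show "r1 = m1" using rk_le[OF X(1)] X(2) a by linarith
      next
        assume "r1 = m1"
        hence "rk Xa = m1" using a by linarith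
        thus "\<exists>X \<in> T2. invertible_mat (S X)" using inv[OF Xa(1)] Xa(1) by blast
      qed
      show "(\<forall>X \<in> T2. invertible_mat (S X)) \<longleftrightarrow> r1 = m1 \<and> int p = int p1 + int rN - int m1"
      proof
        assume h: "\<forall>X \<in> T2. invertible_mat (S X)"
        have "rk Xc = m1" "rk Xa = m1" using h inv Xa(1) Xc(1) by blast+
        thus "r1 = m1 \<and> int p = int p1 + int rN - int m1" using a c by linarith
      next
        assume h: "r1 = m1 \<and> int p = int p1 + int rN - int m1"
        show "\<forall>X \<in> T2. invertible_mat (S X)"
        proof
          fix X assume X: "X \<in> T2"
          have "rk X = m1" using h rkeq[OF X] ps_ge[OF X] ng_ge[OF X] rk_le[OF X] by linarith
          thus "invertible_mat (S X)" using inv[OF X] by simp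
        qed
      qed
      show "(\<exists>X \<in> T2. B1 * X * mat_adjoint B1 = A1) \<longleftrightarrow>
          mat_range A1 \<subseteq> mat_range B1 \<and> p = mat_rank (B1 @\<^sub>r B2)" by (rule rangeC)
      show "(\<exists>X \<in> T2. B1 * X * mat_adjoint B1 \<prec>\<^sub>L A1) \<longleftrightarrow> p1 = m1"
      proof
        assume "\<exists>X \<in> T2. B1 * X * mat_adjoint B1 \<prec>\<^sub>L A1"
        then obtain X where X: "X \<in> T2" "ps X = m1" using lt by blast
        show "p1 = m1" using ps_le[OF X(1)] X(2) a by linarith
      next
        assume "p1 = m1"
        hence "ps Xa = m1" using a by linarith
        thus "\<exists>X \<in> T2. B1 * X * mat_adjoint B1 \<prec>\<^sub>L A1" using lt[OF Xa(1)] Xa(1) by blast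
      qed
      show "(\<exists>X \<in> T2. A1 \<prec>\<^sub>L B1 * X * mat_adjoint B1) \<longleftrightarrow> q = r2 + m1"
      proof
        assume "\<exists>X \<in> T2. A1 \<prec>\<^sub>L B1 * X * mat_adjoint B1"
        then obtain X where X: "X \<in> T2" "ng X = m1" using gt by blast
        show "q = r2 + m1" using ng_le[OF X(1)] X(2) b by linarith
      next
        assume "q = r2 + m1"
        hence "ng Xb = m1" using b by linarith
        thus "\<exists>X \<in> T2. A1 \<prec>\<^sub>L B1 * X * mat_adjoint B1" using gt[OF Xb(1)] Xb(1) by blast
      qed
      show "(\<exists>X \<in> T2. B1 * X * mat_adjoint B1 \<preceq>\<^sub>L A1) \<longleftrightarrow> p1 = r1"
      proof
        assume "\<exists>X \<in> T2. B1 * X * mat_adjoint B1 \<preceq>\<^sub>L A1"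
        then obtain X where X: "X \<in> T2" "ng X = 0" using le by blast
        show "p1 = r1" using ng_ge[OF X(1)] X(2) a by linarith
      next
        assume "p1 = r1"
        hence "ng Xc = 0" using c by linarith
        thus "\<exists>X \<in> T2. B1 * X * mat_adjoint B1 \<preceq>\<^sub>L A1" using le[OF Xc(1)] Xc(1) by blast
      qed
      show "(\<exists>X \<in> T2. A1 \<preceq>\<^sub>L B1 * X * mat_adjoint B1) \<longleftrightarrow> int p = int rN - int r1"
      proof
        assume "\<exists>X \<in> T2. A1 \<preceq>\<^sub>L B1 * X * mat_adjoint B1"
        then obtain X where X: "X \<in> T2" "ps X = 0" using ge by blast
        show "int p = int rN - int r1" using ps_ge[OF X(1)] X(2) c by linarith
      next
        assume "int p = int rN - int r1"
        hence "ps Xc = 0" using c by linarith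
        thus "\<exists>X \<in> T2. A1 \<preceq>\<^sub>L B1 * X * mat_adjoint B1" using ge[OF Xc(1)] Xc(1) by blast
      qed
      show "(\<forall>X \<in> T2. B1 * X * mat_adjoint B1 \<preceq>\<^sub>L A1) \<longleftrightarrow>
          T2 \<subseteq> {X \<in> herm_mats n. B1 * X * mat_adjoint B1 \<preceq>\<^sub>L A1}" using Xh by blast
      show "(\<forall>X \<in> T2. B1 * X * mat_adjoint B1 \<preceq>\<^sub>L A1) \<longleftrightarrow> q = r2"
      proof
        assume "\<forall>X \<in> T2. B1 * X * mat_adjoint B1 \<preceq>\<^sub>L A1"
        hence "ng Xb = 0" using le[OF Xb(1)] Xb(1) by blast
        thus "q = r2" using b by linarith
      next
        assume "q = r2"
        thus "\<forall>X \<in> T2. B1 * X * mat_adjoint B1 \<preceq>\<^sub>L A1" using le ng_le by fastforce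
      qed
      show "(\<exists>c. \<forall>X \<in> T2. rk X = c) \<longleftrightarrow> int p = int p1 + int rN - int r1"
      proof
        assume "\<exists>c. \<forall>X \<in> T2. rk X = c"
        hence "rk Xa = rk Xc" using Xa(1) Xc(1) by fastforce
        thus "int p = int p1 + int rN - int r1" using a c by linarith
      next
        assume h: "int p = int p1 + int rN - int r1"
        have "rk X = r1" if X: "X \<in> T2" for X
          using h rkeq[OF X] ps_ge[OF X] ng_ge[OF X] rk_le[OF X] by linarith
        thus "\<exists>c. \<forall>X \<in> T2. rk X = c" by blast
      qed
      show "(\<exists>c. \<forall>X \<in> T2. ps X = c) \<longleftrightarrow> p1 + rN = r1 + p"
      proof
        assume "\<exists>c. \<forall>X \<in> T2. ps X = c"
        hence "ps Xa = ps Xc" using Xa(1) Xc(1) by fastforce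
        thus "p1 + rN = r1 + p" using a c by linarith
      next
        assume h: "p1 + rN = r1 + p"
        have "ps X = p1" if X: "X \<in> T2" for X
          using h ps_ge[OF X] ps_le[OF X] by linarith
        thus "\<exists>c. \<forall>X \<in> T2. ps X = c" by blast
      qed
      show "(\<exists>c. \<forall>X \<in> T2. ng X = c) \<longleftrightarrow> q + p1 = r1 + r2"
      proof
        assume "\<exists>c. \<forall>X \<in> T2. ng X = c"
        hence "ng Xb = ng Xc" using Xb(1) Xc(1) by fastforce
        thus "q + p1 = r1 + r2" using b c by linarith
      next
        assume h: "q + p1 = r1 + r2"
        have "ng X + r2 = q" if X: "X \<in> T2" for X
          using h ng_ge[OF X] ng_le[OF X] by linarith
        hence "\<forall>X \<in> T2. ng X = q - r2" by fastforce
        thus "\<exists>c. \<forall>X \<in> T2. ng X = c" by blast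
      qed
    qed
  qed
  show ?thesis
    by (rule conjI[OF feas impI[OF main[unfolded defs rk_def[abs_def] ps_def[abs_def] ng_def[abs_def]]]])
qed

end
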